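(* Let $p>1$ and $f(x)=(x+1)^p$. Let $\mathcal W(\cdot)$ be the continuous-time process built from independent exponential random variables with kernel $f$, let $\mathcal S$ be its tree explosion time, and let $0=\mathcal B_0<\mathcal B_1<\mathcal B_2<\cdots$ be the increasing enumeration of the birth times that are smaller than $\mathcal S$. Then the sequence $\{T_n\equiv\mathcal W(\mathcal B_n)\}_{n\ge0}$ is identical in law to the labelled $\mathsf{GN}$ process with attachment kernel $f$. Moreover, almost surely, $T_n\to T_\infty\equiv\mathcal W(\mathcal S)$ as $n\to+\infty$ (i.e. the increasing sets $T_n$ have union $\mathcal W(\mathcal S)$).
   Context: $\mathbb N=\{1,2,3,\dots\}$ and $\mathbb N^*$ is the set of all finite sequences $a=a_1\dots a_m$ of elements of $\mathbb N$, including the empty sequence $\epsilon$. The parent sequence of $a_1\dots a_m$ ($m\ge1$) is $a_1\dots a_{m-1}$; $ab$ denotes concatenation. A set $A\subset\mathbb N^*$ is parent-closed if it is non-empty and contains the parent sequence of each of its non-empty elements; it is viewed as a tree rooted at $\epsilon$ in which every non-empty $a\in A$ is a child of its parent sequence. $\mathrm d_A(a)$ is the number of children of $a$ in $A$. Labelled $\mathsf{GN}$ process with attachment kernel $f$: the discrete-time Markov chain on finite parent-closed subsets of $\mathbb N^*$ started from $\{\epsilon\}$, with transition probabilities $\Pi(A,B)=f(\mathrm d_A(a))/\sum_{b\in A}f(\mathrm d_A(b))$ if $B=A\cup\{a(\mathrm d_A(a)+1)\}$ for some $a\in A$, and $\Pi(A,B)=0$ otherwise. Continuous-time process: let $\{X(a,j):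 a\in\mathbb N^*, j\in\mathbb N\cup\{0\}\}$ be independent random variables, $X(a,j)$ exponential with rate $f(j)$. Birth times are defined by $\mathcal B(\epsilon)=0$ and $\mathcal B(a_1\dots a_n)=\mathcal B(a_1\dots a_{n-1})+\sum_{j=0}^{a_n-1}X(a_1\dots a_{n-1},j)$. Set $\mathcal W(t)=\{a\in\mathbb N^*:\mathcal B(a)\le t\}$, $\mathcal P(a)=\sum_{j=0}^{\infty}X(a,j)$ (the explosion time of $a$), and $\mathcal S=\inf_{a\in\mathbb N^*}(\mathcal B(a)+\mathcal P(a))$ (the tree explosion time). Almost surely, the birth times $\mathcal B(a)$ that are smaller than $\mathcal S$ are pairwise distinct and, in their usual order, have order type $\omega$, so that the enumeration $\mathcal B_0<\mathcal B_1<\cdots$ is well defined. *)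

theory Defs
  imports "HOL-Probability.Probability"
begin

text \<open>A finite sequence of positive integers is a list whose entries are all positive; \<open>[]\<close> is the
  empty sequence, \<open>butlast a\<close> the parent sequence of a non-empty \<open>a\<close>, and \<open>last a\<close> its last entry.\<close>

definition nat_seqs :: "nat list set" where
  "nat_seqs = {a. \<forall>k\<in>set a. 1 \<le> k}"

definition parent_closed :: "nat list set \<Rightarrow> bool" where
  "parent_closed A \<longleftrightarrow> A \<subseteq> nat_seqs \<and> A \<noteq> {} \<and> (\<forall>a\<in>A. a \<noteq> [] \<longrightarrow> butlast a \<in> A)"

definition nchildren :: "nat list set \<Rightarrow> nat list \<Rightarrow> nat" where
  "nchildren A a = card {b\<in>A. b \<noteq> [] \<and> butlast b = a}"

definition add_child :: "nat list set \<Rightarrow> nat list \<Rightarrow> nat list set" where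
  "add_child A a = A \<union> {a @ [nchildren A a + 1]}"

text \<open>The vertices \<open>a\<close> with \<open>B = add_child A a\<close> are summed over. On the trees reached from \<open>{[]}\<close> the
  children of each vertex carry the labels \<open>1, \<dots>, nchildren A a\<close>, so there is at most one such \<open>a\<close>
  and the sum is the single quotient \<open>f (nchildren A a) / (\<Sum>b\<in>A. f (nchildren A b))\<close>, or \<open>0\<close>.\<close>

definition GN_trans :: "(nat \<Rightarrow> real) \<Rightarrow> nat list set \<Rightarrow> nat list set \<Rightarrow> real" where
  "GN_trans f A B =
     (\<Sum>a\<in>{a\<in>A. B = add_child A a}. f (nchildren A a) / (\<Sum>b\<in>A. f (nchildren A b)))"

definition GN_step :: "(nat \<Rightarrow> real) \<Rightarrow> nat list set \<Rightarrow> nat list set pmf" where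
  "GN_step f A = embed_pmf (GN_trans f A)"

text \<open>The law of the state at time \<open>n\<close> given the states \<open>x 0, \<dots>, x (n - 1)\<close>.\<close>

definition GN_kernel ::
    "(nat \<Rightarrow> real) \<Rightarrow> nat \<Rightarrow> (nat \<Rightarrow> nat list set) \<Rightarrow> nat list set measure" where
  "GN_kernel f n x = measure_pmf (case n of 0 \<Rightarrow> return_pmf {[]} | Suc m \<Rightarrow> GN_step f (x m))"

text \<open>Random sets of sequences are measured by the \<open>\<sigma>\<close>-algebra that the events
  \<open>{A. a \<in> A}\<close> generate. It contains every singleton, hence every set of finite trees.\<close>

definition tree_space :: "nat list set measure" where
  "tree_space = sigma UNIV (range (\<lambda>a. {A. a \<in> A}))"

definition tree_path_space :: "(nat \<Rightarrow> nat list set) measure" where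
  "tree_path_space = PiM UNIV (\<lambda>_. tree_space)"

text \<open>The law of the whole trajectory: the Ionescu-Tulcea limit of the one-step kernels, restricted
  to the \<open>\<sigma>\<close>-algebra of \<^const>\<open>tree_path_space\<close>.\<close>

definition GN_law :: "(nat \<Rightarrow> real) \<Rightarrow> (nat \<Rightarrow> nat list set) measure" where
  "GN_law f =
     distr (projective_family.lim UNIV
              (Ionescu_Tulcea.CI (GN_kernel f) (\<lambda>_. count_space UNIV)) (\<lambda>_. count_space UNIV))
       tree_path_space (\<lambda>x. x)"

function birth :: "(nat list \<Rightarrow> nat \<Rightarrow> 'w \<Rightarrow> real) \<Rightarrow> nat list \<Rightarrow> 'w \<Rightarrow> real" where
  "birth X a \<omega> =
     (if a = [] then 0 else birth X (butlast a) \<omega> + (\<Sum>j<last a. X (butlast a) j \<omega>))"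
  by auto
termination by (relation "Wellfounded.measure (\<lambda>(X, a, \<omega>). length a)") auto

declare birth.simps [simp del]

definition explosion :: "(nat list \<Rightarrow> nat \<Rightarrow> 'w \<Rightarrow> real) \<Rightarrow> nat list \<Rightarrow> 'w \<Rightarrow> ereal" where
  "explosion X a \<omega> = (\<Sum>j. ereal (X a j \<omega>))"

definition tree_explosion :: "(nat list \<Rightarrow> nat \<Rightarrow> 'w \<Rightarrow> real) \<Rightarrow> 'w \<Rightarrow> ereal" where
  "tree_explosion X \<omega> = (INF a\<in>nat_seqs. ereal (birth X a \<omega>) + explosion X a \<omega>)"

definition alive :: "(nat list \<Rightarrow> nat \<Rightarrow> 'w \<Rightarrow> real) \<Rightarrow> ereal \<Rightarrow> 'w \<Rightarrow> nat list set" where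
  "alive X t \<omega> = {a\<in>nat_seqs. ereal (birth X a \<omega>) \<le> t}"

definition early_births :: "(nat list \<Rightarrow> nat \<Rightarrow> 'w \<Rightarrow> real) \<Rightarrow> 'w \<Rightarrow> real set" where
  "early_births X \<omega> =
     {birth X a \<omega> | a. a \<in> nat_seqs \<and> ereal (birth X a \<omega>) < tree_explosion X \<omega>}"

text \<open>A strictly increasing enumeration of a set of reals by \<^typ>\<open>nat\<close> is unique if it exists, that
  is, if the set has order type \<open>\<omega>\<close>; on the other outcomes the value is unspecified.\<close>

definition birth_enum :: "(nat list \<Rightarrow> nat \<Rightarrow> 'w \<Rightarrow> real) \<Rightarrow> nat \<Rightarrow> 'w \<Rightarrow> real" where
  "birth_enum X n \<omega> = (THE g. strict_mono g \<and> range g = early_births X \<omega>) n"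

definition jump_tree :: "(nat list \<Rightarrow> nat \<Rightarrow> 'w \<Rightarrow> real) \<Rightarrow> nat \<Rightarrow> 'w \<Rightarrow> nat list set" where
  "jump_tree X n \<omega> = alive X (ereal (birth_enum X n \<omega>)) \<omega>"

lemma finite_add_child: "finite A \<Longrightarrow> finite (add_child A a)"
  by (simp add: add_child_def)

lemma parent_closed_add_child:
  assumes "parent_closed A" "a \<in> A"
  shows "parent_closed (add_child A a)"
  using assms by (auto simp: parent_closed_def add_child_def nat_seqs_def)

lemma GN_trans_eq_0: "(\<And>a. a \<in> A \<Longrightarrow> B \<noteq> add_child A a) \<Longrightarrow> GN_trans f A B = 0"
  unfolding GN_trans_def by (rule sum.neutral) auto

lemma GN_trans_unique:
  assumes "a \<in> A" "B = add_child A a" "\<And>a'. a' \<in> A \<Longrightarrow> B = add_child A a' \<Longrightarrow> a' = a"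
  shows "GN_trans f A B = f (nchildren A a) / (\<Sum>b\<in>A. f (nchildren A b))"
proof -
  have "{a\<in>A. B = add_child A a} = {a}" using assms by auto
  then show ?thesis by (simp add: GN_trans_def)
qed

lemma pmf_GN_step:
  assumes f: "\<And>j. 0 < f j" and A: "finite A" "A \<noteq> {}"
  shows "pmf (GN_step f A) B = GN_trans f A B"
proof -
  define w where "w a = f (nchildren A a) / (\<Sum>b\<in>A. f (nchildren A b))" for a
  have pos: "0 < (\<Sum>b\<in>A. f (nchildren A b))"
    using A f by (intro sum_pos) auto
  have w0: "0 \<le> w a" for a
    using pos f[of "nchildren A a"] by (simp add: w_def)
  have T: "GN_trans f A B = (\<Sum>a\<in>{a\<in>A. add_child A a = B}. w a)" for B
    unfolding GN_trans_def w_def by (rule sum.cong) auto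
  have nn: "0 \<le> GN_trans f A B" for B
    unfolding T by (rule sum_nonneg) (rule w0)
  let ?I = "add_child A ` A"
  have "(\<integral>\<^sup>+B. ennreal (GN_trans f A B) \<partial>count_space UNIV) =
        (\<Sum>B\<in>?I. ennreal (GN_trans f A B))"
  proof (rule nn_integral_count_space'[of ?I])
    show "finite ?I" using A by simp
    show "ennreal (GN_trans f A B) = 0" if "B \<notin> ?I" "B \<in> UNIV" for B
      using that by (subst GN_trans_eq_0) auto
  qed auto
  also have "\<dots> = ennreal (\<Sum>B\<in>?I. GN_trans f A B)"
    by (rule sum_ennreal) (rule nn)
  also have "(\<Sum>B\<in>?I. GN_trans f A B) = (\<Sum>a\<in>A. w a)"
    unfolding T using A(1) by (rule sum.image_gen[symmetric])
  also have "\<dots> = 1"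
    using pos by (simp add: w_def flip: sum_divide_distrib)
  finally show ?thesis
    unfolding GN_step_def by (intro pmf_embed_pmf) (auto intro: nn)
qed

lemma space_tree_space [simp]: "space tree_space = UNIV"
  by (simp add: tree_space_def space_measure_of_conv)

lemma sets_tree_space: "sets tree_space = sigma_sets UNIV (range (\<lambda>a. {A. a \<in> A}))"
  by (simp add: tree_space_def)

lemma singleton_tree_space: "{A} \<in> sets tree_space"
proof -
  have "{B. a \<in> B} \<in> sets tree_space" for a
    by (auto simp: sets_tree_space)
  moreover from this have "UNIV - {B. a \<in> B} \<in> sets tree_space" for a
    using sets.compl_sets[of _ tree_space] by simp
  ultimately have *: "{B. a \<in> B \<longleftrightarrow> a \<in> A} \<in> sets tree_space" for a
    by (cases "a \<in> A") (auto simp: set_diff_eq)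
  have "{A} = (\<Inter>a\<in>UNIV. {B. a \<in> B \<longleftrightarrow> a \<in> A})"
    by auto
  also have "\<dots> \<in> sets tree_space"
    using * by (intro sets.countable_INT) auto
  finally show ?thesis .
qed

interpretation GN: Ionescu_Tulcea "GN_kernel f" "\<lambda>_. count_space UNIV" for f
proof (rule Ionescu_Tulcea.intro)
  show "prob_space (GN_kernel f i x)" for i x
    by (simp add: GN_kernel_def measure_pmf.prob_space_axioms)
  show "GN_kernel f i \<in> PiM {0..<i} (\<lambda>_. count_space UNIV) \<rightarrow>\<^sub>M subprob_algebra (count_space UNIV)"
    for i
  proof (cases i)
    case 0
    then show ?thesis
      by (simp add: GN_kernel_def[abs_def] measure_pmf_in_subprob_algebra)
  next
    case (Suc m)
    have "(\<lambda>A. measure_pmf (GN_step f A)) \<in> count_space UNIV \<rightarrow>\<^sub>M subprob_algebra (count_space UNIV)"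
      by (simp add: measure_pmf_in_subprob_algebra)
    moreover have "(\<lambda>x. x m) \<in> PiM {0..<i} (\<lambda>_. count_space UNIV) \<rightarrow>\<^sub>M count_space UNIV"
      using Suc by (intro measurable_component_singleton) auto
    ultimately show ?thesis
      unfolding GN_kernel_def[abs_def] using Suc by (simp add: measurable_compose)
  qed
qed

lemma emeasure_GN_C:
  "emeasure (GN.C f 0 n (\<lambda>_. undefined)) (PiE {0..<n} (\<lambda>i. {A i})) =
   (\<Prod>i<n. emeasure (GN_kernel f i A) {A i})"
proof (induction n)
  case 0
  show ?case
    by (simp add: PiM_empty)
next
  case (Suc n)
  let ?P = "\<lambda>n. PiM {0..<n} (\<lambda>_. count_space UNIV :: nat list set measure)"
  let ?S = "\<lambda>n. PiE {0..<n} (\<lambda>i. {A i})"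
  have u: "(\<lambda>_. undefined) \<in> space (?P 0)"
    by (simp add: space_PiM PiE_def extensional_def)
  have S: "?S n \<in> sets (?P n)" for n
    by (intro sets_PiM_I_finite) auto
  have space: "space (GN.C f 0 n (\<lambda>_. undefined)) = space (?P n)"
    using GN.space_C[OF u, of f n] by simp
  have sets: "sets (GN.C f 0 n (\<lambda>_. undefined)) = sets (?P n)"
    using GN.sets_C[OF u, of f n] by simp
  have nonempty: "space (GN.C f 0 n (\<lambda>_. undefined)) \<noteq> {}"
    using prob_space.not_empty[OF GN.prob_space_C[OF u, of f n]] by simp
  have eP: "GN.eP f n \<in> GN.C f 0 n (\<lambda>_. undefined) \<rightarrow>\<^sub>M subprob_algebra (?P (Suc n))"
    using GN.measurable_eP[of f n] unfolding measurable_cong_sets[OF sets refl] .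
  have "emeasure (GN.C f 0 (Suc n) (\<lambda>_. undefined)) (?S (Suc n)) =
        (\<integral>\<^sup>+x. emeasure (GN.eP f n x) (?S (Suc n)) \<partial>GN.C f 0 n (\<lambda>_. undefined))"
    using emeasure_bind[OF nonempty eP S] by simp
  also have "\<dots> = (\<integral>\<^sup>+x. emeasure (GN_kernel f n A) {A n} * indicator (?S n) x
                        \<partial>GN.C f 0 n (\<lambda>_. undefined))"
  proof (rule nn_integral_cong)
    fix x assume "x \<in> space (GN.C f 0 n (\<lambda>_. undefined))"
    then have x: "x \<in> space (?P n)" using space by simp
    have xe: "x \<in> extensional {0..<n}" using x by (simp add: space_PiM PiE_def)
    show "emeasure (GN.eP f n x) (?S (Suc n)) =
          emeasure (GN_kernel f n A) {A n} * indicator (?S n) x"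
    proof (cases "x \<in> ?S n")
      case True
      then have eq: "x i = A i" if "i < n" for i
        using that by (auto simp: PiE_iff)
      have "fun_upd x n y \<in> ?S (Suc n) \<longleftrightarrow> y = A n" for y
        using xe eq by (force simp: PiE_iff extensional_def less_Suc_eq)
      then have "fun_upd x n -` ?S (Suc n) = {A n}"
        by auto
      moreover have "GN_kernel f n x = GN_kernel f n A"
        using eq by (cases n) (simp_all add: GN_kernel_def)
      ultimately show ?thesis
        using True by (simp add: GN.emeasure_eP[OF x S])
    next
      case False
      then have "\<not> (\<forall>i<n. x i = A i)"
        using xe by (simp add: PiE_iff Bex_def)
      then obtain i where "i < n" "x i \<noteq> A i"
        by blast
      then have "fun_upd x n y \<notin> ?S (Suc n)" for y
        by (force simp: PiE_iff)
      then have "fun_upd x n -` ?S (Suc n) = {}"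
        by auto
      then show ?thesis
        using False by (simp add: GN.emeasure_eP[OF x S])
    qed
  qed
  also have "\<dots> = emeasure (GN_kernel f n A) {A n} *
                  emeasure (GN.C f 0 n (\<lambda>_. undefined)) (?S n)"
    using S sets by (subst nn_integral_cmult_indicator) auto
  finally show ?case
    by (simp add: Suc.IH mult.commute)
qed

lemma GN_trans_nonzero:
  assumes "GN_trans f A B \<noteq> 0"
  obtains a where "a \<in> A" "B = add_child A a"
  using GN_trans_eq_0[of A B f] assms by blast

lemma finite_GN_path:
  assumes "A 0 = {[]}" "(\<Prod>i<n. GN_trans f (A i) (A (Suc i))) \<noteq> 0"
  shows "finite (A n) \<and> A n \<noteq> {}"
  using assms(2)
proof (induction n)
  case 0
  show ?case using assms(1) by simp
next
  case (Suc n)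
  then have "GN_trans f (A n) (A (Suc n)) \<noteq> 0" "finite (A n)"
    by simp_all
  then show ?case
    by (elim GN_trans_nonzero) (simp add: finite_add_child, simp add: add_child_def)
qed

lemma prod_GN_kernel:
  assumes f: "\<And>j. 0 < f j"
  shows "(\<Prod>i<Suc n. measure (GN_kernel f i A) {A i}) =
         (if A 0 = {[]} then \<Prod>i<n. GN_trans f (A i) (A (Suc i)) else 0)"
proof (induction n)
  case 0
  show ?case
    by (simp add: GN_kernel_def measure_pmf_single)
next
  case (Suc n)
  let ?p = "\<Prod>i<n. GN_trans f (A i) (A (Suc i))"
  have "(\<Prod>i<Suc (Suc n). measure (GN_kernel f i A) {A i}) =
        (if A 0 = {[]} then ?p else 0) * pmf (GN_step f (A n)) (A (Suc n))"
    by (subst prod.lessThan_Suc, subst Suc.IH) (simp add: GN_kernel_def measure_pmf_single)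
  also have "\<dots> = (if A 0 = {[]} then ?p * GN_trans f (A n) (A (Suc n)) else 0)"
  proof -
    have "?p * pmf (GN_step f (A n)) (A (Suc n)) = ?p * GN_trans f (A n) (A (Suc n))"
      if A0: "A 0 = {[]}" and p: "?p \<noteq> 0"
    proof -
      have A: "finite (A n)" "A n \<noteq> {}"
        using finite_GN_path[where f = f, OF A0 p] by simp_all
      show ?thesis
        by (simp only: pmf_GN_step[where f = f, OF f A])
    qed
    then have "?p * pmf (GN_step f (A n)) (A (Suc n)) = ?p * GN_trans f (A n) (A (Suc n))"
      if "A 0 = {[]}"
      using that by (cases "?p = 0") (simp_all only: mult_zero_left not_False_eq_True)
    then show ?thesis
      by (simp only: mult_zero_left split: if_split) blast
  qed
  finally show ?case
    by (simp only: prod.lessThan_Suc)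
qed

text \<open>The finite-dimensional distributions of \<^const>\<open>GN_law\<close> are those of the Markov chain started
  from \<open>{[]}\<close> with transition probabilities \<^const>\<open>GN_trans\<close>.\<close>

lemma measure_GN_law:
  assumes f: "\<And>j. 0 < f j"
  shows "measure (GN_law f) {x. \<forall>i\<le>n. x i = A i} =
         (if A 0 = {[]} then \<Prod>i<n. GN_trans f (A i) (A (Suc i)) else 0)"
proof -
  let ?N = "\<lambda>_::nat. count_space UNIV :: nat list set measure"
  let ?J = "{0..<Suc n}"
  let ?S = "PiE ?J (\<lambda>i. {A i})"
  let ?E = "{x. \<forall>i\<le>n. x i = A i}"
  have S: "?S \<in> sets (PiM ?J ?N)"
    by (intro sets_PiM_I_finite) auto
  have "?E = (\<Inter>i\<in>{..n}. {x\<in>space tree_path_space. x i \<in> {A i}})"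
    by (auto simp: tree_path_space_def space_PiM)
  also have "\<dots> \<in> sets tree_path_space"
    unfolding tree_path_space_def
    by (intro sets.finite_INT measurable_sets_Collect[OF measurable_component_singleton])
       (auto simp: singleton_tree_space)
  finally have E: "?E \<in> sets tree_path_space" .
  have id: "(\<lambda>x. x) \<in> PiM UNIV ?N \<rightarrow>\<^sub>M tree_path_space"
    unfolding tree_path_space_def
  proof (rule measurable_PiM_single')
    fix i :: nat
    have "(\<lambda>x. x i) \<in> PiM UNIV ?N \<rightarrow>\<^sub>M count_space UNIV"
      by (rule measurable_component_singleton) simp
    then show "(\<lambda>x. x i) \<in> PiM UNIV ?N \<rightarrow>\<^sub>M tree_space"
      by (rule measurable_compose) simp
  qed (auto simp: space_PiM)
  have id': "(\<lambda>x. x) \<in> GN.PF.lim f \<rightarrow>\<^sub>M tree_path_space"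
    using id unfolding measurable_cong_sets[OF GN.PF.sets_lim refl] .
  have emb: "?E = prod_emb UNIV ?N ?J ?S"
    by (auto simp: prod_emb_def space_PiM PiE_iff restrict_def less_Suc_eq_le)
  have "emeasure (GN_law f) ?E = emeasure (GN.PF.lim f) ?E"
    unfolding GN_law_def by (subst emeasure_distr[OF id' E]) (simp add: space_PiM)
  also have "\<dots> = emeasure (GN.CI f ?J) ?S"
    unfolding emb using S by (intro GN.lim) auto
  also have "\<dots> = emeasure (GN.C f 0 (Suc n) (\<lambda>_. undefined)) (prod_emb ?J ?N ?J ?S)"
    using S by (intro GN.emeasure_CI) auto
  also have "prod_emb ?J ?N ?J ?S = ?S"
    by (intro prod_emb_id) (auto simp: PiE_def)
  also have "emeasure (GN.C f 0 (Suc n) (\<lambda>_. undefined)) ?S =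
      (\<Prod>i<Suc n. emeasure (GN_kernel f i A) {A i})"
    by (rule emeasure_GN_C)
  also have "\<dots> = ennreal (\<Prod>i<Suc n. measure (GN_kernel f i A) {A i})"
    by (subst prod_ennreal[symmetric])
       (simp_all only: GN_kernel_def measure_pmf.emeasure_eq_measure measure_nonneg)
  finally have "measure (GN_law f) ?E = (\<Prod>i<Suc n. measure (GN_kernel f i A) {A i})"
    unfolding Sigma_Algebra.measure_def[of "GN_law f"]
    by (simp only: enn2real_ennreal prod_nonneg measure_nonneg)
  then show ?thesis
    by (simp only: prod_GN_kernel[where f = f, OF f])
qed

end

theory Submission
  imports Defs "HOL-Real_Asymp.Real_Asymp"
begin

text \<open>The finite-dimensional laws come from competing exponential clocks: given the first \<open>n\<close> births,
  the waiting times until the next children of the present vertices are independent exponentials by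
  memorylessness, so the next child of \<open>a\<close> comes first with probability proportional to \<open>f\<close> of the
  number of children of \<open>a\<close>.

  What makes the births before the tree explosion time \<open>S\<close> have order type \<open>\<omega>\<close> is local finiteness.
  If \<open>c @ [k]\<close> is born by a time \<open>t\<close> with \<open>t + \<epsilon> < S\<close>, then \<open>c\<close> needs more than \<open>\<epsilon>\<close> after that birth
  to explode, so one of its clocks from the \<open>k\<close>-th on exceeds its share of \<open>\<epsilon>\<close>. The expected number of
  such \<open>k\<close> is finite, hence the vertices all of whose ancestral edges have this property form a
  branching process with finite mean, only finitely many of whose members are born by time \<open>t\<close>.
  Finally no birth happens exactly at time \<open>S\<close>, because the last clock before a birth has no atoms
  and is independent of every explosion time that could compete with this birth.\<close>

section \<open>Birth times and clocks\<close>

text \<open>The time \<open>S\<close> reads every clock, so conditioning on it is hopeless. Local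
  finiteness therefore uses \<open>S\<close> only to derive, outcome by outcome, a late clock on
  every ancestral edge. These conditions read the clocks of distinct vertices, so first moments
  multiply along a path.

  For the laws, an induction over births cannot carry the probability of the history alone: the next
  competition needs the joint tails of all clocks still running, so these are proved along with it.

  Finally, sequences of arbitrary sets form an uncountable state space at each time, where
  prescribing finitely many states does not generate all events. Almost sure finiteness of the trees
  reduces the comparison of laws to countably many states.\<close>

lemma Nil_in_nat_seqs [simp]: "[] \<in> nat_seqs"
  by (simp add: nat_seqs_def)

lemma append_in_nat_seqs [simp]: "a @ b \<in> nat_seqs \<longleftrightarrow> a \<in> nat_seqs \<and> b \<in> nat_seqs"
  by (auto simp: nat_seqs_def)

lemma Cons_in_nat_seqs [simp]: "k # b \<in> nat_seqs \<longleftrightarrow> 1 \<le> k \<and> b \<in> nat_seqs"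
  by (auto simp: nat_seqs_def)

lemma countable_nat_list_set [simp, intro]: "countable (A :: nat list set)"
  by (rule countableI_type)

lemma birth_Nil [simp]: "birth X [] \<omega> = 0"
  by (subst birth.simps) simp

lemma birth_snoc: "birth X (a @ [k]) \<omega> = birth X a \<omega> + (\<Sum>j<k. X a j \<omega>)"
  by (subst birth.simps) simp

lemma birth_snoc_Suc: "birth X (a @ [Suc k]) \<omega> = birth X (a @ [k]) \<omega> + X a k \<omega>"
  by (simp add: birth_snoc)

definition positive_clocks :: "(nat list \<Rightarrow> nat \<Rightarrow> 'w \<Rightarrow> real) \<Rightarrow> 'w \<Rightarrow> bool" where
  "positive_clocks X \<omega> \<longleftrightarrow> (\<forall>a\<in>nat_seqs. \<forall>j. 0 < X a j \<omega>)"

lemma positive_clocksD: "positive_clocks X \<omega> \<Longrightarrow> a \<in> nat_seqs \<Longrightarrow> 0 < X a j \<omega>"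
  by (simp add: positive_clocks_def)

lemma tree_explosion_le:
  "a \<in> nat_seqs \<Longrightarrow> tree_explosion X \<omega> \<le> ereal (birth X a \<omega>) + explosion X a \<omega>"
  unfolding tree_explosion_def by (rule INF_lower)

context
  fixes X :: "nat list \<Rightarrow> nat \<Rightarrow> 'w \<Rightarrow> real" and \<omega> :: 'w
  assumes pos: "positive_clocks X \<omega>"
begin

private lemma clock_pos: "a \<in> nat_seqs \<Longrightarrow> 0 < X a j \<omega>"
  using pos by (rule positive_clocksD)

text \<open>The gap is kept as an explicit clock instead of a strict inequality:
  \<open>path_weight_ge\<close> discounts by it, and the margin in
  \<open>AE_birth_neq_tree_explosion\<close> is built from such gaps.\<close>

lemma birth_less_child:
  assumes "a \<in> nat_seqs" "1 \<le> k"
  shows "birth X a \<omega> + X a 0 \<omega> \<le> birth X (a @ [k]) \<omega>"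
proof -
  have "(\<Sum>j<1. X a j \<omega>) \<le> (\<Sum>j<k. X a j \<omega>)"
    using assms by (intro sum_mono2) (auto intro: less_imp_le[OF clock_pos])
  then show ?thesis by (simp add: birth_snoc)
qed

lemma birth_sibling_less:
  assumes "a \<in> nat_seqs" "k < l"
  shows "birth X (a @ [k]) \<omega> + X a k \<omega> \<le> birth X (a @ [l]) \<omega>"
proof -
  have "(\<Sum>j<Suc k. X a j \<omega>) \<le> (\<Sum>j<l. X a j \<omega>)"
    using assms by (intro sum_mono2) (auto intro: less_imp_le[OF clock_pos])
  then show ?thesis by (simp add: birth_snoc)
qed

lemma birth_sibling_less_iff:
  assumes "a \<in> nat_seqs"
  shows "birth X (a @ [k]) \<omega> < birth X (a @ [l]) \<omega> \<longleftrightarrow> k < l"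
  using birth_sibling_less[OF assms, of k l] birth_sibling_less[OF assms, of l k]
    clock_pos[OF assms, of k] clock_pos[OF assms, of l]
  by (cases k l rule: linorder_cases) auto

lemma birth_mono_append:
  "a @ b \<in> nat_seqs \<Longrightarrow> birth X a \<omega> \<le> birth X (a @ b) \<omega>"
proof (induction b rule: rev_induct)
  case (snoc k b)
  then have "birth X (a @ b) \<omega> + X (a @ b) 0 \<omega> \<le> birth X ((a @ b) @ [k]) \<omega>"
    by (intro birth_less_child) auto
  with snoc clock_pos[of "a @ b" 0] show ?case by simp
qed simp

lemma birth_less_append:
  assumes "a @ b \<in> nat_seqs" "b \<noteq> []"
  shows "birth X a \<omega> + X a 0 \<omega> \<le> birth X (a @ b) \<omega>"
proof -
  obtain k b' where b: "b = k # b'" using assms(2) by (cases b) auto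
  have "birth X a \<omega> + X a 0 \<omega> \<le> birth X (a @ [k]) \<omega>"
    using assms b by (intro birth_less_child) auto
  also have "\<dots> \<le> birth X ((a @ [k]) @ b') \<omega>"
    using assms b by (intro birth_mono_append) auto
  finally show ?thesis using b by simp
qed

lemma birth_nonneg: "a \<in> nat_seqs \<Longrightarrow> 0 \<le> birth X a \<omega>"
  using birth_mono_append[of "[]" a] by simp

lemma explosion_ge:
  assumes a: "a \<in> nat_seqs"
  shows "ereal (birth X (a @ [k]) \<omega>) \<le> ereal (birth X a \<omega>) + explosion X a \<omega>"
proof -
  have "ereal (\<Sum>j<k. X a j \<omega>) \<le> explosion X a \<omega>"
    unfolding explosion_def sum_ereal[symmetric]
    using a by (intro suminf_upper) (auto intro: less_imp_le[OF clock_pos])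
  then have "ereal (birth X a \<omega>) + ereal (\<Sum>j<k. X a j \<omega>) \<le> ereal (birth X a \<omega>) + explosion X a \<omega>"
    by (rule add_left_mono)
  then show ?thesis by (simp add: birth_snoc)
qed

text \<open>The birth of \<open>a @ [k]\<close> already accounts for the first \<open>k\<close>
  clocks, so only the tail bounded by \<open>u\<close> remains. It is used in contrapositive form: a
  vertex that is far from exploding must still have a long clock ahead.\<close>

lemma explosion_le:
  assumes a: "a \<in> nat_seqs"
    and tail: "\<And>j. k \<le> j \<Longrightarrow> X a j \<omega> \<le> u j" and u: "\<And>j. 0 \<le> u j" "summable u"
  shows "ereal (birth X a \<omega>) + explosion X a \<omega> \<le> ereal (birth X (a @ [k]) \<omega> + suminf u)"
proof -
  have "(\<Sum>j<n. X a j \<omega>) \<le> (\<Sum>j<k. X a j \<omega>) + suminf u" for n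
  proof -
    have "(\<Sum>j<n. X a j \<omega>) \<le> (\<Sum>j\<in>{..<k} \<union> {k..<n}. X a j \<omega>)"
      using a by (intro sum_mono2) (auto intro: less_imp_le[OF clock_pos])
    also have "\<dots> = (\<Sum>j<k. X a j \<omega>) + (\<Sum>j\<in>{k..<n}. X a j \<omega>)"
      by (rule sum.union_disjoint) auto
    also have "(\<Sum>j\<in>{k..<n}. X a j \<omega>) \<le> (\<Sum>j\<in>{k..<n}. u j)"
      by (intro sum_mono tail) auto
    also have "\<dots> \<le> suminf u"
      using u by (intro sum_le_suminf) auto
    finally show ?thesis by simp
  qed
  then have "explosion X a \<omega> \<le> ereal ((\<Sum>j<k. X a j \<omega>) + suminf u)"
    unfolding explosion_def by (intro suminf_bound) (auto intro: less_imp_le[OF clock_pos] a)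
  then have "ereal (birth X a \<omega>) + explosion X a \<omega>
      \<le> ereal (birth X a \<omega>) + ereal ((\<Sum>j<k. X a j \<omega>) + suminf u)"
    by (rule add_left_mono)
  then show ?thesis by (simp add: birth_snoc add.assoc)
qed

end

text \<open>The clocks summed in the birth time of \<open>a\<close>: in \<open>a = c @ k # b\<close>
  the prefix \<open>c\<close> is a proper ancestor and \<open>k\<close> the label of the next vertex
  on the path, whose edge costs the clocks \<open>0, ..., k - 1\<close> of \<open>c\<close>.\<close>

definition birth_clocks :: "nat list \<Rightarrow> (nat list \<times> nat) set" where
  "birth_clocks a = {(c, j). \<exists>k b. a = c @ k # b \<and> j < k}"

lemma birth_clocks_Nil [simp]: "birth_clocks [] = {}"
  by (auto simp: birth_clocks_def)

lemma birth_clocks_snoc: "birth_clocks (a @ [k]) = birth_clocks a \<union> {a} \<times> {..<k}"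
proof -
  have "a @ [k] = c @ l # b \<longleftrightarrow> (b = [] \<and> c = a \<and> l = k) \<or> (\<exists>b'. b = b' @ [k] \<and> a = c @ l # b')"
    for c l b
    by (cases b rule: rev_cases) auto
  then show ?thesis
    unfolding birth_clocks_def by auto
qed

lemma birth_clocks_subset: "a \<in> nat_seqs \<Longrightarrow> birth_clocks a \<subseteq> nat_seqs \<times> UNIV"
  by (auto simp: birth_clocks_def)

section \<open>Sigma-algebras of sets of clocks, independence and absence of atoms\<close>

locale exponential_clocks = prob_space M for M :: "'w measure" +
  fixes X :: "nat list \<Rightarrow> nat \<Rightarrow> 'w \<Rightarrow> real" and f :: "nat \<Rightarrow> real"
  assumes f_pos: "\<And>j. 0 < f j"
    and indep: "indep_vars (\<lambda>_. borel) (\<lambda>(a, j). X a j) (nat_seqs \<times> UNIV)"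
    and exponential:
      "\<And>a j. a \<in> nat_seqs \<Longrightarrow> distributed M lborel (X a j) (exponential_density (f j))"
begin

text \<open>Measurability with respect to this space expresses that a quantity reads only the clocks
  in \<open>J\<close>; independence then amounts to disjointness of index sets.\<close>

definition clock_algebra :: "(nat list \<times> nat) set \<Rightarrow> 'w measure" where
  "clock_algebra J = sigma (space M) (\<Union>(a, j)\<in>J. {X a j -` B \<inter> space M |B. B \<in> sets borel})"

lemma space_clock_algebra [simp]: "space (clock_algebra J) = space M"
  unfolding clock_algebra_def by (rule space_measure_of) auto

lemma sets_clock_algebra:
  "sets (clock_algebra J) =
    sigma_sets (space M) (\<Union>(a, j)\<in>J. {X a j -` B \<inter> space M |B. B \<in> sets borel})"
  unfolding clock_algebra_def by (rule sets_measure_of) auto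

lemma measurable_clock [measurable (raw)]:
  "(a, j) \<in> J \<Longrightarrow> X a j \<in> borel_measurable (clock_algebra J)"
  by (rule measurableI) (auto simp: sets_clock_algebra intro!: sigma_sets.Basic)

lemma random_variable_X [measurable (raw)]: "a \<in> nat_seqs \<Longrightarrow> X a j \<in> borel_measurable M"
  using distributed_measurable[OF exponential[of a j]] by simp

lemma sets_clock_algebra_subset: "J \<subseteq> nat_seqs \<times> UNIV \<Longrightarrow> sets (clock_algebra J) \<subseteq> sets M"
  unfolding sets_clock_algebra by (rule sets.sigma_sets_subset) (auto intro!: measurable_sets[OF random_variable_X])

lemma measurable_clock_algebra:
  "g \<in> clock_algebra J \<rightarrow>\<^sub>M N \<Longrightarrow> J \<subseteq> nat_seqs \<times> UNIV \<Longrightarrow> g \<in> M \<rightarrow>\<^sub>M N"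
  using sets_clock_algebra_subset[of J] by (auto simp: measurable_def)

lemma measurable_birth [measurable (raw)]:
  "birth_clocks a \<subseteq> J \<Longrightarrow> birth X a \<in> borel_measurable (clock_algebra J)"
proof (induction a rule: rev_induct)
  case Nil
  have "birth X [] = (\<lambda>_. 0)" by (rule ext) simp
  then show ?case by simp
next
  case (snoc k a)
  have "birth X (a @ [k]) = (\<lambda>\<omega>. birth X a \<omega> + (\<Sum>j<k. X a j \<omega>))"
    by (rule ext) (rule birth_snoc)
  then show ?case
    using snoc by (auto simp: birth_clocks_snoc intro!: borel_measurable_add borel_measurable_sum measurable_clock)
qed

lemma measurable_explosion [measurable (raw)]:
  "{a} \<times> UNIV \<subseteq> J \<Longrightarrow> explosion X a \<in> borel_measurable (clock_algebra J)"
proof -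
  assume "{a} \<times> UNIV \<subseteq> J"
  then have [measurable]: "X a j \<in> borel_measurable (clock_algebra J)" for j
    by (intro measurable_clock) auto
  show ?thesis
    unfolding explosion_def[abs_def] suminf_eq_lim sum_ereal by measurable
qed

lemma random_variable_birth [measurable (raw)]: "a \<in> nat_seqs \<Longrightarrow> birth X a \<in> borel_measurable M"
  by (rule measurable_clock_algebra[OF measurable_birth[OF order_refl] birth_clocks_subset])

lemma random_variable_explosion [measurable (raw)]:
  "a \<in> nat_seqs \<Longrightarrow> explosion X a \<in> borel_measurable M"
  by (rule measurable_clock_algebra[OF measurable_explosion[OF order_refl]]) auto

lemma random_variable_tree_explosion [measurable]: "tree_explosion X \<in> borel_measurable M"
proof -
  have "(\<lambda>\<omega>. ereal (birth X a \<omega>) + explosion X a \<omega>) \<in> borel_measurable M"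
    if a: "a \<in> nat_seqs" for a
  proof -
    note [measurable] = random_variable_birth[OF a] random_variable_explosion[OF a]
    show ?thesis by measurable
  qed
  then show ?thesis
    unfolding tree_explosion_def[abs_def] by (intro borel_measurable_INF) auto
qed

text \<open>The events of a single clock are stable under intersection, so independence passes from
  the individual clocks to the sigma-algebras generated by disjoint groups of them.\<close>

lemma indep_clock_algebras:
  assumes J: "J \<inter> K = {}" "J \<subseteq> nat_seqs \<times> UNIV" "K \<subseteq> nat_seqs \<times> UNIV"
  shows "indep_set (sets (clock_algebra J)) (sets (clock_algebra K))"
proof -
  let ?E = "\<lambda>i. {(\<lambda>(a, j). X a j) i -` B \<inter> space M |B. B \<in> sets borel}"
  have "indep_sets ?E (nat_seqs \<times> UNIV)"
    using indep unfolding indep_vars_def2 by simp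
  then have "indep_sets ?E (\<Union>b\<in>UNIV. case_bool J K b)"
    using J by (rule_tac indep_sets_mono_index) (auto simp: UNIV_bool)
  then have "indep_sets (\<lambda>b. sigma_sets (space M) (\<Union>i\<in>case_bool J K b. ?E i)) UNIV"
  proof (rule indep_sets_collect_sigma)
    show "Int_stable (?E i)" for i
    proof (rule Int_stableI)
      fix A B assume "A \<in> ?E i" "B \<in> ?E i"
      then obtain A' B' where "A' \<in> sets borel" "B' \<in> sets borel"
        "A = (\<lambda>(a, j). X a j) i -` A' \<inter> space M" "B = (\<lambda>(a, j). X a j) i -` B' \<inter> space M"
        by blast
      then show "A \<inter> B \<in> ?E i"
        by (intro CollectI exI[of _ "A' \<inter> B'"]) auto
    qed
    show "disjoint_family (case_bool J K)"
      using J by (auto simp: disjoint_family_on_def split: bool.splits)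
  qed
  moreover have "(\<Union>i\<in>J. ?E i) = (\<Union>(a, j)\<in>J. {X a j -` B \<inter> space M |B. B \<in> sets borel})" for J
    by (rule SUP_cong) auto
  ultimately show ?thesis
    unfolding indep_set_def sets_clock_algebra
    by (elim indep_sets_cong[OF refl, THEN iffD1, rotated]) (auto split: bool.split)
qed

lemma prob_clock_algebras:
  assumes J: "J \<inter> K = {}" "J \<subseteq> nat_seqs \<times> UNIV" "K \<subseteq> nat_seqs \<times> UNIV"
    and A: "A \<in> sets (clock_algebra J)" and B: "B \<in> sets (clock_algebra K)"
  shows "prob (A \<inter> B) = prob A * prob B"
  using indep_setD[OF indep_clock_algebras[OF J] A B] .

lemma nn_integral_clock_algebras:
  fixes Y Z :: "'w \<Rightarrow> ennreal"
  assumes J: "J \<inter> K = {}" "J \<subseteq> nat_seqs \<times> UNIV" "K \<subseteq> nat_seqs \<times> UNIV"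
    and Y: "Y \<in> borel_measurable (clock_algebra J)" and Z: "Z \<in> borel_measurable (clock_algebra K)"
  shows "(\<integral>\<^sup>+\<omega>. Y \<omega> * Z \<omega> \<partial>M) = (\<integral>\<^sup>+\<omega>. Y \<omega> \<partial>M) * (\<integral>\<^sup>+\<omega>. Z \<omega> \<partial>M)"
proof -
  have "indep_var borel Y borel Z"
    unfolding indep_var_eq
  proof (intro conjI)
    show "random_variable borel Y" "random_variable borel Z"
      using Y Z J by (auto intro: measurable_clock_algebra)
    have sub: "sigma_sets (space M) {Y -` A \<inter> space M |A. A \<in> sets borel} \<subseteq> sets (clock_algebra J)"
      if "Y \<in> borel_measurable (clock_algebra J)" for Y :: "'w \<Rightarrow> ennreal" and J
      using sets.sigma_sets_subset[of "{Y -` A \<inter> space M |A. A \<in> sets borel}" "clock_algebra J"]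
        measurable_sets[OF that] by auto
    show "indep_set (sigma_sets (space M) {Y -` A \<inter> space M |A. A \<in> sets borel})
         (sigma_sets (space M) {Z -` A \<inter> space M |A. A \<in> sets borel})"
      using indep_clock_algebras[OF J] sub[OF Y] sub[OF Z] unfolding indep_set_def
      by (elim indep_sets_mono_sets) (auto split: bool.split)
  qed
  then have "indep_vars (\<lambda>_. borel) (case_bool Y Z) UNIV"
    unfolding indep_var_def by (elim indep_vars_cong[THEN iffD1, rotated -1]) (auto split: bool.split)
  from indep_vars_nn_integral[OF _ this] show ?thesis
    by (simp add: UNIV_bool mult.commute)
qed

lemma prob_clock_gt: "a \<in> nat_seqs \<Longrightarrow> 0 \<le> t \<Longrightarrow> prob {\<omega>\<in>space M. t < X a j \<omega>} = exp (- f j * t)"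
  using exponential_distributedD_gt[OF exponential _ f_pos, of a t j] by (simp add: mult.commute)

lemma AE_positive_clocks: "AE \<omega> in M. positive_clocks X \<omega>"
proof -
  have "AE \<omega> in M. 0 < X a j \<omega>" if "a \<in> nat_seqs" for a j
    using prob_clock_gt[OF that, of 0 j] that by (subst prob_Collect_eq_1[symmetric]) simp_all
  then show ?thesis
    by (simp add: positive_clocks_def AE_ball_countable AE_all_countable)
qed

text \<open>The diagonal is covered by squares of side \<open>1 / Suc m\<close>, and the clock has density at most \<open>f k\<close>.\<close>

lemma AE_clock_neq:
  assumes c: "c \<in> nat_seqs" and J: "J \<subseteq> nat_seqs \<times> UNIV" "(c, k) \<notin> J"
    and Z: "Z \<in> borel_measurable (clock_algebra J)"
  shows "AE \<omega> in M. X c k \<omega> \<noteq> Z \<omega>"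
proof -
  have [measurable]: "Z \<in> borel_measurable M" "X c k \<in> borel_measurable M"
    using Z J c by (auto intro: measurable_clock_algebra)
  have bound: "emeasure M {\<omega>\<in>space M. X c k \<omega> = Z \<omega>} \<le> ennreal (f k / Suc m)" for m
  proof -
    let ?I = "\<lambda>i::int. {of_int i / real (Suc m)..<(of_int i + 1) / real (Suc m)}"
    let ?A = "\<lambda>i. {\<omega>\<in>space M. X c k \<omega> \<in> ?I i}" and ?B = "\<lambda>i. {\<omega>\<in>space M. Z \<omega> \<in> ?I i}"
    have mem: "z \<in> ?I \<lfloor>z * real (Suc m)\<rfloor>" for z
      by (simp add: field_simps) linarith
    have uniq: "i = \<lfloor>z * real (Suc m)\<rfloor>" if "z \<in> ?I i" for z i
      using that by (intro floor_unique[symmetric]) (simp_all add: field_simps)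
    have A: "emeasure M (?A i) \<le> ennreal (f k / Suc m)" for i
    proof -
      have "emeasure M (?A i) = emeasure M (X c k -` ?I i \<inter> space M)"
        by (rule arg_cong[where f="emeasure M"]) auto
      also have "\<dots> = (\<integral>\<^sup>+x. ennreal (exponential_density (f k) x) * indicator (?I i) x \<partial>lborel)"
        by (rule distributed_emeasure[OF exponential[OF c]]) simp
      also have "\<dots> \<le> (\<integral>\<^sup>+x. ennreal (f k) * indicator (?I i) x \<partial>lborel)"
        using f_pos[of k]
        by (intro nn_integral_mono mult_right_mono ennreal_leI)
           (auto simp: exponential_density_def mult_le_cancel_left1)
      also have "\<dots> = ennreal (f k / Suc m)"
        using f_pos[of k] by (simp add: nn_integral_cmult_indicator ennreal_mult[symmetric] add_divide_distrib)
      finally show ?thesis .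
    qed
    have "emeasure M {\<omega>\<in>space M. X c k \<omega> = Z \<omega>} \<le> emeasure M (\<Union>i. ?A i \<inter> ?B i)"
    proof (rule emeasure_mono)
      show "{\<omega>\<in>space M. X c k \<omega> = Z \<omega>} \<subseteq> (\<Union>i. ?A i \<inter> ?B i)"
      proof
        fix \<omega> assume "\<omega> \<in> {\<omega>\<in>space M. X c k \<omega> = Z \<omega>}"
        then have "\<omega> \<in> ?A \<lfloor>Z \<omega> * real (Suc m)\<rfloor> \<inter> ?B \<lfloor>Z \<omega> * real (Suc m)\<rfloor>"
          using mem[of "Z \<omega>"] by simp
        then show "\<omega> \<in> (\<Union>i. ?A i \<inter> ?B i)" by blast
      qed
    qed measurable
    also have "\<dots> = (\<integral>\<^sup>+i. emeasure M (?A i \<inter> ?B i) \<partial>count_space UNIV)"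
    proof (rule emeasure_UN_countable)
      show "disjoint_family (\<lambda>i. ?A i \<inter> ?B i)"
        using uniq unfolding disjoint_family_on_def by blast
    qed auto
    also have "\<dots> = (\<integral>\<^sup>+i. emeasure M (?A i) * emeasure M (?B i) \<partial>count_space UNIV)"
    proof (rule nn_integral_cong)
      fix i
      have "prob (?A i \<inter> ?B i) = prob (?A i) * prob (?B i)"
      proof (rule prob_clock_algebras)
        show "{(c, k)} \<inter> J = {}" "{(c, k)} \<subseteq> nat_seqs \<times> UNIV" "J \<subseteq> nat_seqs \<times> UNIV"
          using c J by auto
        have "X c k \<in> borel_measurable (clock_algebra {(c, k)})"
          by (rule measurable_clock) simp
        then have "X c k -` ?I i \<inter> space (clock_algebra {(c, k)}) \<in> sets (clock_algebra {(c, k)})"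
          by (rule measurable_sets) simp
        then show "?A i \<in> sets (clock_algebra {(c, k)})"
          by (simp only: space_clock_algebra vimage_def Int_def mem_Collect_eq conj_commute)
        have "Z -` ?I i \<inter> space (clock_algebra J) \<in> sets (clock_algebra J)"
          using Z by (rule measurable_sets) simp
        then show "?B i \<in> sets (clock_algebra J)"
          by (simp only: space_clock_algebra vimage_def Int_def mem_Collect_eq conj_commute)
      qed
      then show "emeasure M (?A i \<inter> ?B i) = emeasure M (?A i) * emeasure M (?B i)"
        by (simp add: emeasure_eq_measure ennreal_mult)
    qed
    \<comment> \<open>The first factor is bounded uniformly in \<open>i\<close>, while the sets
      \<open>?B i\<close> are disjoint and so have total measure at most 1.\<close>
    also have "\<dots> \<le> (\<integral>\<^sup>+i. ennreal (f k / Suc m) * emeasure M (?B i) \<partial>count_space UNIV)"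
      by (intro nn_integral_mono mult_right_mono A) auto
    also have "\<dots> = ennreal (f k / Suc m) * (\<integral>\<^sup>+i. emeasure M (?B i) \<partial>count_space UNIV)"
      by (rule nn_integral_cmult) simp
    also have "(\<integral>\<^sup>+i. emeasure M (?B i) \<partial>count_space UNIV) = emeasure M (\<Union>i. ?B i)"
    proof (rule emeasure_UN_countable[symmetric])
      show "disjoint_family ?B"
        using uniq unfolding disjoint_family_on_def by blast
    qed auto
    also have "\<dots> \<le> 1"
      using emeasure_le_1 .
    finally show ?thesis
      by (simp add: mult_left_mono order_trans)
  qed
  have "(\<lambda>m. ennreal (f k / Suc m)) \<longlonglongrightarrow> ennreal 0"
    by (intro tendsto_ennrealI) real_asymp
  then have "emeasure M {\<omega>\<in>space M. X c k \<omega> = Z \<omega>} \<le> ennreal 0"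
    by (rule LIMSEQ_le_const) (use bound in auto)
  then show ?thesis
    by (intro AE_I[where N="{\<omega>\<in>space M. X c k \<omega> = Z \<omega>}"]) auto
qed

end

section \<open>Order type of the early births\<close>

text \<open>For the converse, counting predecessors embeds \<open>E\<close> order-preservingly into
  the natural numbers, and the infinite set of ranks can be enumerated increasingly.\<close>

lemma ex_strict_mono_enumeration_iff:
  fixes E :: "'a::linorder set"
  shows "(\<exists>g::nat \<Rightarrow> 'a. strict_mono g \<and> range g = E) \<longleftrightarrow>
    infinite E \<and> (\<forall>x\<in>E. finite {y\<in>E. y < x})"
proof (intro iffI conjI)
  assume "\<exists>g::nat \<Rightarrow> 'a. strict_mono g \<and> range g = E"
  then obtain g :: "nat \<Rightarrow> 'a" where g: "strict_mono g" and E: "range g = E" by auto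
  show "infinite E"
    using g E strict_mono_imp_inj_on range_inj_infinite by blast
  show "\<forall>x\<in>E. finite {y\<in>E. y < x}"
  proof
    fix x assume "x \<in> E"
    then obtain n where "x = g n" using E by auto
    then have "{y\<in>E. y < x} \<subseteq> g ` {..<n}"
      using g E by (auto simp: strict_mono_less)
    then show "finite {y\<in>E. y < x}" by (rule finite_subset) simp
  qed
next
  assume *: "infinite E \<and> (\<forall>x\<in>E. finite {y\<in>E. y < x})"
  define r where "r x = card {y\<in>E. y < x}" for x
  have r: "r x < r y" if "x \<in> E" "y \<in> E" "x < y" for x y
    unfolding r_def using that * by (intro psubset_card_mono) auto
  have r_iff: "r x < r y \<longleftrightarrow> x < y" if "x \<in> E" "y \<in> E" for x y
    using r[of x y] r[of y x] that by (cases x y rule: linorder_cases) auto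
  have inj: "inj_on r E"
    by (rule inj_onI) (metis r less_irrefl linorder_neqE)
  then have inf: "infinite (r ` E)"
    using * finite_imageD by blast
  define g where "g n = inv_into E r (enumerate (r ` E) n)" for n
  have en: "enumerate (r ` E) n \<in> r ` E" for n
    using inf by (rule enumerate_in_set)
  have gE: "g n \<in> E" "r (g n) = enumerate (r ` E) n" for n
    unfolding g_def using en[of n] by (auto intro: inv_into_into f_inv_into_f)
  have "strict_mono g"
    by (rule strict_monoI) (metis gE r_iff inf enumerate_mono)
  moreover have "range g = E"
  proof -
    have "range g = inv_into E r ` range (enumerate (r ` E))"
      by (auto simp: g_def)
    also have "\<dots> = E"
      using inf inj by (simp add: range_enumerate)
    finally show ?thesis .
  qed
  ultimately show "\<exists>g::nat \<Rightarrow> 'a. strict_mono g \<and> range g = E" by blast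
qed

lemma strict_mono_enumeration_unique:
  fixes g h :: "nat \<Rightarrow> 'a::linorder"
  assumes "strict_mono g" "strict_mono h" "range g = range h"
  shows "g = h"
proof -
  \<comment> \<open>If \<open>g\<close> and \<open>h\<close> agree below \<open>n\<close>, then
    \<open>g n\<close> can occur in \<open>h\<close> only at an index that is at least
    \<open>n\<close>. Exchanging the roles of \<open>g\<close> and \<open>h\<close> gives
    equality.\<close>
  have le: "h n \<le> g n"
    if gh: "strict_mono g" "strict_mono h" "range g = range h" "\<And>m. m < n \<Longrightarrow> g m = h m"
    for g h :: "nat \<Rightarrow> 'a" and n
  proof -
    obtain m where m: "g n = h m" using gh(3) by (metis rangeI rangeE)
    have "\<not> m < n"
      using gh m strict_mono_eq[of g n m] by auto
    then show ?thesis using m gh(2) by (simp add: strict_mono_less_eq)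
  qed
  have "g n = h n" for n
  proof (induction n rule: less_induct)
    case (less n)
    then show ?case using le[of g h n] le[of h g n] assms by (intro antisym) auto
  qed
  then show ?thesis by blast
qed

text \<open>These are exactly the outcomes on which the definite description in
  \<open>birth_enum\<close> has a denotation.\<close>

definition well_timed :: "(nat list \<Rightarrow> nat \<Rightarrow> 'w \<Rightarrow> real) \<Rightarrow> 'w \<Rightarrow> bool" where
  "well_timed X \<omega> \<longleftrightarrow> (\<exists>g::nat \<Rightarrow> real. strict_mono g \<and> range g = early_births X \<omega>)"

text \<open>This says that at most \<open>n\<close> early births precede the birth of \<open>a\<close>; written with countable
  quantifiers over vertices so that its measurability is immediate.\<close>

definition rank_le :: "(nat list \<Rightarrow> nat \<Rightarrow> 'w \<Rightarrow> real) \<Rightarrow> nat \<Rightarrow> nat list \<Rightarrow> 'w \<Rightarrow> bool" where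
  "rank_le X n a \<omega> \<longleftrightarrow>
    (\<exists>F\<in>{F. set F \<subseteq> nat_seqs \<and> length F \<le> n}. \<forall>c\<in>nat_seqs.
      ereal (birth X c \<omega>) < tree_explosion X \<omega> \<and> birth X c \<omega> < birth X a \<omega> \<longrightarrow>
      (\<exists>d\<in>set F. birth X c \<omega> = birth X d \<omega>))"

text \<open>The list names vertices but the rank counts times. On exceptional outcomes several
  vertices share a birth time, so the witness list takes one vertex for each time.\<close>

lemma rank_le_iff:
  "rank_le X n a \<omega> \<longleftrightarrow> finite {y\<in>early_births X \<omega>. y < birth X a \<omega>} \<and>
     card {y\<in>early_births X \<omega>. y < birth X a \<omega>} \<le> n" (is "_ \<longleftrightarrow> finite ?Y \<and> _")
proof
  assume "rank_le X n a \<omega>"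
  then obtain F where F: "length F \<le> n" "?Y \<subseteq> (\<lambda>d. birth X d \<omega>) ` set F"
    unfolding rank_le_def early_births_def by fast
  have "card ?Y \<le> card ((\<lambda>d. birth X d \<omega>) ` set F)"
    using F by (intro card_mono) auto
  also have "\<dots> \<le> card (set F)" by (rule card_image_le) simp
  also have "\<dots> \<le> length F" by (rule card_length)
  finally show "finite ?Y \<and> card ?Y \<le> n"
    using F(1) finite_subset[OF F(2)] by simp
next
  assume Y: "finite ?Y \<and> card ?Y \<le> n"
  have "?Y \<subseteq> (\<lambda>d. birth X d \<omega>) ` nat_seqs"
    by (auto simp: early_births_def)
  then obtain U where U: "U \<subseteq> nat_seqs" "inj_on (\<lambda>d. birth X d \<omega>) U" "?Y = (\<lambda>d. birth X d \<omega>) ` U"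
    unfolding subset_image_inj by blast
  have "finite U" using Y U finite_imageD by metis
  then obtain F where F: "set F = U" "distinct F"
    using finite_distinct_list by blast
  have "length F = card ?Y"
    unfolding U(3) using F U(2) by (simp add: card_image distinct_card[symmetric])
  moreover have "\<exists>d\<in>set F. birth X c \<omega> = birth X d \<omega>"
    if "c \<in> nat_seqs" "ereal (birth X c \<omega>) < tree_explosion X \<omega>" "birth X c \<omega> < birth X a \<omega>" for c
  proof -
    have "birth X c \<omega> \<in> ?Y" using that by (auto simp: early_births_def)
    then show ?thesis unfolding U(3) F(1) by auto
  qed
  ultimately show "rank_le X n a \<omega>"
    unfolding rank_le_def using Y F(1) U(1) by (intro bexI[of _ F]) auto
qed

text \<open>Order type omega is split into finite initial segments and unbounded ranks, both written
  with countable quantifiers over vertices, which yields measurability.\<close>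

lemma well_timed_iff:
  "well_timed X \<omega> \<longleftrightarrow>
    (\<forall>a\<in>nat_seqs. ereal (birth X a \<omega>) < tree_explosion X \<omega> \<longrightarrow> (\<exists>n. rank_le X n a \<omega>)) \<and>
    (\<forall>n. \<exists>a\<in>nat_seqs. ereal (birth X a \<omega>) < tree_explosion X \<omega> \<and> \<not> rank_le X n a \<omega>)"
  (is "_ \<longleftrightarrow> ?fin \<and> ?inf")
proof -
  let ?E = "early_births X \<omega>"
  have fin: "?fin \<longleftrightarrow> (\<forall>x\<in>?E. finite {y\<in>?E. y < x})"
    unfolding rank_le_iff early_births_def by blast
  show ?thesis
  proof
    assume wt: "well_timed X \<omega>"
    then obtain g :: "nat \<Rightarrow> real" where g: "strict_mono g" "range g = ?E"
      unfolding well_timed_def by blast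
    have "\<exists>a\<in>nat_seqs. ereal (birth X a \<omega>) < tree_explosion X \<omega> \<and> \<not> rank_le X n a \<omega>" for n
    proof -
      \<comment> \<open>The entry with index \<open>Suc n\<close> has \<open>Suc n\<close>
        predecessors, one more than \<open>rank_le X n\<close> admits.\<close>
      have "g (Suc n) \<in> ?E" using g by auto
      then obtain a where a: "a \<in> nat_seqs" "ereal (birth X a \<omega>) < tree_explosion X \<omega>"
        "birth X a \<omega> = g (Suc n)"
        by (auto simp: early_births_def)
      have "\<not> rank_le X n a \<omega>"
      proof
        assume "rank_le X n a \<omega>"
        then have *: "finite {y\<in>?E. y < g (Suc n)}" "card {y\<in>?E. y < g (Suc n)} \<le> n"
          unfolding rank_le_iff a(3) by auto
        have "card (g ` {..n}) \<le> card {y\<in>?E. y < g (Suc n)}"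
          using g * by (intro card_mono) (auto simp: strict_mono_less)
        moreover have "card (g ` {..n}) = Suc n"
          using g strict_mono_imp_inj_on[of g] by (subst card_image) (auto intro: inj_on_subset)
        ultimately show False using * by simp
      qed
      then show ?thesis using a by blast
    qed
    moreover have ?fin
      using wt unfolding fin well_timed_def ex_strict_mono_enumeration_iff by blast
    ultimately show "?fin \<and> ?inf" by blast
  next
    assume *: "?fin \<and> ?inf"
    have "infinite ?E"
    proof
      assume E: "finite ?E"
      have "rank_le X (card ?E) a \<omega>" for a
        unfolding rank_le_iff using E by (auto intro: card_mono)
      then show False using * by blast
    qed
    then show "well_timed X \<omega>"
      using * unfolding fin well_timed_def ex_strict_mono_enumeration_iff by blast
  qed
qed

lemma birth_enum:
  assumes "well_timed X \<omega>"
  shows strict_mono_birth_enum: "strict_mono (\<lambda>n. birth_enum X n \<omega>)"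
    and range_birth_enum: "range (\<lambda>n. birth_enum X n \<omega>) = early_births X \<omega>"
proof -
  let ?P = "\<lambda>g::nat \<Rightarrow> real. strict_mono g \<and> range g = early_births X \<omega>"
  obtain g where g: "?P g" using assms unfolding well_timed_def by blast
  then have "The ?P = g"
    using strict_mono_enumeration_unique by (intro the_equality) blast+
  then have "birth_enum X n \<omega> = g n" for n
    by (simp add: birth_enum_def)
  then show "strict_mono (\<lambda>n. birth_enum X n \<omega>)"
    "range (\<lambda>n. birth_enum X n \<omega>) = early_births X \<omega>" using g by simp_all
qed

text \<open>The entry of the enumeration with index \<open>n\<close> has exactly \<open>n\<close>
  predecessors, so membership in the jump tree can be stated without the enumeration, in a visibly
  measurable form.\<close>

lemma jump_tree_iff_rank_le:
  assumes wt: "well_timed X \<omega>" and a: "a \<in> nat_seqs"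
  shows "a \<in> jump_tree X n \<omega> \<longleftrightarrow> rank_le X n a \<omega>"
proof -
  let ?E = "early_births X \<omega>" and ?g = "\<lambda>n. birth_enum X n \<omega>"
  note g = strict_mono_birth_enum[OF wt] and E = range_birth_enum[OF wt]
  have "birth X a \<omega> \<le> ?g n \<longleftrightarrow> rank_le X n a \<omega>"
  proof
    assume "birth X a \<omega> \<le> ?g n"
    then have sub: "{y\<in>?E. y < birth X a \<omega>} \<subseteq> ?g ` {..<n}"
      unfolding E[symmetric] using strict_mono_less[OF g] by (auto dest: less_le_trans)
    have "card {y\<in>?E. y < birth X a \<omega>} \<le> card (?g ` {..<n})"
      using sub by (intro card_mono) auto
    also have "\<dots> \<le> n" using card_image_le[of "{..<n}" ?g] by simp
    finally show "rank_le X n a \<omega>"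
      unfolding rank_le_iff using sub finite_subset by blast
  next
    assume r: "rank_le X n a \<omega>"
    show "birth X a \<omega> \<le> ?g n"
    proof (rule ccontr)
      assume *: "\<not> birth X a \<omega> \<le> ?g n"
      have "card (?g ` {..n}) \<le> card {y\<in>?E. y < birth X a \<omega>}"
      proof (rule card_mono)
        have "?g m \<le> ?g n" if "m \<le> n" for m
          using strict_mono_less_eq[OF g, of m n] that by simp
        then show "?g ` {..n} \<subseteq> {y\<in>?E. y < birth X a \<omega>}"
          using * E by fastforce
        show "finite {y\<in>?E. y < birth X a \<omega>}"
          using r by (simp only: rank_le_iff)
      qed
      moreover have "card (?g ` {..n}) = Suc n"
        using card_image[OF inj_on_subset[OF strict_mono_imp_inj_on[OF g] subset_UNIV], of "{..n}"] by simp
      ultimately show False using r unfolding rank_le_iff by simp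
    qed
  qed
  then show ?thesis using a by (simp add: jump_tree_def alive_def)
qed

text \<open>The defining predicate is identically false on such outcomes, so the unspecified value
  is one and the same constant for all of them and does not spoil measurability.\<close>

lemma birth_enum_not_well_timed:
  assumes "\<not> well_timed X \<omega>"
  shows "birth_enum X n \<omega> = (THE g::nat \<Rightarrow> real. False) n"
proof -
  have "(\<lambda>g::nat \<Rightarrow> real. strict_mono g \<and> range g = early_births X \<omega>) = (\<lambda>g. False)"
    using assms unfolding well_timed_def fun_eq_iff by simp
  then show ?thesis by (simp only: birth_enum_def)
qed

context
  fixes X :: "nat list \<Rightarrow> nat \<Rightarrow> 'w \<Rightarrow> real" and \<omega> :: 'w
  assumes pos: "positive_clocks X \<omega>"
begin

lemma birth_le_explosion:
  assumes a: "a \<in> nat_seqs"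
  shows "ereal (birth X a \<omega>) \<le> ereal (birth X a \<omega>) + explosion X a \<omega>"
proof -
  \<comment> \<open>The label 0 serves as a dummy: its sum of clocks is empty, so
    \<open>a @ [0]\<close> has the birth time of \<open>a\<close>.\<close>
  have "birth X (a @ [0]) \<omega> = birth X a \<omega>" by (simp add: birth_snoc)
  then show ?thesis using explosion_ge[OF pos a, of 0] by (simp only:)
qed

text \<open>Every vertex of the subtree of \<open>a\<close> explodes no earlier than the birth of
  its own first child. This child is a proper descendant of \<open>a\<close> even when
  \<open>b\<close> is empty, so the first clock of \<open>a\<close> has run out by then.\<close>

lemma descendant_explosion_ge:
  assumes "a @ b \<in> nat_seqs"
  shows "ereal (birth X a \<omega> + X a 0 \<omega>) \<le> ereal (birth X (a @ b) \<omega>) + explosion X (a @ b) \<omega>"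
proof -
  have "birth X a \<omega> + X a 0 \<omega> \<le> birth X (a @ (b @ [1])) \<omega>"
    using assms by (intro birth_less_append[OF pos]) auto
  then show ?thesis
    using explosion_ge[OF pos, of "a @ b" 1] assms by (simp add: order_trans[rotated])
qed

lemma tree_explosion_pos: "0 < tree_explosion X \<omega>"
proof -
  have "ereal (X [] 0 \<omega>) \<le> tree_explosion X \<omega>"
    unfolding tree_explosion_def using descendant_explosion_ge[of "[]"] by (intro INF_greatest) simp
  then show ?thesis
    using positive_clocksD[OF pos, of "[]" 0] by (cases "tree_explosion X \<omega>") (auto simp: zero_ereal_def)
qed

text \<open>If only finitely many vertices were born before the tree explosion, the earliest birth on the
  boundary of this finite tree would be the tree explosion time itself.\<close>

lemma infinite_early_vertices:
  assumes neq: "\<And>a. a \<in> nat_seqs \<Longrightarrow> ereal (birth X a \<omega>) \<noteq> tree_explosion X \<omega>"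
  shows "infinite {a\<in>nat_seqs. ereal (birth X a \<omega>) < tree_explosion X \<omega>}" (is "infinite ?V")
proof
  assume fin: "finite ?V"
  have "[] \<in> ?V" using tree_explosion_pos by (simp add: zero_ereal_def)
  have "\<exists>k\<ge>1. c @ [k] \<notin> ?V" for c
  proof (rule ccontr)
    assume "\<not> (\<exists>k\<ge>1. c @ [k] \<notin> ?V)"
    then have "(\<lambda>k. c @ [k]) ` {1..} \<subseteq> ?V" by blast
    then have "finite ((\<lambda>k. c @ [k]) ` {1::nat..})" using fin finite_subset by blast
    then have "finite {1::nat..}" by (rule finite_imageD) (auto intro: inj_onI)
    then show False using infinite_Ici by blast
  qed
  define k where "k c = (LEAST k. 1 \<le> k \<and> c @ [k] \<notin> ?V)" for c
  have k: "1 \<le> k c \<and> c @ [k c] \<notin> ?V" for c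
    unfolding k_def by (rule LeastI_ex) fact
  have k_le: "k c \<le> l" if "1 \<le> l" "c @ [l] \<notin> ?V" for c l
    unfolding k_def using that by (intro Least_le) auto
  define Z where "Z = Min ((\<lambda>c. birth X (c @ [k c]) \<omega>) ` ?V)"
  have Z_le: "Z \<le> birth X (c @ [k c]) \<omega>" if "c \<in> ?V" for c
    unfolding Z_def using fin that by (intro Min_le) auto
  have outside: "Z \<le> birth X a \<omega>" if "a \<in> nat_seqs" "a \<notin> ?V" for a
    using that
  proof (induction a rule: rev_induct)
    case Nil
    then show ?case using \<open>[] \<in> ?V\<close> by blast
  next
    case (snoc l c)
    then have c: "c \<in> nat_seqs" and l: "1 \<le> l" by auto
    show ?case
    proof (cases "c \<in> ?V")
      case True
      have "k c \<le> l" using k_le[OF l] snoc.prems by blast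
      then have "birth X (c @ [k c]) \<omega> \<le> birth X (c @ [l]) \<omega>"
        using birth_sibling_less_iff[OF pos c, of l "k c"] by (simp add: not_less[symmetric])
      then show ?thesis using Z_le[OF True] by simp
    next
      case False
      then show ?thesis
        using snoc.IH[OF c] birth_mono_append[OF pos, of c "[l]"] snoc.prems by simp
    qed
  qed
  have "ereal Z \<le> tree_explosion X \<omega>"
    unfolding tree_explosion_def
  proof (rule INF_greatest)
    fix c assume c: "c \<in> nat_seqs"
    \<comment> \<open>A vertex of \<open>?V\<close> explodes after the birth of its first missing
      child; for a vertex outside, the dummy label 0 compares with its own birth.\<close>
    have "ereal Z \<le> ereal (birth X (c @ (if c \<in> ?V then [k c] else [0])) \<omega>)"
      using Z_le[of c] outside[OF c] by (auto simp: birth_snoc)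
    also have "\<dots> \<le> ereal (birth X c \<omega>) + explosion X c \<omega>"
      using explosion_ge[OF pos, of c] c by auto
    finally show "ereal Z \<le> ereal (birth X c \<omega>) + explosion X c \<omega>" .
  qed
  moreover obtain c where c: "c \<in> ?V" "Z = birth X (c @ [k c]) \<omega>"
  proof -
    have "Z \<in> (\<lambda>c. birth X (c @ [k c]) \<omega>) ` ?V"
      unfolding Z_def using fin \<open>[] \<in> ?V\<close> by (intro Min_in) blast+
    then show ?thesis using that by blast
  qed
  \<comment> \<open>The boundary vertex attaining \<open>Z\<close> is not early, so its birth is at
    least the tree explosion time. With the bound just shown the two coincide, against
    \<open>neq\<close>.\<close>
  ultimately show False
    using k[of c] neq[of "c @ [k c]"] by (auto simp: not_less)
qed

end

section \<open>Measurability of the jump trees and almost sure absence of ties\<close>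

context exponential_clocks
begin

lemma pred_rank_le [measurable]:
  assumes a: "a \<in> nat_seqs"
  shows "Measurable.pred M (rank_le X n a)"
proof -
  note [measurable] = random_variable_birth[OF a]
  show ?thesis
    unfolding rank_le_def[abs_def]
  proof (intro pred_intros_countable_bounded pred_intros_logic)
    fix F c assume F: "F \<in> {F. set F \<subseteq> nat_seqs \<and> length F \<le> n}" and c: "c \<in> nat_seqs"
    note [measurable] = random_variable_birth[OF c]
    show "Measurable.pred M (\<lambda>\<omega>. ereal (birth X c \<omega>) < tree_explosion X \<omega>)"
      "Measurable.pred M (\<lambda>\<omega>. birth X c \<omega> < birth X a \<omega>)"
      by measurable
    fix d assume "d \<in> set F"
    with F have [measurable]: "birth X d \<in> borel_measurable M"
      by (intro random_variable_birth) auto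
    show "Measurable.pred M (\<lambda>\<omega>. birth X c \<omega> = birth X d \<omega>)"
      by measurable
  qed
qed

lemma pred_well_timed [measurable]: "Measurable.pred M (well_timed X)"
proof -
  have *: "Measurable.pred M (\<lambda>\<omega>. ereal (birth X a \<omega>) < tree_explosion X \<omega>)" if "a \<in> nat_seqs" for a
    using random_variable_birth[OF that] by measurable
  show ?thesis
    unfolding well_timed_iff[abs_def]
    by (intro pred_intros_countable_bounded pred_intros_logic pred_intros_countable
        countable_nat_list_set pred_rank_le *)
qed

text \<open>The two kinds of outcomes are treated apart: ranks decide membership on the well-timed
  ones, and on the others a birth time is compared with the fixed real \<open>?t\<close>.\<close>

lemma measurable_jump_trees: "(\<lambda>\<omega> n. jump_tree X n \<omega>) \<in> M \<rightarrow>\<^sub>M tree_path_space"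
  unfolding tree_path_space_def
proof (rule measurable_PiM_single')
  fix n :: nat
  show "jump_tree X n \<in> M \<rightarrow>\<^sub>M tree_space"
    unfolding tree_space_def
  proof (rule measurable_sigma_sets[OF sets_measure_of])
    fix A assume "A \<in> range (\<lambda>a::nat list. {A. a \<in> A})"
    then obtain a :: "nat list" where A: "A = {A. a \<in> A}" by auto
    let ?t = "(THE g::nat \<Rightarrow> real. False) n"
    show "jump_tree X n -` A \<inter> space M \<in> sets M"
    proof (cases "a \<in> nat_seqs")
      case True
      note [measurable] = random_variable_birth[OF True] pred_rank_le[OF True]
      have "jump_tree X n -` A \<inter> space M =
          {\<omega>\<in>space M. well_timed X \<omega> \<and> rank_le X n a \<omega> \<or> \<not> well_timed X \<omega> \<and> birth X a \<omega> \<le> ?t}"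
      proof -
        have "a \<in> jump_tree X n \<omega> \<longleftrightarrow>
            well_timed X \<omega> \<and> rank_le X n a \<omega> \<or> \<not> well_timed X \<omega> \<and> birth X a \<omega> \<le> ?t" for \<omega>
        proof (cases "well_timed X \<omega>")
          case wt: True
          then show ?thesis using jump_tree_iff_rank_le[OF wt True] by simp
        next
          case False
          then show ?thesis
            using True by (simp add: jump_tree_def alive_def birth_enum_not_well_timed)
        qed
        then show ?thesis unfolding A by auto
      qed
      also have "\<dots> \<in> sets M"
        by measurable
      finally show ?thesis .
    next
      case False
      then have "jump_tree X n -` A \<inter> space M = {}"
        by (auto simp: A jump_tree_def alive_def)
      then show ?thesis by simp
    qed
  qed auto
qed (auto simp: space_PiM)

text \<open>Clocks are numbered from 0, so \<open>(a, k - 1)\<close> is the last clock in the birth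
  of \<open>a @ [k]\<close>. The rest of that birth reads only \<open>J\<close>, and can be moved to
  the side of \<open>Z\<close>.\<close>

lemma AE_birth_neq:
  assumes a: "a @ [k] \<in> nat_seqs" and J: "J = nat_seqs \<times> UNIV - {(a, k - 1)}"
    and Z: "Z \<in> borel_measurable (clock_algebra J)"
  shows "AE \<omega> in M. birth X (a @ [k]) \<omega> \<noteq> Z \<omega>"
proof -
  have k: "k = Suc (k - 1)" using a by auto
  have "(a, j) \<notin> birth_clocks a" for j
    by (auto simp: birth_clocks_def)
  then have "birth_clocks (a @ [k - 1]) \<subseteq> J"
    using birth_clocks_subset[of a] a by (auto simp: J birth_clocks_snoc)
  then have [measurable]: "birth X (a @ [k - 1]) \<in> borel_measurable (clock_algebra J)"
    by (rule measurable_birth)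
  note [measurable] = Z
  have "AE \<omega> in M. X a (k - 1) \<omega> \<noteq> Z \<omega> - birth X (a @ [k - 1]) \<omega>"
  proof (rule AE_clock_neq)
    show "a \<in> nat_seqs" "J \<subseteq> nat_seqs \<times> UNIV" "(a, k - 1) \<notin> J"
      using a by (auto simp: J)
    show "(\<lambda>\<omega>. Z \<omega> - birth X (a @ [k - 1]) \<omega>) \<in> borel_measurable (clock_algebra J)"
      by measurable
  qed
  moreover have "birth X (a @ [k]) \<omega> = birth X (a @ [k - 1]) \<omega> + X a (k - 1) \<omega>" for \<omega>
    by (subst k) (rule birth_snoc_Suc)
  ultimately show ?thesis by (auto elim: AE_mp)
qed

text \<open>If the birth of \<open>b\<close> avoids the last clock of the birth of \<open>a\<close>,
  absence of atoms separates them. Otherwise \<open>b\<close> lies in the subtree of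
  \<open>a\<close> or of a later sibling of \<open>a\<close>, and positivity of the clocks makes it
  strictly younger.\<close>

lemma AE_inj_birth: "AE \<omega> in M. inj_on (\<lambda>a. birth X a \<omega>) nat_seqs"
proof -
  have "AE \<omega> in M. birth X a \<omega> \<noteq> birth X b \<omega>"
    if a: "a \<in> nat_seqs" and b: "b \<in> nat_seqs" and "a \<noteq> b" for a b
  proof (cases a rule: rev_cases)
    case Nil
    show ?thesis
      using AE_positive_clocks
    proof eventually_elim
      case (elim \<omega>)
      then have "birth X [] \<omega> + X [] 0 \<omega> \<le> birth X ([] @ b) \<omega>"
        using Nil that by (intro birth_less_append) auto
      then show ?case using Nil positive_clocksD[OF elim, of "[]" 0] by auto
    qed
  next
    case (snoc a' k)
    show ?thesis
    proof (cases "(a', k - 1) \<in> birth_clocks b")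
      case False
      then have "birth_clocks b \<subseteq> nat_seqs \<times> UNIV - {(a', k - 1)}"
        using birth_clocks_subset[OF b] by auto
      then show ?thesis
        unfolding snoc using a snoc by (intro AE_birth_neq[OF _ refl] measurable_birth) auto
    next
      case True
      then obtain l b' where b': "b = a' @ l # b'" "k - 1 < l" by (auto simp: birth_clocks_def)
      have k: "1 \<le> k" and a': "a' \<in> nat_seqs" using a snoc by auto
      show ?thesis
        using AE_positive_clocks
      proof eventually_elim
        case (elim \<omega>)
        note pos = elim(1)
        have *: "birth X (a' @ [l]) \<omega> \<le> birth X ((a' @ [l]) @ b') \<omega>"
          using b b' by (intro birth_mono_append[OF pos]) auto
        show ?case
        proof (cases "l = k")
          case True
          then have "birth X a \<omega> + X a 0 \<omega> \<le> birth X (a @ b') \<omega>"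
            using \<open>a \<noteq> b\<close> b b' snoc by (intro birth_less_append[OF pos]) auto
          then show ?thesis using positive_clocksD[OF pos, OF a, of 0] b' snoc True by simp
        next
          case False
          then have "birth X (a' @ [k]) \<omega> + X a' k \<omega> \<le> birth X (a' @ [l]) \<omega>"
            using b' k a' by (intro birth_sibling_less[OF pos]) auto
          then show ?thesis using * positive_clocksD[OF pos, OF a', of k] b' snoc by simp
        qed
      qed
    qed
  qed
  then have "AE \<omega> in M. \<forall>a\<in>nat_seqs. \<forall>b\<in>nat_seqs. a \<noteq> b \<longrightarrow> birth X a \<omega> \<noteq> birth X b \<omega>"
    by (simp add: AE_ball_countable)
  then show ?thesis
    by eventually_elim (auto simp: inj_on_def)
qed

text \<open>The vertices whose explosion times involve the last clock before the birth of \<open>a\<close> explode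
  after the birth of \<open>a\<close> by a uniform margin, and the remaining ones are independent of this clock.\<close>

lemma AE_birth_neq_tree_explosion:
  "AE \<omega> in M. \<forall>a\<in>nat_seqs. ereal (birth X a \<omega>) \<noteq> tree_explosion X \<omega>"
proof -
  have "AE \<omega> in M. ereal (birth X a \<omega>) \<noteq> tree_explosion X \<omega>" if a: "a \<in> nat_seqs" for a
  proof (cases a rule: rev_cases)
    case Nil
    show ?thesis
      using AE_positive_clocks
    proof eventually_elim
      case (elim \<omega>)
      then show ?case
        using tree_explosion_pos[OF elim] Nil by (auto simp: zero_ereal_def)
    qed
  next
    case (snoc a' k)
    have a': "a' \<in> nat_seqs" and k: "1 \<le> k" using a snoc by auto
    define J where "J = nat_seqs \<times> (UNIV :: nat set) - {(a', k - 1)}"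
    \<comment> \<open>Here neither the birth nor the explosion of \<open>c\<close> reads the clock
      \<open>(a', k - 1)\<close>. The vertex \<open>a'\<close> is left out because its explosion
      sums all of its clocks.\<close>
    define C where "C = {c\<in>nat_seqs. c \<noteq> a' \<and> (a', k - 1) \<notin> birth_clocks c}"
    define R where "R \<omega> = (INF c\<in>C. ereal (birth X c \<omega>) + explosion X c \<omega>)" for \<omega>
    have "(\<lambda>\<omega>. ereal (birth X c \<omega>) + explosion X c \<omega>) \<in> borel_measurable (clock_algebra J)"
      if "c \<in> C" for c
    proof -
      have "birth_clocks c \<subseteq> J" "{c} \<times> UNIV \<subseteq> J"
        using that birth_clocks_subset[of c] by (auto simp: J_def C_def)
      note [measurable] = measurable_birth[OF this(1)] measurable_explosion[OF this(2)]
      show ?thesis by measurable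
    qed
    then have "R \<in> borel_measurable (clock_algebra J)"
      unfolding R_def[abs_def] by (intro borel_measurable_INF) auto
    \<comment> \<open>A real-valued variable is required. The default value for an infinite
      \<open>R\<close> does no harm, since the contradiction arises only where \<open>R\<close>
      equals the real birth time of \<open>a\<close>.\<close>
    then have "(\<lambda>\<omega>. real_of_ereal (R \<omega>)) \<in> borel_measurable (clock_algebra J)"
      by measurable
    then have "AE \<omega> in M. birth X (a' @ [k]) \<omega> \<noteq> real_of_ereal (R \<omega>)"
      using a snoc by (intro AE_birth_neq[OF _ J_def]) auto
    then show ?thesis
      using AE_positive_clocks
    proof eventually_elim
      case (elim \<omega>)
      note pos = elim(2)
      \<comment> \<open>The clock \<open>X a 0\<close> delays the explosions within the subtree of
        \<open>a\<close>; the clock \<open>X a' k\<close>, which runs from \<open>a' @ [k]\<close>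
        to its next sibling, delays those of \<open>a'\<close> and of the later siblings with their
        subtrees.\<close>
      define \<delta> where "\<delta> = min (X a 0 \<omega>) (X a' k \<omega>)"
      have \<delta>: "0 < \<delta>" using positive_clocksD[OF pos] a a' by (simp add: \<delta>_def)
      have late: "ereal (birth X a \<omega> + \<delta>) \<le> ereal (birth X c \<omega>) + explosion X c \<omega>"
        if c: "c \<in> nat_seqs" "c \<notin> C" for c
      proof (cases "c = a'")
        case True
        have "birth X a \<omega> + \<delta> \<le> birth X (a' @ [Suc k]) \<omega>"
          by (simp add: birth_snoc_Suc snoc \<delta>_def)
        then show ?thesis
          using explosion_ge[OF pos, of a' "Suc k"] a' True by (auto intro: order_trans[rotated])
      next
        case False
        then obtain l b where b: "c = a' @ l # b" "k - 1 < l"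
          using c by (auto simp: C_def birth_clocks_def)
        show ?thesis
        proof (cases "l = k")
          case True
          then show ?thesis
            using descendant_explosion_ge[OF pos, of a b] b c snoc
            by (auto simp: \<delta>_def intro: order_trans[rotated])
        next
          case False
          have "birth X (a' @ [k]) \<omega> + X a' k \<omega> \<le> birth X (a' @ [l]) \<omega>"
            using b k a' False by (intro birth_sibling_less[OF pos]) auto
          also have "\<dots> \<le> birth X ((a' @ [l]) @ b) \<omega>"
            using c b by (intro birth_mono_append[OF pos]) auto
          finally have "ereal (birth X a \<omega> + \<delta>) \<le> ereal (birth X c \<omega>)"
            using b snoc by (simp add: \<delta>_def)
          also have "\<dots> \<le> ereal (birth X c \<omega>) + explosion X c \<omega>"
            using c by (intro birth_le_explosion[OF pos])
          finally show ?thesis .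
        qed
      qed
      show ?case
      proof
        assume S: "ereal (birth X a \<omega>) = tree_explosion X \<omega>"
        have "tree_explosion X \<omega> \<le> R \<omega>"
          unfolding R_def by (rule INF_greatest) (auto simp: C_def intro: tree_explosion_le)
        moreover have "min (R \<omega>) (ereal (birth X a \<omega> + \<delta>)) \<le> tree_explosion X \<omega>"
          unfolding tree_explosion_def
        proof (rule INF_greatest)
          fix c assume c: "c \<in> nat_seqs"
          show "min (R \<omega>) (ereal (birth X a \<omega> + \<delta>)) \<le> ereal (birth X c \<omega>) + explosion X c \<omega>"
          proof (cases "c \<in> C")
            case True
            then have "R \<omega> \<le> ereal (birth X c \<omega>) + explosion X c \<omega>"
              unfolding R_def by (rule INF_lower)
            then show ?thesis by (rule min.coboundedI1)
          next
            case False
            then show ?thesis using late[OF c] by (rule_tac min.coboundedI2)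
          qed
        qed
        moreover have "tree_explosion X \<omega> < ereal (birth X a \<omega> + \<delta>)"
          using \<delta> by (simp add: S[symmetric])
        ultimately have "R \<omega> = ereal (birth X a \<omega>)"
          unfolding S by (auto simp: min_def split: if_splits)
        then show False using elim(1) snoc by simp
      qed
    qed
  qed
  then show ?thesis by (simp add: AE_ball_countable)
qed

end

section \<open>Local finiteness before the tree explosion\<close>

text \<open>Splitting off the first letter makes the sum over words factor. Summed over all lengths
  this is the geometric series for the expected total progeny of a branching process.\<close>

lemma nn_integral_prod_list_length:
  fixes g :: "'a \<Rightarrow> ennreal"
  shows "(\<integral>\<^sup>+xs. prod_list (map g xs) * indicator {xs. length xs = n} xs \<partial>count_space UNIV) =
    (\<integral>\<^sup>+x. g x \<partial>count_space UNIV) ^ n"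
proof (induction n)
  case 0
  have "(\<integral>\<^sup>+xs. prod_list (map g xs) * indicator {xs. length xs = 0} xs \<partial>count_space UNIV) =
      (\<integral>\<^sup>+xs. indicator {[] :: 'a list} xs \<partial>count_space UNIV)"
    by (rule nn_integral_cong) (auto split: split_indicator)
  then show ?case by simp
next
  case (Suc n)
  let ?h = "\<lambda>n xs. prod_list (map g xs) * indicator {xs. length xs = n} xs"
  have bij: "bij_betw (\<lambda>(x, xs). x # xs) UNIV (UNIV - {[] :: 'a list})"
    by (rule bij_betwI[where g="\<lambda>xs. (hd xs, tl xs)"]) auto
  have "(\<integral>\<^sup>+xs. ?h (Suc n) xs \<partial>count_space UNIV) =
      (\<integral>\<^sup>+xs. ?h (Suc n) xs \<partial>count_space (UNIV - {[]}))"
    by (rule nn_integral_count_space_eq) auto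
  also have "\<dots> = (\<integral>\<^sup>+p. ?h (Suc n) (case p of (x, xs) \<Rightarrow> x # xs) \<partial>count_space UNIV)"
    by (rule nn_integral_bij_count_space[OF bij, symmetric])
  also have "\<dots> = (\<integral>\<^sup>+p. (case p of (x, xs) \<Rightarrow> g x * ?h n xs) \<partial>count_space UNIV)"
    by (intro nn_integral_cong) (auto split: split_indicator)
  also have "\<dots> = (\<integral>\<^sup>+x. \<integral>\<^sup>+xs. g x * ?h n xs \<partial>count_space UNIV \<partial>count_space UNIV)"
    by (subst nn_integral_fst_count_space[symmetric]) simp
  also have "\<dots> = (\<integral>\<^sup>+x. g x * (\<integral>\<^sup>+xs. ?h n xs \<partial>count_space UNIV) \<partial>count_space UNIV)"
    by (intro nn_integral_cong nn_integral_cmult) simp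
  also have "\<dots> = (\<integral>\<^sup>+x. g x \<partial>count_space UNIV) * (\<integral>\<^sup>+xs. ?h n xs \<partial>count_space UNIV)"
    by (rule nn_integral_multc) simp
  finally show ?case by (simp add: Suc.IH)
qed

lemma nn_integral_prod_list:
  fixes g :: "'a \<Rightarrow> ennreal"
  shows "(\<integral>\<^sup>+xs. prod_list (map g xs) \<partial>count_space UNIV) = (\<Sum>n. (\<integral>\<^sup>+x. g x \<partial>count_space UNIV) ^ n)"
proof -
  have "(\<integral>\<^sup>+xs. prod_list (map g xs) \<partial>count_space UNIV) =
      (\<integral>\<^sup>+xs. (\<Sum>n. prod_list (map g xs) * indicator {xs. length xs = n} xs) \<partial>count_space UNIV)"
  proof (rule nn_integral_cong)
    fix xs :: "'a list"
    have "(\<lambda>n. prod_list (map g xs) * indicator {xs. length xs = n} xs) sums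
        (\<Sum>n\<in>{length xs}. prod_list (map g xs) * indicator {xs. length xs = n} xs)"
      by (rule sums_finite) auto
    then show "prod_list (map g xs) = (\<Sum>n. prod_list (map g xs) * indicator {xs. length xs = n} xs)"
      by (simp add: sums_iff)
  qed
  also have "\<dots> = (\<Sum>n. (\<integral>\<^sup>+x. g x \<partial>count_space UNIV) ^ n)"
    by (subst nn_integral_suminf) (simp_all add: nn_integral_prod_list_length)
  finally show ?thesis .
qed

text \<open>This is Markov's inequality for counting measure, where finite measure means finite
  cardinality.\<close>

lemma finite_of_nn_integral_count_space:
  assumes "(\<integral>\<^sup>+x. h x \<partial>count_space A) < \<infinity>" "0 < c"
  shows "finite {x\<in>A. ennreal c \<le> h x}"
proof -
  have c: "1 \<le> ennreal (1 / c) * h x \<longleftrightarrow> ennreal c \<le> h x" for x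
  proof
    assume "1 \<le> ennreal (1 / c) * h x"
    then have "ennreal c * 1 \<le> ennreal c * (ennreal (1 / c) * h x)" by (rule mult_left_mono) simp
    also have "\<dots> = h x" using assms(2) by (simp add: mult.assoc[symmetric] ennreal_mult[symmetric])
    finally show "ennreal c \<le> h x" by simp
  next
    assume "ennreal c \<le> h x"
    then have "ennreal (1 / c) * ennreal c \<le> ennreal (1 / c) * h x" by (rule mult_left_mono) simp
    then show "1 \<le> ennreal (1 / c) * h x" using assms(2) by (simp add: ennreal_mult[symmetric])
  qed
  have "emeasure (count_space A) {x\<in>A. 1 \<le> ennreal (1 / c) * h x} \<le>
      ennreal (1 / c) * (\<integral>\<^sup>+x. h x * indicator A x \<partial>count_space A)"
    by (rule nn_integral_Markov_inequality) auto
  also have "(\<integral>\<^sup>+x. h x * indicator A x \<partial>count_space A) = (\<integral>\<^sup>+x. h x \<partial>count_space A)"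
    by (rule nn_integral_cong) simp
  also have "ennreal (1 / c) * (\<integral>\<^sup>+x. h x \<partial>count_space A) < \<infinity>"
    using assms by (simp add: ennreal_mult_less_top)
  finally have "emeasure (count_space A) {x\<in>A. ennreal c \<le> h x} < \<infinity>"
    unfolding c .
  then show ?thesis
    by (subst (asm) emeasure_count_space) (auto split: if_splits)
qed

text \<open>Stretched exponentials beat every power. The factor \<open>real j\<close> arises because
  a late clock with index \<open>j\<close> qualifies the edges with labels
  \<open>1, ..., j\<close>.\<close>

lemma summable_stretched_exponential:
  fixes e s :: real
  assumes "0 < e" "0 < s"
  shows "summable (\<lambda>j. real j * exp (- e * (real j + 1) powr s))"
proof (rule summable_comparison_test_bigo)
  show "summable (\<lambda>j. norm (1 / real j ^ 2))"
    using inverse_power_summable[of 2, where 'a=real] by (simp add: inverse_eq_divide)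
  show "(\<lambda>j. real j * exp (- e * (real j + 1) powr s)) \<in> O(\<lambda>j. 1 / real j ^ 2)"
    using assms by real_asymp
qed

section \<open>Discounted first-moment bounds along paths\<close>

context exponential_clocks
begin

text \<open>A vertex \<open>c\<close> all of whose clocks from the \<open>k\<close>-th on are at most \<open>u j\<close> explodes within
  \<open>suminf u\<close> of the birth of \<open>c @ [k]\<close>; the weight is only given to the remaining edges.\<close>

definition edge_weight :: "(nat \<Rightarrow> real) \<Rightarrow> real \<Rightarrow> nat list \<Rightarrow> nat \<Rightarrow> 'w \<Rightarrow> ennreal" where
  "edge_weight u l c k \<omega> = (if \<exists>j\<in>{k..}. u j < X c j \<omega> then ennreal (exp (- l * X c 0 \<omega>)) else 0)"

definition path_weight :: "(nat \<Rightarrow> real) \<Rightarrow> real \<Rightarrow> nat list \<Rightarrow> 'w \<Rightarrow> ennreal" where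
  "path_weight u l a \<omega> = (\<Prod>i<length a. edge_weight u l (take i a) (a ! i) \<omega>)"

lemma path_weight_Nil [simp]: "path_weight u l [] \<omega> = 1"
  by (simp add: path_weight_def)

lemma path_weight_snoc:
  "path_weight u l (a @ [k]) \<omega> = path_weight u l a \<omega> * edge_weight u l a k \<omega>"
proof -
  have "(\<Prod>i<length a. edge_weight u l (take i (a @ [k])) ((a @ [k]) ! i) \<omega>) = path_weight u l a \<omega>"
    unfolding path_weight_def by (intro prod.cong) (auto simp: nth_append)
  then show ?thesis by (simp add: path_weight_def)
qed

lemma edge_weight_eq:
  "edge_weight u l c k \<omega> =
    ennreal (exp (- l * X c 0 \<omega>)) * indicator {\<omega>. \<exists>j\<in>{k..}. u j < X c j \<omega>} \<omega>"
  by (auto simp: edge_weight_def split: split_indicator)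

lemma measurable_late_clock:
  assumes "{c} \<times> {k..} \<subseteq> J"
  shows "(\<lambda>\<omega>. indicator {\<omega>. \<exists>j\<in>{k..}. u j < X c j \<omega>} \<omega> :: ennreal) \<in> borel_measurable (clock_algebra J)"
proof -
  have *: "Measurable.pred (clock_algebra J) (\<lambda>\<omega>. \<exists>j\<in>{k..}. u j < X c j \<omega>)"
  proof (rule pred_intros_countable_bounded)
    fix j assume "j \<in> {k..}"
    then have [measurable]: "X c j \<in> borel_measurable (clock_algebra J)"
      using assms by (intro measurable_clock) auto
    show "Measurable.pred (clock_algebra J) (\<lambda>\<omega>. u j < X c j \<omega>)"
      by measurable
  qed
  have "(\<lambda>\<omega>. if \<exists>j\<in>{k..}. u j < X c j \<omega> then 1 else 0 :: ennreal) \<in> borel_measurable (clock_algebra J)"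
    using * by measurable
  then show ?thesis by (simp add: indicator_def of_bool_def)
qed

lemma measurable_edge_weight:
  assumes J: "{c} \<times> UNIV \<subseteq> J"
  shows "edge_weight u l c k \<in> borel_measurable (clock_algebra J)"
proof -
  have "{c} \<times> {k..} \<subseteq> J" using J by auto
  note [measurable] = measurable_late_clock[OF this]
  have [measurable]: "X c 0 \<in> borel_measurable (clock_algebra J)"
    using J by (intro measurable_clock) auto
  show ?thesis
    unfolding edge_weight_eq[abs_def] by measurable
qed

text \<open>The set on the left consists of the proper ancestors of \<open>a\<close>. As the path
  weight reads none of the clocks of \<open>a\<close> itself, it is independent of the weights of
  the edges leaving \<open>a\<close>.\<close>

lemma measurable_path_weight:
  "{c. \<exists>k b. a = c @ k # b} \<times> UNIV \<subseteq> J \<Longrightarrow> path_weight u l a \<in> borel_measurable (clock_algebra J)"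
proof (induction a rule: rev_induct)
  case Nil
  have "path_weight u l [] = (\<lambda>_. 1)" by (rule ext) simp
  then show ?case by simp
next
  case (snoc k a)
  have sub: "{c. \<exists>k b. a = c @ k # b} \<times> UNIV \<subseteq> J" "{a} \<times> UNIV \<subseteq> J"
    using snoc.prems by fastforce+
  note [measurable] = snoc.IH[OF sub(1)] measurable_edge_weight[OF sub(2)]
  have "path_weight u l (a @ [k]) = (\<lambda>\<omega>. path_weight u l a \<omega> * edge_weight u l a k \<omega>)"
    by (rule ext) (rule path_weight_snoc)
  then show ?case by simp
qed

text \<open>Multiplying the density by the exponential discount gives a multiple of the exponential
  density with the larger rate \<open>f j + l\<close>, which integrates to 1.\<close>

lemma nn_integral_clock_Laplace:
  assumes c: "c \<in> nat_seqs" and l: "0 \<le> l"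
  shows "(\<integral>\<^sup>+\<omega>. ennreal (exp (- l * X c j \<omega>)) \<partial>M) = ennreal (f j / (f j + l))"
proof -
  have pos: "0 < f j + l" using f_pos[of j] l by simp
  have "(\<integral>\<^sup>+\<omega>. ennreal (exp (- l * X c j \<omega>)) \<partial>M) =
      (\<integral>\<^sup>+x. ennreal (exponential_density (f j) x) * ennreal (exp (- l * x)) \<partial>lborel)"
    by (rule distributed_nn_integral[OF exponential[OF c], symmetric]) simp
  also have "\<dots> = (\<integral>\<^sup>+x. ennreal (f j / (f j + l)) * ennreal (exponential_density (f j + l) x) \<partial>lborel)"
  proof (rule nn_integral_cong)
    fix x :: real
    have "exponential_density (f j) x * exp (- l * x) =
        f j / (f j + l) * exponential_density (f j + l) x"
    proof -
      have "exp (- x * f j) * exp (- l * x) = exp (- x * (f j + l))"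
        by (simp add: exp_add[symmetric] algebra_simps)
      then show ?thesis
        using pos by (simp add: exponential_density_def)
    qed
    then show "ennreal (exponential_density (f j) x) * ennreal (exp (- l * x)) =
        ennreal (f j / (f j + l)) * ennreal (exponential_density (f j + l) x)"
      using f_pos[of j] pos l
      by (simp add: ennreal_mult[symmetric] exponential_density_nonneg del: mult_minus_left)
  qed
  also have "\<dots> = ennreal (f j / (f j + l)) * (\<integral>\<^sup>+x. ennreal (exponential_density (f j + l) x) \<partial>lborel)"
    by (rule nn_integral_cmult) simp
  also have "(\<integral>\<^sup>+x. ennreal (exponential_density (f j + l) x) \<partial>lborel) = 1"
    using prob_space.emeasure_space_1[OF prob_space_exponential_density[OF pos]]
    by (simp add: emeasure_density)
  finally show ?thesis by simp
qed

lemma nn_integral_late_clock: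
  assumes c: "c \<in> nat_seqs" and u: "\<And>j. 0 \<le> u j"
  shows "(\<integral>\<^sup>+\<omega>. indicator {\<omega>. \<exists>j\<in>{k..}. u j < X c j \<omega>} \<omega> \<partial>M) \<le>
    (\<Sum>j. ennreal (exp (- f j * u j)) * indicator {k..} j)"
proof -
  note [measurable] = random_variable_X[OF c]
  let ?A = "\<lambda>j. {\<omega>\<in>space M. u j < X c j \<omega> \<and> j \<in> {k..}}"
  have "(\<integral>\<^sup>+\<omega>. indicator {\<omega>. \<exists>j\<in>{k..}. u j < X c j \<omega>} \<omega> \<partial>M) = (\<integral>\<^sup>+\<omega>. indicator (\<Union>j. ?A j) \<omega> \<partial>M)"
    by (intro nn_integral_cong) (auto split: split_indicator)
  also have "\<dots> = emeasure M (\<Union>j. ?A j)"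
    by (rule nn_integral_indicator) measurable
  also have "\<dots> \<le> (\<Sum>j. emeasure M (?A j))"
    by (rule emeasure_subadditive_countably) auto
  also have "(\<lambda>j. emeasure M (?A j)) = (\<lambda>j. ennreal (exp (- f j * u j)) * indicator {k..} j)"
    using prob_clock_gt[OF c u] by (auto simp: fun_eq_iff emeasure_eq_measure split: split_indicator)
  finally show ?thesis .
qed

text \<open>The discount uses only clock 0 and the event only clocks from \<open>k\<close> on. Since
  \<open>1 <= k\<close> these are disjoint, hence the expectation factors.\<close>

lemma nn_integral_edge_weight:
  assumes c: "c \<in> nat_seqs" and k: "1 \<le> k" and l: "0 \<le> l" and u: "\<And>j. 0 \<le> u j"
  shows "(\<integral>\<^sup>+\<omega>. edge_weight u l c k \<omega> \<partial>M) \<le>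
    ennreal (f 0 / (f 0 + l)) * (\<Sum>j. ennreal (exp (- f j * u j)) * indicator {k..} j)"
proof -
  have [measurable]: "X c 0 \<in> borel_measurable (clock_algebra {(c, 0)})"
    by (rule measurable_clock) simp
  have "(\<integral>\<^sup>+\<omega>. edge_weight u l c k \<omega> \<partial>M) =
      (\<integral>\<^sup>+\<omega>. ennreal (exp (- l * X c 0 \<omega>)) \<partial>M) *
      (\<integral>\<^sup>+\<omega>. indicator {\<omega>. \<exists>j\<in>{k..}. u j < X c j \<omega>} \<omega> \<partial>M)"
    unfolding edge_weight_eq
    by (rule nn_integral_clock_algebras[where J="{(c, 0)}" and K="{c} \<times> {k..}"])
       (use c k measurable_late_clock in auto)
  then show ?thesis
    using nn_integral_late_clock[OF c u, of k] nn_integral_clock_Laplace[OF c l, of 0]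
    by (simp add: mult_left_mono)
qed

lemma nn_integral_path_weight:
  assumes l: "0 \<le> l" and u: "\<And>j. 0 \<le> u j"
  shows "a \<in> nat_seqs \<Longrightarrow> (\<integral>\<^sup>+\<omega>. path_weight u l a \<omega> \<partial>M) \<le>
    prod_list (map (\<lambda>k. ennreal (f 0 / (f 0 + l)) *
      (\<Sum>j. ennreal (exp (- f j * u j)) * indicator {k..} j)) a)"
proof (induction a rule: rev_induct)
  case Nil
  show ?case by (simp add: emeasure_space_1)
next
  case (snoc k a)
  then have a: "a \<in> nat_seqs" and k: "1 \<le> k" by auto
  have "(\<integral>\<^sup>+\<omega>. path_weight u l (a @ [k]) \<omega> \<partial>M) =
      (\<integral>\<^sup>+\<omega>. path_weight u l a \<omega> \<partial>M) * (\<integral>\<^sup>+\<omega>. edge_weight u l a k \<omega> \<partial>M)"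
    unfolding path_weight_snoc
    using a
    by (intro nn_integral_clock_algebras[where J="{c. \<exists>k b. a = c @ k # b} \<times> UNIV" and K="{a} \<times> UNIV"]
        measurable_path_weight measurable_edge_weight order_refl) auto
  also have "\<dots> \<le> prod_list (map (\<lambda>k. ennreal (f 0 / (f 0 + l)) *
      (\<Sum>j. ennreal (exp (- f j * u j)) * indicator {k..} j)) a) *
      (ennreal (f 0 / (f 0 + l)) * (\<Sum>j. ennreal (exp (- f j * u j)) * indicator {k..} j))"
    by (intro mult_mono snoc.IH a nn_integral_edge_weight k l u) auto
  finally show ?case by simp
qed

text \<open>The first clocks of the ancestors add up to at most the birth time of \<open>a\<close>,
  so the discounts multiply to at least the claimed value. This turns a finite total weight into a
  finite number of vertices born by a given time.\<close>

lemma path_weight_ge: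
  assumes pos: "positive_clocks X \<omega>" and l: "0 \<le> l"
  shows "a \<in> nat_seqs \<Longrightarrow> (\<And>c k b. a = c @ k # b \<Longrightarrow> \<exists>j\<ge>k. u j < X c j \<omega>) \<Longrightarrow>
    ennreal (exp (- l * birth X a \<omega>)) \<le> path_weight u l a \<omega>"
proof (induction a rule: rev_induct)
  case Nil
  show ?case by simp
next
  case (snoc k a)
  then have a: "a \<in> nat_seqs" and k: "1 \<le> k" by auto
  have IH: "ennreal (exp (- l * birth X a \<omega>)) \<le> path_weight u l a \<omega>"
    using a by (rule snoc.IH) (use snoc.prems(2) in force)
  have "\<exists>j\<ge>k. u j < X a j \<omega>" by (rule snoc.prems(2)) simp
  then have e: "edge_weight u l a k \<omega> = ennreal (exp (- l * X a 0 \<omega>))"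
    by (auto simp: edge_weight_def)
  have "l * (birth X a \<omega> + X a 0 \<omega>) \<le> l * birth X (a @ [k]) \<omega>"
    using l birth_less_child[OF pos a k] by (rule mult_left_mono[rotated])
  then have "exp (- l * birth X (a @ [k]) \<omega>) \<le> exp (- l * birth X a \<omega>) * exp (- l * X a 0 \<omega>)"
    by (simp add: exp_add[symmetric] algebra_simps)
  then have "ennreal (exp (- l * birth X (a @ [k]) \<omega>)) \<le>
      ennreal (exp (- l * birth X a \<omega>)) * ennreal (exp (- l * X a 0 \<omega>))"
    by (simp add: ennreal_mult[symmetric])
  also have "\<dots> \<le> path_weight u l (a @ [k]) \<omega>"
    unfolding path_weight_snoc e by (intro mult_right_mono IH) simp
  finally show ?case .
qed

text \<open>The total weight of the tree is that of a branching process with mean offspring at most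
  \<open>1 / 2\<close> once the discount rate \<open>l\<close> is large.\<close>

lemma AE_path_weight_finite:
  assumes u: "\<And>j. 0 \<le> u j" and sum: "summable (\<lambda>j. real j * exp (- f j * u j))"
  shows "\<exists>l\<ge>0. AE \<omega> in M. (\<integral>\<^sup>+a. path_weight u l a \<omega> \<partial>count_space nat_seqs) < \<infinity>"
proof -
  define S where "S = (\<Sum>j. real j * exp (- f j * u j))"
  have S: "0 \<le> S" unfolding S_def by (intro suminf_nonneg sum) simp
  \<comment> \<open>With this rate the mean offspring is at most \<open>S / (1 + 2 * S)\<close>,
    which is below one half.\<close>
  define l where "l = 2 * S * f 0"
  have l: "0 \<le> l" using S f_pos[of 0] by (simp add: l_def)
  define q where "q k = (\<Sum>j. ennreal (exp (- f j * u j)) * indicator {k..} j)" for k :: nat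
  define g where "g k = ennreal (f 0 / (f 0 + l)) * q k * indicator {1..} k" for k :: nat
  \<comment> \<open>After exchanging the two sums, each \<open>j\<close> is counted once for every
    label from 1 to \<open>j\<close>.\<close>
  have q_sum: "(\<integral>\<^sup>+k. q k * indicator {1..} k \<partial>count_space UNIV) = ennreal S"
  proof -
    have "(\<integral>\<^sup>+k. q k * indicator {1..} k \<partial>count_space UNIV) =
        (\<integral>\<^sup>+k. (\<Sum>j. ennreal (exp (- f j * u j)) * indicator {1..j} k) \<partial>count_space UNIV)"
      unfolding q_def by (intro nn_integral_cong) (auto split: split_indicator simp: indicator_def)
    also have "\<dots> = (\<Sum>j. \<integral>\<^sup>+k. ennreal (exp (- f j * u j)) * indicator {1..j} k \<partial>count_space UNIV)"
      by (rule nn_integral_suminf) simp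
    also have "\<dots> = (\<Sum>j. ennreal (real j * exp (- f j * u j)))"
    proof (rule suminf_cong)
      fix j
      have "(\<integral>\<^sup>+k. ennreal (exp (- f j * u j)) * indicator {1..j} k \<partial>count_space UNIV) =
          ennreal (exp (- f j * u j)) * ennreal (real j)"
        by (subst nn_integral_cmult_indicator) (simp_all add: ennreal_of_nat_eq_real_of_nat)
      then show "(\<integral>\<^sup>+k. ennreal (exp (- f j * u j)) * indicator {1..j} k \<partial>count_space UNIV) =
          ennreal (real j * exp (- f j * u j))"
        by (simp add: ennreal_mult mult.commute)
    qed
    also have "\<dots> = ennreal S"
      unfolding S_def by (intro suminf_ennreal2 sum) simp
    finally show ?thesis .
  qed
  have "(\<integral>\<^sup>+k. g k \<partial>count_space UNIV) =
      ennreal (f 0 / (f 0 + l)) * (\<integral>\<^sup>+k. q k * indicator {1..} k \<partial>count_space UNIV)"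
    unfolding g_def by (simp add: mult.assoc nn_integral_cmult)
  also have "\<dots> = ennreal (f 0 / (f 0 + l) * S)"
    unfolding q_sum using f_pos[of 0] l by (subst ennreal_mult') auto
  also have "f 0 / (f 0 + l) * S \<le> 1 / 2"
    using f_pos[of 0] S by (simp add: l_def field_simps add_pos_nonneg)
  finally have g_le: "(\<integral>\<^sup>+k. g k \<partial>count_space UNIV) \<le> ennreal (1 / 2)"
    by (simp add: ennreal_leI)
  have meas: "path_weight u l a \<in> borel_measurable M" if "a \<in> nat_seqs" for a
    by (rule measurable_clock_algebra[OF measurable_path_weight[OF order_refl]]) (use that in auto)
  have "(\<integral>\<^sup>+\<omega>. \<integral>\<^sup>+a. path_weight u l a \<omega> \<partial>count_space nat_seqs \<partial>M) =
      (\<integral>\<^sup>+a. \<integral>\<^sup>+\<omega>. path_weight u l a \<omega> \<partial>M \<partial>count_space nat_seqs)"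
    using meas by (intro nn_integral_count_space_nn_integral) auto
  also have "\<dots> \<le> (\<integral>\<^sup>+a. prod_list (map g a) \<partial>count_space nat_seqs)"
  proof (rule nn_integral_mono)
    fix a assume "a \<in> space (count_space nat_seqs)"
    then have a: "a \<in> nat_seqs" by simp
    then have *: "map g a = map (\<lambda>k. ennreal (f 0 / (f 0 + l)) * q k) a"
      by (auto simp: g_def nat_seqs_def)
    show "(\<integral>\<^sup>+\<omega>. path_weight u l a \<omega> \<partial>M) \<le> prod_list (map g a)"
      unfolding * q_def by (rule nn_integral_path_weight[OF l u a])
  qed
  also have "\<dots> \<le> (\<integral>\<^sup>+a. prod_list (map g a) \<partial>count_space UNIV)"
    by (subst nn_integral_count_space_indicator) (auto intro!: nn_integral_mono split: split_indicator)
  also have "\<dots> = (\<Sum>n. (\<integral>\<^sup>+k. g k \<partial>count_space UNIV) ^ n)"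
    by (rule nn_integral_prod_list)
  also have "\<dots> \<le> (\<Sum>n. ennreal ((1 / 2) ^ n))"
    using g_le by (intro suminf_le) (auto simp: ennreal_power[symmetric] intro: power_mono)
  also have "\<dots> = ennreal (\<Sum>n. (1 / 2) ^ n)"
    by (intro suminf_ennreal2 summable_geometric) auto
  also have "\<dots> < \<infinity>" by simp
  finally have "(\<integral>\<^sup>+\<omega>. \<integral>\<^sup>+a. path_weight u l a \<omega> \<partial>count_space nat_seqs \<partial>M) \<noteq> \<infinity>" by simp
  moreover have "(\<lambda>\<omega>. \<integral>\<^sup>+a. path_weight u l a \<omega> \<partial>count_space nat_seqs) \<in> borel_measurable M"
  proof -
    \<comment> \<open>Enumerating the vertices turns the integral over them into a series of random
      variables, from which measurability in the outcome can be read off.\<close>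
    let ?e = "from_nat_into (UNIV :: nat list set)"
    have e: "bij_betw ?e UNIV UNIV"
      by (intro bij_betw_from_nat_into) (auto simp: infinite_UNIV_listI)
    have "(\<integral>\<^sup>+a. path_weight u l a \<omega> \<partial>count_space nat_seqs) =
        (\<Sum>i. if ?e i \<in> nat_seqs then path_weight u l (?e i) \<omega> else 0)" for \<omega>
    proof -
      have "(\<integral>\<^sup>+a. path_weight u l a \<omega> \<partial>count_space nat_seqs) =
          (\<integral>\<^sup>+a. (if a \<in> nat_seqs then path_weight u l a \<omega> else 0) \<partial>count_space UNIV)"
        by (subst nn_integral_count_space_indicator)
           (auto intro!: nn_integral_cong split: split_indicator)
      then show ?thesis
        by (simp only: nn_integral_bij_count_space[OF e, symmetric] nn_integral_count_space_nat)
    qed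
    moreover have "(\<lambda>\<omega>. if ?e i \<in> nat_seqs then path_weight u l (?e i) \<omega> else 0) \<in> borel_measurable M" for i
      using meas by (cases "?e i \<in> nat_seqs") auto
    ultimately show ?thesis
      by simp
  qed
  ultimately have "AE \<omega> in M. (\<integral>\<^sup>+a. path_weight u l a \<omega> \<partial>count_space nat_seqs) \<noteq> \<infinity>"
    by (rule nn_integral_PInf_AE[rotated])
  then show ?thesis using l by (intro exI[of _ l]) (auto simp: less_top)
qed

text \<open>The margin left before the tree explosion is random and depends on \<open>t\<close>. The
  shares are therefore taken from the countable family \<open>w / Suc m\<close>, so that a single
  null set serves all margins.\<close>

lemma AE_finite_alive:
  assumes w: "\<And>j. 0 \<le> w j" "summable w"
    and sum: "\<And>e. 0 < e \<Longrightarrow> summable (\<lambda>j. real j * exp (- f j * (e * w j)))"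
  shows "AE \<omega> in M. \<forall>t. ereal t < tree_explosion X \<omega> \<longrightarrow> finite {a\<in>nat_seqs. birth X a \<omega> \<le> t}"
proof -
  have "\<exists>l\<ge>0. AE \<omega> in M. (\<integral>\<^sup>+a. path_weight (\<lambda>j. 1 / real (Suc m) * w j) l a \<omega> \<partial>count_space nat_seqs) < \<infinity>"
    for m
    using w by (intro AE_path_weight_finite sum mult_nonneg_nonneg) auto
  then obtain l where l: "\<And>m. 0 \<le> l m" and
    fin: "\<And>m. AE \<omega> in M. (\<integral>\<^sup>+a. path_weight (\<lambda>j. 1 / real (Suc m) * w j) (l m) a \<omega> \<partial>count_space nat_seqs) < \<infinity>"
    by metis
  have "AE \<omega> in M. \<forall>m. (\<integral>\<^sup>+a. path_weight (\<lambda>j. 1 / real (Suc m) * w j) (l m) a \<omega> \<partial>count_space nat_seqs) < \<infinity>"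
    using fin by (simp add: AE_all_countable)
  then show ?thesis
    using AE_positive_clocks
  proof eventually_elim
    case (elim \<omega>)
    note pos = elim(2)
    show ?case
    proof (intro allI impI)
      fix t assume t: "ereal t < tree_explosion X \<omega>"
      have "\<exists>d>0. ereal (t + d) < tree_explosion X \<omega>"
      proof -
        obtain s where "ereal t < ereal s" "ereal s < tree_explosion X \<omega>"
          using ereal_dense2[OF t] by auto
        then show ?thesis by (intro exI[of _ "s - t"]) simp
      qed
      then obtain d where d: "0 < d" "ereal (t + d) < tree_explosion X \<omega>" by blast
      have "(\<lambda>m. suminf w / real (Suc m)) \<longlonglongrightarrow> 0"
        by (rule LIMSEQ_Suc[OF lim_const_over_n])
      then have "\<forall>\<^sub>F m in sequentially. suminf w / real (Suc m) < d"
        using d(1) by (rule order_tendstoD)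
      then obtain m where m: "suminf w / real (Suc m) < d"
        unfolding eventually_sequentially by blast
      define u where "u j = 1 / real (Suc m) * w j" for j
      have u: "0 \<le> u j" "summable u" "suminf u < d" for j
      proof -
        show "0 \<le> u j" using w by (simp add: u_def)
        show "summable u" unfolding u_def[abs_def] by (intro summable_mult w)
        have "suminf u = 1 / real (Suc m) * suminf w"
          unfolding u_def[abs_def] by (rule suminf_mult[OF w(2)])
        then show "suminf u < d" using m by simp
      qed
      have "ennreal (exp (- l m * t)) \<le> path_weight u (l m) a \<omega>"
        if a: "a \<in> nat_seqs" "birth X a \<omega> \<le> t" for a
      proof -
        have late: "\<exists>j\<ge>k. u j < X c j \<omega>" if ab: "a = c @ k # b" for c k b
        proof (rule ccontr)
          assume "\<not> (\<exists>j\<ge>k. u j < X c j \<omega>)"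
          then have "X c j \<omega> \<le> u j" if "k \<le> j" for j using that by (auto simp: not_less)
          then have "ereal (birth X c \<omega>) + explosion X c \<omega> \<le> ereal (birth X (c @ [k]) \<omega> + suminf u)"
            using a ab u by (intro explosion_le[OF pos]) auto
          moreover have "birth X (c @ [k]) \<omega> \<le> birth X ((c @ [k]) @ b) \<omega>"
            using a ab by (intro birth_mono_append[OF pos]) auto
          moreover have "tree_explosion X \<omega> \<le> ereal (birth X c \<omega>) + explosion X c \<omega>"
            using a ab by (intro tree_explosion_le) auto
          ultimately have "tree_explosion X \<omega> \<le> ereal (t + d)"
            using a ab u(3) by (auto elim!: order_trans)
          then show False using d(2) by simp
        qed
        have "exp (- l m * t) \<le> exp (- l m * birth X a \<omega>)"
          using a l[of m] by (simp add: mult_left_mono)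
        then have "ennreal (exp (- l m * t)) \<le> ennreal (exp (- l m * birth X a \<omega>))"
          by (rule ennreal_leI)
        also have "\<dots> \<le> path_weight u (l m) a \<omega>"
          by (rule path_weight_ge[OF pos l a(1) late])
        finally show ?thesis .
      qed
      then have "{a\<in>nat_seqs. birth X a \<omega> \<le> t} \<subseteq> {a\<in>nat_seqs. ennreal (exp (- l m * t)) \<le> path_weight u (l m) a \<omega>}"
        by blast
      moreover have "finite {a\<in>nat_seqs. ennreal (exp (- l m * t)) \<le> path_weight u (l m) a \<omega>}"
        using elim(1) unfolding u_def[abs_def] by (intro finite_of_nn_integral_count_space) auto
      ultimately show "finite {a\<in>nat_seqs. birth X a \<omega> \<le> t}"
        by (rule finite_subset)
    qed
  qed
qed

end

section \<open>The jump trees of a regular outcome\<close>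

text \<open>The invariant of the growth. The equivalence combines closure under parents with
  gap-free labels; this makes \<open>next_child\<close> a new vertex and lets the growing vertex be
  recovered from the enlarged tree.\<close>

definition gn_tree :: "nat list set \<Rightarrow> bool" where
  "gn_tree A \<longleftrightarrow> finite A \<and> [] \<in> A \<and> A \<subseteq> nat_seqs \<and>
    (\<forall>a k. a @ [k] \<in> A \<longleftrightarrow> a \<in> A \<and> 1 \<le> k \<and> k \<le> nchildren A a)"

abbreviation next_child :: "nat list set \<Rightarrow> nat list \<Rightarrow> nat list" where
  "next_child A a \<equiv> a @ [Suc (nchildren A a)]"

lemma add_child_eq: "add_child A a = insert (next_child A a) A"
  by (simp add: add_child_def)

lemma gn_treeD:
  assumes "gn_tree A"
  shows "finite A" "[] \<in> A" "A \<subseteq> nat_seqs" "a @ [k] \<in> A \<longleftrightarrow> a \<in> A \<and> 1 \<le> k \<and> k \<le> nchildren A a"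
  using assms unfolding gn_tree_def by blast+

lemma next_child_notin: "gn_tree A \<Longrightarrow> next_child A a \<notin> A"
  by (simp add: gn_treeD(4))

lemma next_child_in_nat_seqs: "gn_tree A \<Longrightarrow> a \<in> A \<Longrightarrow> next_child A a \<in> nat_seqs"
  using gn_treeD(3) by auto

lemma add_child_inject:
  assumes "gn_tree A" "add_child A a = add_child A b"
  shows "a = b"
proof -
  have "next_child A a \<in> insert (next_child A b) A"
    using assms(2) by (auto simp: add_child_eq)
  then show ?thesis using next_child_notin[OF assms(1), of a] by simp
qed

lemma nchildren_singleton: "nchildren {[]} a = 0"
proof -
  have "{b \<in> {[]}. b \<noteq> [] \<and> butlast b = a} = {}" by auto
  then show ?thesis by (simp only: nchildren_def card.empty)
qed

lemma gn_tree_singleton: "gn_tree {[]}"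
  by (auto simp: gn_tree_def nchildren_singleton)

lemma nchildren_notin:
  assumes "gn_tree A" "a \<notin> A"
  shows "nchildren A a = 0"
proof -
  have "b \<notin> A" if "b \<noteq> []" "butlast b = a" for b
    using assms gn_treeD(4)[OF assms(1), of a "last b"] that by (metis append_butlast_last_id)
  then have "{b\<in>A. b \<noteq> [] \<and> butlast b = a} = {}" by blast
  then show ?thesis by (simp only: nchildren_def card.empty)
qed

lemma nchildren_add_child:
  assumes A: "gn_tree A"
  shows "nchildren (add_child A a) b = (if b = a then Suc (nchildren A a) else nchildren A b)"
proof -
  have "{c\<in>add_child A a. c \<noteq> [] \<and> butlast c = b} =
      (if b = a then insert (next_child A a) {c\<in>A. c \<noteq> [] \<and> butlast c = b}
       else {c\<in>A. c \<noteq> [] \<and> butlast c = b})"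
    by (auto simp: add_child_eq)
  then show ?thesis
    using gn_treeD(1)[OF A] next_child_notin[OF A, of a] by (simp add: nchildren_def)
qed

lemma gn_tree_add_child:
  assumes A: "gn_tree A" and a: "a \<in> A"
  shows "gn_tree (add_child A a)"
  unfolding gn_tree_def
proof (intro conjI allI)
  show "finite (add_child A a)" "[] \<in> add_child A a" "add_child A a \<subseteq> nat_seqs"
    using gn_treeD[OF A] a by (auto simp: add_child_eq)
  fix b k
  show "b @ [k] \<in> add_child A a \<longleftrightarrow>
      b \<in> add_child A a \<and> 1 \<le> k \<and> k \<le> nchildren (add_child A a) b"
    using gn_treeD(4)[OF A, of b k] a next_child_notin[OF A, of a] nchildren_notin[OF A, of b]
    unfolding nchildren_add_child[OF A]
    by (auto simp: add_child_eq split: if_splits)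
qed

text \<open>The index \<open>nchildren A b\<close> is included: this is the running clock of
  \<open>b\<close>, the last one in the birth time of its next child, which has label
  \<open>Suc (nchildren A b)\<close>.\<close>

definition tree_clocks :: "nat list set \<Rightarrow> (nat list \<times> nat) set" where
  "tree_clocks A = {(b, j). b \<in> A \<and> j \<le> nchildren A b}"

lemma birth_clocks_gn_tree:
  assumes A: "gn_tree A"
  shows "a \<in> A \<Longrightarrow> birth_clocks a \<subseteq> tree_clocks A"
proof (induction a rule: rev_induct)
  case (snoc k a)
  then have "a \<in> A" "k \<le> nchildren A a"
    using gn_treeD(4)[OF A] by auto
  then show ?case
    using snoc.IH by (auto simp: birth_clocks_snoc tree_clocks_def)
qed simp

lemma birth_clocks_next_child:
  "gn_tree A \<Longrightarrow> a \<in> A \<Longrightarrow> birth_clocks (next_child A a) \<subseteq> tree_clocks A"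
  using birth_clocks_gn_tree[of A a] by (auto simp: birth_clocks_snoc tree_clocks_def)

lemma tree_clocks_add_child:
  assumes A: "gn_tree A" and a: "a \<in> A"
  shows "tree_clocks A \<subseteq> tree_clocks (add_child A a)"
proof -
  have "A \<subseteq> add_child A a" by (auto simp: add_child_eq)
  then show ?thesis by (auto simp: tree_clocks_def nchildren_add_child[OF A])
qed

text \<open>The almost sure properties under which everything else about the jump trees is argued
  for a fixed outcome.\<close>

definition regular :: "(nat list \<Rightarrow> nat \<Rightarrow> 'w \<Rightarrow> real) \<Rightarrow> 'w \<Rightarrow> bool" where
  "regular X \<omega> \<longleftrightarrow> positive_clocks X \<omega> \<and> inj_on (\<lambda>a. birth X a \<omega>) nat_seqs \<and>
    (\<forall>a\<in>nat_seqs. ereal (birth X a \<omega>) \<noteq> tree_explosion X \<omega>) \<and>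
    (\<forall>t. ereal t < tree_explosion X \<omega> \<longrightarrow> finite {a\<in>nat_seqs. birth X a \<omega> \<le> t})"

context
  fixes X :: "nat list \<Rightarrow> nat \<Rightarrow> 'w \<Rightarrow> real" and \<omega> :: 'w
  assumes reg: "regular X \<omega>"
begin

private lemma pos: "positive_clocks X \<omega>"
  and inj: "inj_on (\<lambda>a. birth X a \<omega>) nat_seqs"
  and neq: "a \<in> nat_seqs \<Longrightarrow> ereal (birth X a \<omega>) \<noteq> tree_explosion X \<omega>"
  and fin: "ereal t < tree_explosion X \<omega> \<Longrightarrow> finite {a\<in>nat_seqs. birth X a \<omega> \<le> t}"
  using reg by (auto simp: regular_def)

lemma regular_well_timed: "well_timed X \<omega>"
  unfolding well_timed_def ex_strict_mono_enumeration_iff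
proof (intro conjI ballI)
  let ?V = "{a\<in>nat_seqs. ereal (birth X a \<omega>) < tree_explosion X \<omega>}"
  have E: "early_births X \<omega> = (\<lambda>a. birth X a \<omega>) ` ?V"
    by (auto simp: early_births_def)
  have "infinite ?V"
    using neq by (rule infinite_early_vertices[OF pos])
  moreover have "inj_on (\<lambda>a. birth X a \<omega>) ?V"
    using inj by (rule inj_on_subset) blast
  ultimately show "infinite (early_births X \<omega>)"
    unfolding E using finite_image_iff by blast
  fix x assume "x \<in> early_births X \<omega>"
  then have "finite ((\<lambda>a. birth X a \<omega>) ` {a\<in>nat_seqs. birth X a \<omega> \<le> x})"
    by (intro finite_imageI fin) (auto simp: early_births_def)
  then show "finite {y\<in>early_births X \<omega>. y < x}"
    by (rule rev_finite_subset) (auto simp: early_births_def)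
qed

private lemma g_mono: "strict_mono (\<lambda>n. birth_enum X n \<omega>)"
  by (rule strict_mono_birth_enum[OF regular_well_timed])

lemma birth_enum_vertex:
  obtains a where "a \<in> nat_seqs" "ereal (birth X a \<omega>) < tree_explosion X \<omega>"
    "birth X a \<omega> = birth_enum X n \<omega>"
proof -
  have "birth_enum X n \<omega> \<in> early_births X \<omega>"
    using range_birth_enum[OF regular_well_timed] by blast
  then show ?thesis using that by (auto simp: early_births_def)
qed

lemma early_birth_enum:
  assumes "a \<in> nat_seqs" "ereal (birth X a \<omega>) < tree_explosion X \<omega>"
  obtains n where "birth X a \<omega> = birth_enum X n \<omega>"
proof -
  have "birth X a \<omega> \<in> range (\<lambda>n. birth_enum X n \<omega>)"
    using range_birth_enum[OF regular_well_timed] assms by (auto simp: early_births_def)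
  then show ?thesis using that by blast
qed

lemma birth_enum_less_tree_explosion: "ereal (birth_enum X n \<omega>) < tree_explosion X \<omega>"
  by (rule birth_enum_vertex[of n]) simp

lemma mem_jump_tree: "a \<in> jump_tree X n \<omega> \<longleftrightarrow> a \<in> nat_seqs \<and> birth X a \<omega> \<le> birth_enum X n \<omega>"
  by (simp add: jump_tree_def alive_def)

lemma finite_jump_tree: "finite (jump_tree X n \<omega>)"
  using fin[OF birth_enum_less_tree_explosion, of n] by (simp add: jump_tree_def alive_def)

lemma incseq_jump_tree: "incseq (\<lambda>n. jump_tree X n \<omega>)"
proof (rule incseq_SucI)
  fix n
  have "birth_enum X n \<omega> < birth_enum X (Suc n) \<omega>" by (rule strict_monoD[OF g_mono]) simp
  then show "jump_tree X n \<omega> \<subseteq> jump_tree X (Suc n) \<omega>" by (auto simp: mem_jump_tree)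
qed

text \<open>The set \<open>alive\<close> also admits births at the explosion time itself. Regularity
  excludes them, so the members of the right-hand side are exactly the enumerated early
  vertices.\<close>

lemma Union_jump_tree: "(\<Union>n. jump_tree X n \<omega>) = alive X (tree_explosion X \<omega>) \<omega>"
proof (intro equalityI subsetI)
  fix a assume "a \<in> (\<Union>n. jump_tree X n \<omega>)"
  then obtain n where "a \<in> nat_seqs" "birth X a \<omega> \<le> birth_enum X n \<omega>" by (auto simp: mem_jump_tree)
  then show "a \<in> alive X (tree_explosion X \<omega>) \<omega>"
    using birth_enum_less_tree_explosion[of n]
    by (auto simp: alive_def intro: order_trans[of _ "ereal (birth_enum X n \<omega>)"])
next
  fix a assume "a \<in> alive X (tree_explosion X \<omega>) \<omega>"
  then have a: "a \<in> nat_seqs" "ereal (birth X a \<omega>) < tree_explosion X \<omega>"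
    using neq by (auto simp: alive_def less_le)
  then show "a \<in> (\<Union>n. jump_tree X n \<omega>)"
    by (rule early_birth_enum) (use a in \<open>auto simp: mem_jump_tree\<close>)
qed

lemma birth_pos: "a \<in> nat_seqs \<Longrightarrow> a \<noteq> [] \<Longrightarrow> 0 < birth X a \<omega>"
  using birth_less_append[OF pos, of "[]" a] positive_clocksD[OF pos, of "[]" 0] by simp

lemma birth_enum_0: "birth_enum X 0 \<omega> = 0"
proof (rule antisym)
  have "ereal (birth X [] \<omega>) < tree_explosion X \<omega>"
    using tree_explosion_pos[OF pos] by (simp add: zero_ereal_def)
  then obtain n where "birth X [] \<omega> = birth_enum X n \<omega>"
    by (rule early_birth_enum[OF Nil_in_nat_seqs])
  then show "birth_enum X 0 \<omega> \<le> 0" using strict_mono_less_eq[OF g_mono, of 0 n] by simp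
  show "0 \<le> birth_enum X 0 \<omega>"
  proof (rule birth_enum_vertex[of 0])
    fix a assume "a \<in> nat_seqs" "birth X a \<omega> = birth_enum X 0 \<omega>"
    then show "0 \<le> birth_enum X 0 \<omega>" using birth_nonneg[OF pos, of a] by simp
  qed
qed

lemma jump_tree_0: "jump_tree X 0 \<omega> = {[]}"
proof (rule set_eqI)
  fix a
  show "a \<in> jump_tree X 0 \<omega> \<longleftrightarrow> a \<in> {[]}"
    using birth_pos[of a] by (cases "a = []") (auto simp: mem_jump_tree birth_enum_0)
qed

text \<open>Injectivity of birth times leaves a single newcomer. Its parent is strictly older and
  hence already present, and its present siblings are precisely those with smaller labels, so it
  carries the next free label.\<close>

lemma jump_tree_Suc:
  obtains a where "a \<in> jump_tree X n \<omega>"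
    "jump_tree X (Suc n) \<omega> = add_child (jump_tree X n \<omega>) a"
    "birth X (next_child (jump_tree X n \<omega>) a) \<omega> = birth_enum X (Suc n) \<omega>"
proof -
  let ?T = "\<lambda>n. jump_tree X n \<omega>"
  obtain v where v: "v \<in> nat_seqs" "birth X v \<omega> = birth_enum X (Suc n) \<omega>"
    by (rule birth_enum_vertex[of "Suc n"])
  have less: "birth_enum X n \<omega> < birth_enum X (Suc n) \<omega>" by (rule strict_monoD[OF g_mono]) simp
  have Suc: "?T (Suc n) = insert v (?T n)"
  proof (intro equalityI subsetI)
    fix b assume b: "b \<in> ?T (Suc n)"
    show "b \<in> insert v (?T n)"
    proof (cases "birth X b \<omega> \<le> birth_enum X n \<omega>")
      case True
      then show ?thesis using b by (simp add: mem_jump_tree)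
    next
      case False
      have "ereal (birth X b \<omega>) \<le> ereal (birth_enum X (Suc n) \<omega>)" using b by (simp add: mem_jump_tree)
      then have "ereal (birth X b \<omega>) < tree_explosion X \<omega>"
        using birth_enum_less_tree_explosion by (rule le_less_trans)
      then obtain m where m: "birth X b \<omega> = birth_enum X m \<omega>"
        using b by (elim early_birth_enum[rotated]) (auto simp: mem_jump_tree)
      have "n < m" "m \<le> Suc n"
        using False b m strict_mono_less[OF g_mono] strict_mono_less_eq[OF g_mono]
        by (auto simp: mem_jump_tree)
      then have "m = Suc n" by simp
      then show ?thesis
        using inj_onD[OF inj, of b v] m v b by (simp add: mem_jump_tree)
    qed
  qed (use less v in \<open>auto simp: mem_jump_tree\<close>)
  have "0 < birth X v \<omega>"
    using v birth_enum_0 strict_monoD[OF g_mono, of 0 "Suc n"] by simp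
  then have "v \<noteq> []" by auto
  then obtain a k where vk: "v = a @ [k]" by (cases v rule: rev_cases) auto
  have a: "a \<in> nat_seqs" and k: "1 \<le> k" using v vk by auto
  have "birth X a \<omega> < birth X v \<omega>"
    using birth_less_child[OF pos a k] positive_clocksD[OF pos a, of 0] vk by simp
  then have "a \<in> ?T (Suc n)"
    using a v by (simp add: mem_jump_tree)
  then have aT: "a \<in> ?T n"
    using vk by (simp add: Suc)
  have "{b\<in>?T n. b \<noteq> [] \<and> butlast b = a} = (\<lambda>j. a @ [j]) ` {1..k - 1}"
  proof (intro equalityI subsetI)
    fix b assume b: "b \<in> {b\<in>?T n. b \<noteq> [] \<and> butlast b = a}"
    then have "b = a @ [last b]" using append_butlast_last_id[of b] by simp
    then obtain j where j: "b = a @ [j]" by blast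
    have "birth X (a @ [j]) \<omega> < birth X (a @ [k]) \<omega>"
      using b j less v vk by (simp add: mem_jump_tree)
    then have "j < k" by (simp add: birth_sibling_less_iff[OF pos a])
    moreover have "1 \<le> j" using b j by (simp add: mem_jump_tree)
    ultimately show "b \<in> (\<lambda>j. a @ [j]) ` {1..k - 1}" using j by auto
  next
    fix b assume "b \<in> (\<lambda>j. a @ [j]) ` {1..k - 1}"
    then obtain j where "b = a @ [j]" "j \<in> {1..k - 1}" by (rule imageE)
    then have j: "b = a @ [j]" "1 \<le> j" "j < k" using k by auto
    then have "birth X b \<omega> < birth X v \<omega>"
      using vk birth_sibling_less_iff[OF pos a] by simp
    then have "b \<in> ?T (Suc n)" "b \<noteq> v"
      using a j v by (auto simp: mem_jump_tree)
    then show "b \<in> {b\<in>?T n. b \<noteq> [] \<and> butlast b = a}"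
      using Suc j by simp
  qed
  then have "nchildren (?T n) a = card ((\<lambda>j. a @ [j]) ` {1..k - 1})"
    by (simp add: nchildren_def)
  also have "\<dots> = k - 1"
    by (subst card_image) (auto intro: inj_onI)
  finally have "next_child (?T n) a = v"
    using vk k by simp
  then show ?thesis
    using that[of a] aT Suc v by (simp add: add_child_eq)
qed

end

section \<open>Growth histories as competitions between running clocks\<close>

definition growth_history :: "(nat \<Rightarrow> nat list set) \<Rightarrow> (nat \<Rightarrow> nat list) \<Rightarrow> nat \<Rightarrow> bool" where
  "growth_history A c n \<longleftrightarrow> A 0 = {[]} \<and> (\<forall>i<n. c i \<in> A i \<and> A (Suc i) = add_child (A i) (c i))"

text \<open>On regular outcomes this is the event that the jump trees follow the history \<open>A\<close>.\<close>

definition history_event ::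
    "(nat list \<Rightarrow> nat \<Rightarrow> 'w \<Rightarrow> real) \<Rightarrow> (nat \<Rightarrow> nat list set) \<Rightarrow> (nat \<Rightarrow> nat list) \<Rightarrow> nat \<Rightarrow> 'w \<Rightarrow> bool"
where
  "history_event X A c n \<omega> \<longleftrightarrow> (\<forall>i<n. \<forall>b\<in>A i - {c i}.
    birth X (next_child (A i) (c i)) \<omega> < birth X (next_child (A i) b) \<omega>)"

text \<open>On the history event of a regular outcome this is \<open>birth_enum X n\<close>. Written
  through the prescribed history, it reads only finitely many clocks, whereas the enumeration
  involves the tree explosion time.\<close>

definition last_birth ::
    "(nat list \<Rightarrow> nat \<Rightarrow> 'w \<Rightarrow> real) \<Rightarrow> (nat \<Rightarrow> nat list set) \<Rightarrow> (nat \<Rightarrow> nat list) \<Rightarrow> nat \<Rightarrow> 'w \<Rightarrow> real"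
where
  "last_birth X A c n \<omega> = (case n of 0 \<Rightarrow> 0 | Suc m \<Rightarrow> birth X (next_child (A m) (c m)) \<omega>)"

text \<open>On the history event, the time still left on the running clock of \<open>b\<close> after
  the birth numbered \<open>n\<close>; elsewhere it may be negative.\<close>

definition residual ::
    "(nat list \<Rightarrow> nat \<Rightarrow> 'w \<Rightarrow> real) \<Rightarrow> (nat \<Rightarrow> nat list set) \<Rightarrow> (nat \<Rightarrow> nat list) \<Rightarrow> nat \<Rightarrow>
      nat list \<Rightarrow> 'w \<Rightarrow> real"
where
  "residual X A c n b \<omega> = birth X (next_child (A n) b) \<omega> - last_birth X A c n \<omega>"

lemma growth_history_Suc:
  "growth_history A c (Suc n) \<longleftrightarrow>
    growth_history A c n \<and> c n \<in> A n \<and> A (Suc n) = add_child (A n) (c n)"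
  by (auto simp: growth_history_def less_Suc_eq)

lemma growth_history_gn_tree: "growth_history A c n \<Longrightarrow> gn_tree (A n)"
  by (induction n) (auto simp: growth_history_Suc gn_tree_add_child, simp add: growth_history_def gn_tree_singleton)

lemma history_event_Suc:
  "history_event X A c (Suc n) \<omega> \<longleftrightarrow> history_event X A c n \<omega> \<and>
    (\<forall>b\<in>A n - {c n}. birth X (next_child (A n) (c n)) \<omega> < birth X (next_child (A n) b) \<omega>)"
  by (auto simp: history_event_def less_Suc_eq)

text \<open>Once the trees agree up to \<open>n\<close>, the growing vertex is the one whose next
  child is born first. The other next children are absent from the next tree and so are born later;
  conversely an earlier one would have to be in that tree, which has room for one newcomer
  only.\<close>

lemma jump_trees_eq_iff:
  assumes reg: "regular X \<omega>"
  shows "growth_history A c n \<Longrightarrow>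
    (\<forall>i\<le>n. jump_tree X i \<omega> = A i) \<longleftrightarrow> history_event X A c n \<omega>"
proof (induction n)
  case 0
  then show ?case
    by (simp add: growth_history_def history_event_def jump_tree_0[OF reg])
next
  case (Suc n)
  then have hist: "growth_history A c n" and c: "c n \<in> A n" and A: "A (Suc n) = add_child (A n) (c n)"
    by (auto simp: growth_history_Suc)
  note gn = growth_history_gn_tree[OF hist]
  have "jump_tree X (Suc n) \<omega> = A (Suc n) \<longleftrightarrow>
      (\<forall>b\<in>A n - {c n}. birth X (next_child (A n) (c n)) \<omega> < birth X (next_child (A n) b) \<omega>)"
    (is "_ \<longleftrightarrow> ?first") if T: "jump_tree X n \<omega> = A n"
  proof -
    obtain a where a: "a \<in> A n" "jump_tree X (Suc n) \<omega> = add_child (A n) a"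
      "birth X (next_child (A n) a) \<omega> = birth_enum X (Suc n) \<omega>"
      using jump_tree_Suc[OF reg, of n] unfolding T by metis
    show ?thesis
    proof
      assume "jump_tree X (Suc n) \<omega> = A (Suc n)"
      then have ac: "a = c n" using add_child_inject[OF gn] a A by metis
      show ?first
      proof
        fix b assume b: "b \<in> A n - {c n}"
        then have "next_child (A n) b \<notin> jump_tree X (Suc n) \<omega>"
          using a(2) ac next_child_notin[OF gn, of b] by (auto simp: add_child_eq)
        moreover have "next_child (A n) b \<in> nat_seqs"
          using b by (intro next_child_in_nat_seqs[OF gn]) simp
        ultimately show "birth X (next_child (A n) (c n)) \<omega> < birth X (next_child (A n) b) \<omega>"
          using a(3) ac by (simp add: mem_jump_tree[OF reg] del: append_in_nat_seqs)
      qed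
    next
      assume first: ?first
      have "a = c n"
      proof (rule ccontr)
        assume "a \<noteq> c n"
        then have "birth X (next_child (A n) (c n)) \<omega> < birth_enum X (Suc n) \<omega>"
          using bspec[OF first, of a] a by simp
        then have "next_child (A n) (c n) \<in> jump_tree X (Suc n) \<omega>"
          using next_child_in_nat_seqs[OF gn c]
          by (simp add: mem_jump_tree[OF reg] del: append_in_nat_seqs)
        then show False
          using a(2) \<open>a \<noteq> c n\<close> next_child_notin[OF gn, of "c n"] by (auto simp: add_child_eq)
      qed
      then show "jump_tree X (Suc n) \<omega> = A (Suc n)" using a A by simp
    qed
  qed
  then show ?case
    using Suc.IH[OF hist] unfolding history_event_Suc by (auto simp: le_Suc_eq)
qed

text \<open>The next children are missing from the current jump tree, so they are born after the
  last recorded birth.\<close>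

lemma residual_pos:
  assumes reg: "regular X \<omega>" and hist: "growth_history A c n" and ev: "history_event X A c n \<omega>"
    and b: "b \<in> A n"
  shows "0 < residual X A c n b \<omega>"
proof -
  have T: "\<forall>i\<le>n. jump_tree X i \<omega> = A i"
    using jump_trees_eq_iff[OF reg hist] ev by blast
  have "last_birth X A c n \<omega> = birth_enum X n \<omega>"
  proof (cases n)
    case 0
    then show ?thesis by (simp add: last_birth_def birth_enum_0[OF reg])
  next
    case (Suc m)
    obtain a where a: "jump_tree X (Suc m) \<omega> = add_child (jump_tree X m \<omega>) a"
      "birth X (next_child (jump_tree X m \<omega>) a) \<omega> = birth_enum X (Suc m) \<omega>"
      by (rule jump_tree_Suc[OF reg, of m])
    have "add_child (A m) a = add_child (A m) (c m)"
      using a(1) T hist Suc by (simp add: growth_history_Suc)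
    then have "a = c m"
      using hist Suc growth_history_gn_tree by (intro add_child_inject) (auto simp: growth_history_Suc)
    then show ?thesis using a(2) T Suc by (simp add: last_birth_def)
  qed
  moreover have gn: "gn_tree (A n)" by (rule growth_history_gn_tree[OF hist])
  have "next_child (A n) b \<notin> jump_tree X n \<omega>"
    using T next_child_notin[OF gn] by simp
  ultimately show ?thesis
    using next_child_in_nat_seqs[OF gn b]
    by (simp add: residual_def mem_jump_tree[OF reg] del: append_in_nat_seqs)
qed

section \<open>Competing clocks\<close>

text \<open>A clock \<open>Y\<close> against a competitor whose survival events are \<open>G t\<close>; discretizing \<open>Y\<close> with
  mesh \<open>1 / Suc n\<close> encloses the probability that \<open>Y\<close> rings first between geometric sums.\<close>

lemma (in finite_measure) measure_competing_exponentials: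
  fixes Y :: "'a \<Rightarrow> real" and G :: "real \<Rightarrow> 'a set" and C l m :: real
  assumes Y [measurable]: "Y \<in> borel_measurable M"
    and G [measurable]: "\<And>t. G t \<in> sets M"
    and anti: "\<And>s t. s \<le> t \<Longrightarrow> G t \<subseteq> G s"
    and tail: "\<And>s t. 0 \<le> s \<Longrightarrow> 0 \<le> t \<Longrightarrow>
      measure M {\<omega>\<in>G t. s < Y \<omega>} = C * exp (- l * s) * exp (- m * t)"
    and l: "0 < l" and m: "0 \<le> m"
    and H: "H \<in> sets M" "H = {\<omega>\<in>space M. 0 < Y \<omega> \<and> \<omega> \<in> G (Y \<omega>)}"
  shows "measure M H = C * (l / (l + m))"
proof -
  \<comment> \<open>The upper geometric sum for mesh \<open>h\<close>. As \<open>h\<close> tends to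
    0 the quotient tends to \<open>l / (l + m)\<close>.\<close>
  define q where "q h = C * ((1 - exp (- l * h)) / (1 - exp (- (l + m) * h)))" for h :: real
  have bounds: "exp (- m * (1 / real (Suc n))) * q (1 / real (Suc n)) \<le> measure M H \<and>
      measure M H \<le> q (1 / real (Suc n))" for n
  proof -
    define N where "N = real (Suc n)"
    have N: "0 < N" by (simp add: N_def)
    \<comment> \<open>Slots open on the left and closed on the right are differences of the tail
      events in \<open>tail\<close>, and together they cover exactly the positive values of
      \<open>Y\<close>.\<close>
    define S where "S i = {\<omega>\<in>space M. real i < Y \<omega> * N \<and> Y \<omega> * N \<le> real i + 1}" for i
    have S [measurable]: "S i \<in> sets M" for i unfolding S_def by measurable
    have slot: "measure M (G t \<inter> S i) =
        C * (1 - exp (- l * (1 / N))) * exp (- l * (i / N)) * exp (- m * t)" if t: "0 \<le> t" for t i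
    proof -
      have eq: "G t \<inter> S i = {\<omega>\<in>G t. i / N < Y \<omega>} - {\<omega>\<in>G t. (i + 1) / N < Y \<omega>}"
        using N sets.sets_into_space[OF G[of t]]
        by (auto simp: S_def pos_divide_less_eq not_less pos_le_divide_eq)
      have meas: "{\<omega>\<in>G t. s < Y \<omega>} \<in> sets M" for s
      proof -
        have "{\<omega>\<in>G t. s < Y \<omega>} = G t \<inter> {\<omega>\<in>space M. s < Y \<omega>}"
          using sets.sets_into_space[OF G[of t]] by auto
        then show ?thesis by simp
      qed
      have "measure M (G t \<inter> S i) =
          measure M {\<omega>\<in>G t. i / N < Y \<omega>} - measure M {\<omega>\<in>G t. (i + 1) / N < Y \<omega>}"
        unfolding eq
      proof (rule finite_measure_Diff[OF meas meas])
        have "i / N \<le> (i + 1) / N" using N by (simp add: divide_right_mono)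
        then show "{\<omega>\<in>G t. (i + 1) / N < Y \<omega>} \<subseteq> {\<omega>\<in>G t. i / N < Y \<omega>}" by auto
      qed
      also have "\<dots> = C * exp (- l * (i / N)) * exp (- m * t) - C * exp (- l * ((i + 1) / N)) * exp (- m * t)"
        using t N by (subst (1 2) tail) auto
      also have "exp (- l * ((i + 1) / N)) = exp (- l * (i / N)) * exp (- l * (1 / N))"
        by (simp add: exp_add[symmetric] add_divide_distrib algebra_simps)
      finally show ?thesis by (simp add: algebra_simps)
    qed
    have disj: "disjoint_family S"
      unfolding disjoint_family_on_def
    proof (intro ballI impI)
      fix i j :: nat assume "i \<noteq> j"
      then have "real i + 1 \<le> real j \<or> real j + 1 \<le> real i" by linarith
      then show "S i \<inter> S j = {}" by (auto simp: S_def)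
    qed
    have cover: "H = (\<Union>i. H \<inter> S i)"
    proof -
      have "\<exists>i. \<omega> \<in> S i" if "\<omega> \<in> H" for \<omega>
      proof -
        have pos: "0 < Y \<omega> * N" and sp: "\<omega> \<in> space M" using that N H by auto
        have "1 \<le> \<lceil>Y \<omega> * N\<rceil>" using pos by (simp add: one_le_ceiling)
        then have "real (nat (\<lceil>Y \<omega> * N\<rceil> - 1)) = of_int \<lceil>Y \<omega> * N\<rceil> - 1" by simp
        then have "\<omega> \<in> S (nat (\<lceil>Y \<omega> * N\<rceil> - 1))"
          unfolding S_def using sp ceiling_correct[of "Y \<omega> * N"] by simp
        then show ?thesis ..
      qed
      then show ?thesis by blast
    qed
    have "(\<lambda>i. measure M (H \<inter> S i)) sums measure M (\<Union>i. H \<inter> S i)"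
      using H(1) disj by (intro finite_measure_UNION) (auto simp: disjoint_family_on_def)
    then have sums: "(\<lambda>i. measure M (H \<inter> S i)) sums measure M H"
      using cover by simp
    define x where "x = exp (- (l + m) * (1 / N))"
    have x: "0 < x" "x < 1" using l m N by (auto simp: x_def divide_less_0_iff)
    \<comment> \<open>Since \<open>G\<close> is decreasing, replacing \<open>Y\<close> by the left
      end of its slot enlarges the event, and by the right end shrinks it. The two bounds differ by
      the factor \<open>exp (- m * (1 / N))\<close>, which tends to 1.\<close>
    have up: "measure M (H \<inter> S i) \<le> C * (1 - exp (- l * (1 / N))) * x ^ i" for i
    proof -
      have "H \<inter> S i \<subseteq> G (i / N) \<inter> S i"
      proof
        fix \<omega> assume \<omega>: "\<omega> \<in> H \<inter> S i"
        then have "i / N \<le> Y \<omega>" using N by (simp add: S_def pos_divide_le_eq)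
        then show "\<omega> \<in> G (i / N) \<inter> S i" using \<omega> H(2) anti by blast
      qed
      then have "measure M (H \<inter> S i) \<le> measure M (G (i / N) \<inter> S i)"
        by (rule finite_measure_mono) simp
      also have "\<dots> = C * (1 - exp (- l * (1 / N))) * (exp (- l * (i / N)) * exp (- m * (i / N)))"
        using N by (subst slot) (auto simp: mult.assoc)
      also have "exp (- l * (i / N)) * exp (- m * (i / N)) = x ^ i"
        unfolding x_def exp_of_nat_mult[symmetric] exp_add[symmetric] using N by (simp add: field_simps)
      finally show ?thesis .
    qed
    have low: "exp (- m * (1 / N)) * (C * (1 - exp (- l * (1 / N))) * x ^ i) \<le> measure M (H \<inter> S i)" for i
    proof -
      have "exp (- l * (i / N)) * exp (- m * ((i + 1) / N)) = exp (- m * (1 / N)) * x ^ i"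
        unfolding x_def exp_of_nat_mult[symmetric] exp_add[symmetric] using N by (simp add: field_simps)
      then have "exp (- m * (1 / N)) * (C * (1 - exp (- l * (1 / N))) * x ^ i) =
          C * (1 - exp (- l * (1 / N))) * exp (- l * (i / N)) * exp (- m * ((i + 1) / N))"
        by (simp add: mult.assoc mult.left_commute)
      also have "\<dots> = measure M (G ((i + 1) / N) \<inter> S i)"
        using N by (subst slot) auto
      also have "\<dots> \<le> measure M (H \<inter> S i)"
      proof (rule finite_measure_mono)
        show "G ((i + 1) / N) \<inter> S i \<subseteq> H \<inter> S i"
        proof
          fix \<omega> assume \<omega>: "\<omega> \<in> G ((i + 1) / N) \<inter> S i"
          then have "0 < Y \<omega> * N" "Y \<omega> \<le> (i + 1) / N"
            using N by (auto simp: S_def pos_le_divide_eq)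
          moreover from this N have "0 < Y \<omega>" by (simp add: zero_less_mult_iff)
          ultimately show "\<omega> \<in> H \<inter> S i"
            using \<omega> anti[of "Y \<omega>" "(i + 1) / N"] unfolding H(2) S_def by auto
        qed
      qed (use H(1) in simp)
      finally show ?thesis .
    qed
    have geo: "(\<lambda>i. C * (1 - exp (- l * (1 / N))) * x ^ i) sums q (1 / N)"
      using sums_mult[OF geometric_sums[of x], of "C * (1 - exp (- l * (1 / N)))"] x
      by (simp add: q_def x_def)
    have "measure M H \<le> q (1 / N)"
      by (rule sums_le[OF up sums geo])
    moreover have "exp (- m * (1 / N)) * q (1 / N) \<le> measure M H"
      by (rule sums_le[OF low sums_mult[OF geo] sums])
    ultimately show ?thesis by (simp add: N_def)
  qed
  define L where "L = l + m"
  have L: "0 < L" using l m by (simp add: L_def)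
  have "(\<lambda>n. (1 - exp (- l * (1 / real (Suc n)))) / (1 - exp (- L * (1 / real (Suc n))))) \<longlonglongrightarrow> l * inverse L"
    using l L by real_asymp
  then have lim: "(\<lambda>n. q (1 / real (Suc n))) \<longlonglongrightarrow> C * (l / (l + m))"
    unfolding q_def L_def divide_inverse[of l] by (rule tendsto_mult_left)
  have "(\<lambda>n. - m * (1 / real (Suc n))) \<longlonglongrightarrow> - m * 0"
    by (intro tendsto_mult_left LIMSEQ_Suc[OF lim_const_over_n])
  then have "(\<lambda>n. exp (- m * (1 / real (Suc n)))) \<longlonglongrightarrow> exp (- m * 0)"
    by (rule tendsto_exp)
  from tendsto_mult[OF this lim]
  have lim': "(\<lambda>n. exp (- m * (1 / real (Suc n))) * q (1 / real (Suc n))) \<longlonglongrightarrow> C * (l / (l + m))"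
    by simp
  show ?thesis
  proof (rule antisym)
    show "measure M H \<le> C * (l / (l + m))"
      using bounds by (intro LIMSEQ_le_const[OF lim]) auto
    show "C * (l / (l + m)) \<le> measure M H"
      using bounds by (intro LIMSEQ_le_const2[OF lim']) auto
  qed
qed

lemma growth_history_mono: "growth_history A c n \<Longrightarrow> i \<le> n \<Longrightarrow> growth_history A c i"
  by (simp add: growth_history_def)

lemma tree_clocks_mono:
  "growth_history A c n \<Longrightarrow> i \<le> n \<Longrightarrow> tree_clocks (A i) \<subseteq> tree_clocks (A n)"
proof (induction n)
  case (Suc n)
  have hist: "growth_history A c n" and c: "c n \<in> A n" and A: "A (Suc n) = add_child (A n) (c n)"
    using Suc.prems by (auto simp: growth_history_Suc)
  show ?case
  proof (cases "i = Suc n")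
    case False
    then have "tree_clocks (A i) \<subseteq> tree_clocks (A n)"
      using Suc hist by auto
    also have "\<dots> \<subseteq> tree_clocks (A (Suc n))"
      unfolding A by (rule tree_clocks_add_child[OF growth_history_gn_tree[OF hist] c])
    finally show ?thesis .
  qed simp
qed simp

lemma tree_clocks_subset: "gn_tree A \<Longrightarrow> tree_clocks A \<subseteq> nat_seqs \<times> UNIV"
  using gn_treeD(3)[of A] by (auto simp: tree_clocks_def)

definition history_prob ::
    "(nat \<Rightarrow> real) \<Rightarrow> (nat \<Rightarrow> nat list set) \<Rightarrow> (nat \<Rightarrow> nat list) \<Rightarrow> nat \<Rightarrow> real" where
  "history_prob f A c n =
    (\<Prod>i<n. f (nchildren (A i) (c i)) / (\<Sum>b\<in>A i. f (nchildren (A i) b)))"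

context exponential_clocks
begin

lemma measurable_next_birth:
  assumes hist: "growth_history A c n" and "i \<le> n" and b: "b \<in> A i"
  shows "birth X (next_child (A i) b) \<in> borel_measurable (clock_algebra (tree_clocks (A n)))"
proof (rule measurable_birth)
  have "birth_clocks (next_child (A i) b) \<subseteq> tree_clocks (A i)"
    using growth_history_gn_tree[OF growth_history_mono[OF hist \<open>i \<le> n\<close>]] b
    by (rule birth_clocks_next_child)
  then show "birth_clocks (next_child (A i) b) \<subseteq> tree_clocks (A n)"
    using tree_clocks_mono[OF hist \<open>i \<le> n\<close>] by blast
qed

lemma pred_history_event:
  assumes hist: "growth_history A c n"
  shows "Measurable.pred (clock_algebra (tree_clocks (A n))) (history_event X A c n)"
proof -
  have *: "Measurable.pred (clock_algebra (tree_clocks (A n)))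
      (\<lambda>\<omega>. \<forall>b\<in>A i - {c i}. birth X (next_child (A i) (c i)) \<omega> < birth X (next_child (A i) b) \<omega>)"
    if i: "i < n" for i
  proof (rule pred_intros_countable_bounded)
    fix b assume b: "b \<in> A i - {c i}"
    have "c i \<in> A i" using hist i by (simp add: growth_history_def)
    then show "Measurable.pred (clock_algebra (tree_clocks (A n)))
        (\<lambda>\<omega>. birth X (next_child (A i) (c i)) \<omega> < birth X (next_child (A i) b) \<omega>)"
      using b by (intro borel_measurable_pred_less measurable_next_birth[OF hist less_imp_le[OF i]]) auto
  qed
  have "Measurable.pred (clock_algebra (tree_clocks (A n))) (\<lambda>\<omega>. \<forall>i\<in>{..<n}.
      \<forall>b\<in>A i - {c i}. birth X (next_child (A i) (c i)) \<omega> < birth X (next_child (A i) b) \<omega>)"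
    by (rule pred_intros_countable_bounded) (use * in auto)
  moreover have "history_event X A c n = (\<lambda>\<omega>. \<forall>i\<in>{..<n}.
      \<forall>b\<in>A i - {c i}. birth X (next_child (A i) (c i)) \<omega> < birth X (next_child (A i) b) \<omega>)"
    by (rule ext) (simp only: history_event_def Ball_def lessThan_iff)
  ultimately show ?thesis by (simp only:)
qed

lemma measurable_residual:
  assumes hist: "growth_history A c n" and b: "b \<in> A n"
  shows "residual X A c n b \<in> borel_measurable (clock_algebra (tree_clocks (A n)))"
proof -
  have [measurable]: "last_birth X A c n \<in> borel_measurable (clock_algebra (tree_clocks (A n)))"
  proof (cases n)
    case 0
    then show ?thesis by (simp add: last_birth_def[abs_def])
  next
    case (Suc m)
    then have "c m \<in> A m" using hist by (simp add: growth_history_def)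
    then show ?thesis
      using measurable_next_birth[OF hist, of m "c m"] Suc by (simp add: last_birth_def[abs_def])
  qed
  note [measurable] = measurable_next_birth[OF hist order_refl b]
  show ?thesis
    unfolding residual_def[abs_def] by measurable
qed

text \<open>Memorylessness; the induction hypothesis supplies the joint tails that the competition between
  the clocks depends on.\<close>

lemma prob_residuals:
  assumes reg: "AE \<omega> in M. regular X \<omega>"
  shows "growth_history A c n \<Longrightarrow> (\<And>b. 0 \<le> r b) \<Longrightarrow>
    prob {\<omega>\<in>space M. history_event X A c n \<omega> \<and> (\<forall>b\<in>A n. r b < residual X A c n b \<omega>)} =
    history_prob f A c n * (\<Prod>b\<in>A n. exp (- f (nchildren (A n) b) * r b))"
proof (induction n arbitrary: r)
  case 0
  have "residual X A c 0 [] \<omega> = X [] 0 \<omega>" for \<omega>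
    using 0 birth_snoc[of X "[]" 1 \<omega>]
    by (simp add: residual_def last_birth_def growth_history_def nchildren_singleton)
  then show ?case
    using 0 prob_clock_gt[of "[]" "r []" 0]
    by (simp add: growth_history_def history_event_def history_prob_def nchildren_singleton)
next
  case (Suc n)
  define T where "T = A n"
  define a where "a = c n"
  define v where "v = next_child T a"
  define d where "d = nchildren T a"
  define lam where "lam b = f (nchildren T b)" for b
  have hist: "growth_history A c n" and a: "a \<in> T" and A: "A (Suc n) = add_child T a"
    using Suc.prems by (auto simp: growth_history_Suc T_def a_def)
  have gn: "gn_tree T" unfolding T_def by (rule growth_history_gn_tree[OF hist])
  have fin: "finite T" by (rule gn_treeD[OF gn])
  have v: "v \<notin> T" "v \<noteq> a" unfolding v_def using next_child_notin[OF gn] a by auto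
  have A': "A (Suc n) = insert v T" unfolding A v_def by (rule add_child_eq)
  let ?R = "residual X A c n"
  note r = Suc.prems(2)
  \<comment> \<open>If \<open>a\<close> rings after a further time \<open>t\<close>, every other
    clock has \<open>t\<close> less to run; exceeding \<open>r b\<close> afterwards means exceeding
    \<open>t + r b\<close> now.\<close>
  define G where "G t = {\<omega>\<in>space M. history_event X A c n \<omega> \<and> (\<forall>b\<in>T - {a}. t + r b < ?R b \<omega>)}" for t
  define H where "H = {\<omega>\<in>space M. 0 < ?R a \<omega> \<and> \<omega> \<in> G (?R a \<omega>)}"
  define K where "K = history_prob f A c n * (\<Prod>b\<in>T - {a}. exp (- lam b * r b))"
  have [measurable]: "Measurable.pred (clock_algebra (tree_clocks T)) (history_event X A c n)"
    unfolding T_def by (rule pred_history_event[OF hist])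
  have R [measurable]: "?R b \<in> borel_measurable (clock_algebra (tree_clocks T))" if "b \<in> T" for b
    using measurable_residual[OF hist, of b] that by (simp add: T_def)
  have sub: "tree_clocks T \<subseteq> nat_seqs \<times> UNIV" by (rule tree_clocks_subset[OF gn])
  have Ra [measurable]: "?R a \<in> borel_measurable (clock_algebra (tree_clocks T))" using a by (rule R)
  have G_meas: "G t \<in> sets (clock_algebra (tree_clocks T))" for t
  proof -
    have "Measurable.pred (clock_algebra (tree_clocks T)) (\<lambda>\<omega>. \<forall>b\<in>T - {a}. t + r b < ?R b \<omega>)"
    proof (rule pred_intros_countable_bounded)
      fix b assume "b \<in> T - {a}"
      then have [measurable]: "?R b \<in> borel_measurable (clock_algebra (tree_clocks T))" by (intro R) simp
      show "Measurable.pred (clock_algebra (tree_clocks T)) (\<lambda>\<omega>. t + r b < ?R b \<omega>)" by measurable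
    qed
    note [measurable] = this
    have "{\<omega>\<in>space (clock_algebra (tree_clocks T)). history_event X A c n \<omega> \<and>
        (\<forall>b\<in>T - {a}. t + r b < ?R b \<omega>)} \<in> sets (clock_algebra (tree_clocks T))"
      by measurable
    then show ?thesis unfolding G_def by simp
  qed
  have H_meas: "H \<in> sets (clock_algebra (tree_clocks T))"
  proof -
    have "Measurable.pred (clock_algebra (tree_clocks T)) (\<lambda>\<omega>. \<forall>b\<in>T - {a}. ?R a \<omega> + r b < ?R b \<omega>)"
    proof (rule pred_intros_countable_bounded)
      fix b assume "b \<in> T - {a}"
      then have [measurable]: "?R b \<in> borel_measurable (clock_algebra (tree_clocks T))" by (intro R) simp
      show "Measurable.pred (clock_algebra (tree_clocks T)) (\<lambda>\<omega>. ?R a \<omega> + r b < ?R b \<omega>)" by measurable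
    qed
    note [measurable] = this
    have "{\<omega>\<in>space (clock_algebra (tree_clocks T)). 0 < ?R a \<omega> \<and> history_event X A c n \<omega> \<and>
        (\<forall>b\<in>T - {a}. ?R a \<omega> + r b < ?R b \<omega>)} \<in> sets (clock_algebra (tree_clocks T))"
      by measurable
    moreover have "H = {\<omega>\<in>space (clock_algebra (tree_clocks T)). 0 < ?R a \<omega> \<and>
        history_event X A c n \<omega> \<and> (\<forall>b\<in>T - {a}. ?R a \<omega> + r b < ?R b \<omega>)}"
      unfolding H_def G_def by auto
    ultimately show ?thesis by (simp only:)
  qed
  have to_M: "S \<in> sets (clock_algebra (tree_clocks T)) \<Longrightarrow> S \<in> sets M" for S
    using sets_clock_algebra_subset[OF sub] by blast
  have "prob H = K * (lam a / (lam a + (\<Sum>b\<in>T - {a}. lam b)))"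
  proof (rule measure_competing_exponentials[where Y="?R a" and G=G])
    show "?R a \<in> borel_measurable M" by (rule measurable_clock_algebra[OF Ra sub])
    show "G t \<in> sets M" for t by (rule to_M[OF G_meas])
    show "G t \<subseteq> G s" if "s \<le> t" for s t
    proof
      fix \<omega> assume \<omega>: "\<omega> \<in> G t"
      have "s + r b < ?R b \<omega>" if "b \<in> T - {a}" for b
        using \<omega> that \<open>s \<le> t\<close> unfolding G_def mem_Collect_eq by (meson add_right_mono le_less_trans)
      then show "\<omega> \<in> G s" using \<omega> unfolding G_def by blast
    qed
    show "H \<in> sets M" by (rule to_M[OF H_meas])
    show "0 < lam a" "0 \<le> (\<Sum>b\<in>T - {a}. lam b)"
      using f_pos by (auto simp: lam_def intro: sum_nonneg less_imp_le)
    fix s t :: real assume st: "0 \<le> s" "0 \<le> t"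
    \<comment> \<open>The induction hypothesis at these shifted thresholds is exactly the joint tail
      required for the competition between \<open>a\<close> and the rest of the tree.\<close>
    let ?r = "\<lambda>b. if b = a then s else t + r b"
    have "{\<omega>\<in>G t. s < ?R a \<omega>} =
        {\<omega>\<in>space M. history_event X A c n \<omega> \<and> (\<forall>b\<in>A n. ?r b < ?R b \<omega>)}"
      using a unfolding G_def T_def[symmetric] by auto
    then have "prob {\<omega>\<in>G t. s < ?R a \<omega>} = history_prob f A c n * (\<Prod>b\<in>T. exp (- lam b * ?r b))"
      using Suc.IH[OF hist, of ?r] st r by (simp add: lam_def T_def)
    also have "(\<Prod>b\<in>T. exp (- lam b * ?r b)) =
        exp (- lam a * s) * (\<Prod>b\<in>T - {a}. exp (- lam b * ?r b))"
      using fin a by (subst prod.remove) auto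
    also have "(\<Prod>b\<in>T - {a}. exp (- lam b * ?r b)) =
        (\<Prod>b\<in>T - {a}. exp (- lam b * r b) * exp (- lam b * t))"
      by (intro prod.cong) (auto simp: exp_add[symmetric] algebra_simps)
    also have "\<dots> = (\<Prod>b\<in>T - {a}. exp (- lam b * r b)) * exp (- (\<Sum>b\<in>T - {a}. lam b) * t)"
      using fin by (simp add: prod.distrib exp_sum[symmetric] sum_distrib_right sum_negf)
    finally show "prob {\<omega>\<in>G t. s < ?R a \<omega>} = K * exp (- lam a * s) * exp (- (\<Sum>b\<in>T - {a}. lam b) * t)"
      by (simp add: K_def mult_ac)
  qed (rule H_def)
  also have "lam a + (\<Sum>b\<in>T - {a}. lam b) = (\<Sum>b\<in>T. lam b)"
    by (rule sum.remove[OF fin a, symmetric])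
  finally have prob_H: "prob H = K * (lam a / (\<Sum>b\<in>T. lam b))" .
  \<comment> \<open>After the birth of \<open>v\<close> two fresh clocks start: the next one of
    \<open>a\<close> and the first one of \<open>v\<close>. Neither lies in
    \<open>tree_clocks T\<close>, so both are independent of \<open>H\<close>.\<close>
  define Q1 where "Q1 = {\<omega>\<in>space M. r a < X a (Suc d) \<omega>}"
  define Q2 where "Q2 = {\<omega>\<in>space M. r v < X v 0 \<omega>}"
  have a_seq: "a \<in> nat_seqs" and v_seq: "v \<in> nat_seqs"
    using gn_treeD(3)[OF gn] a next_child_in_nat_seqs[OF gn a] by (auto simp: v_def)
  have Q: "{\<omega>\<in>space M. s < X b j \<omega>} \<in> sets (clock_algebra J)" if "(b, j) \<in> J" for b j J s
  proof -
    note [measurable] = measurable_clock[OF that]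
    have "{\<omega>\<in>space (clock_algebra J). s < X b j \<omega>} \<in> sets (clock_algebra J)" by measurable
    then show ?thesis by simp
  qed
  have Q_meas: "Q1 \<in> sets M" "Q2 \<in> sets M"
    unfolding Q1_def Q2_def
    using a_seq v_seq
    by (auto intro!: subsetD[OF sets_clock_algebra_subset[OF order_refl] Q])
  have "prob (H \<inter> (Q1 \<inter> Q2)) = prob H * prob (Q1 \<inter> Q2)"
  proof (rule prob_clock_algebras)
    show "tree_clocks T \<inter> {(a, Suc d), (v, 0)} = {}"
      using v by (auto simp: tree_clocks_def d_def)
    show "{(a, Suc d), (v, 0)} \<subseteq> nat_seqs \<times> UNIV" using a_seq v_seq by auto
    show "Q1 \<inter> Q2 \<in> sets (clock_algebra {(a, Suc d), (v, 0)})"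
      unfolding Q1_def Q2_def by (intro sets.Int Q) auto
  qed (use sub H_meas in auto)
  also have "prob (Q1 \<inter> Q2) = prob Q1 * prob Q2"
  proof (rule prob_clock_algebras)
    show "{(a, Suc d)} \<inter> {(v, 0)} = {}" by simp
    show "{(a, Suc d)} \<subseteq> nat_seqs \<times> UNIV" "{(v, 0)} \<subseteq> nat_seqs \<times> UNIV"
      using a_seq v_seq by auto
    show "Q1 \<in> sets (clock_algebra {(a, Suc d)})" "Q2 \<in> sets (clock_algebra {(v, 0)})"
      unfolding Q1_def Q2_def by (intro Q, simp)+
  qed
  also have "prob Q1 = exp (- f (Suc d) * r a)"
    unfolding Q1_def by (rule prob_clock_gt[OF a_seq r])
  also have "prob Q2 = exp (- f 0 * r v)"
    unfolding Q2_def by (rule prob_clock_gt[OF v_seq r])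
  finally have prob_HQ: "prob (H \<inter> (Q1 \<inter> Q2)) =
      K * (lam a / (\<Sum>b\<in>T. lam b)) * (exp (- f (Suc d) * r a) * exp (- f 0 * r v))"
    unfolding prob_H .
  define E where "E = {\<omega>\<in>space M. history_event X A c (Suc n) \<omega> \<and>
    (\<forall>b\<in>A (Suc n). r b < residual X A c (Suc n) b \<omega>)}"
  have nc: "nchildren (A (Suc n)) b = (if b = a then Suc d else nchildren T b)" for b
    unfolding A d_def by (rule nchildren_add_child[OF gn])
  have nc_v: "nchildren (A (Suc n)) v = 0"
    using v nchildren_notin[OF gn v(1)] by (simp add: nc)
  have last: "last_birth X A c (Suc n) \<omega> = birth X v \<omega>" for \<omega>
    by (simp add: last_birth_def v_def T_def a_def)
  have res_a: "residual X A c (Suc n) a \<omega> = X a (Suc d) \<omega>" for \<omega>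
    using birth_snoc_Suc[of X a "Suc d" \<omega>] by (simp add: residual_def last nc v_def d_def)
  have res_v: "residual X A c (Suc n) v \<omega> = X v 0 \<omega>" for \<omega>
    using birth_snoc_Suc[of X v 0 \<omega>] by (simp add: residual_def last nc_v birth_snoc)
  have next_b: "birth X (next_child T b) \<omega> = birth X v \<omega> + (?R b \<omega> - ?R a \<omega>)" for b \<omega>
    by (simp add: residual_def v_def T_def a_def)
  have res_b: "residual X A c (Suc n) b \<omega> = ?R b \<omega> - ?R a \<omega>" if "b \<noteq> a" for b \<omega>
    using that next_b[of b \<omega>] by (simp add: residual_def[of X A c "Suc n"] last nc)
  have ev: "history_event X A c (Suc n) \<omega> \<longleftrightarrow>
      history_event X A c n \<omega> \<and> (\<forall>b\<in>T - {a}. ?R a \<omega> < ?R b \<omega>)" for \<omega>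
    unfolding history_event_Suc T_def[symmetric] a_def[symmetric] next_b by simp
  \<comment> \<open>Regularity enters because \<open>H\<close> asks for a positive residual of
    \<open>a\<close>, which \<open>residual_pos\<close> provides on the history event.\<close>
  have E_iff: "\<omega> \<in> E \<longleftrightarrow> \<omega> \<in> H \<inter> (Q1 \<inter> Q2)" if \<omega>: "regular X \<omega>" for \<omega>
  proof -
    let ?late = "\<forall>b\<in>T - {a}. ?R a \<omega> + r b < ?R b \<omega>"
    have 1: "0 < ?R a \<omega>" if "history_event X A c n \<omega>"
      using residual_pos[OF \<omega> hist that] a by (simp add: T_def)
    have split: "(\<forall>b\<in>insert v (insert a S). P b) \<longleftrightarrow> P v \<and> P a \<and> (\<forall>b\<in>S. P b)" for P S
      by blast
    have A_split: "A (Suc n) = insert v (insert a (T - {a}))" using A' a by auto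
    have "(\<forall>b\<in>T - {a}. r b < residual X A c (Suc n) b \<omega>) \<longleftrightarrow> ?late"
    proof (rule ball_cong[OF refl])
      fix b assume "b \<in> T - {a}"
      then have "b \<noteq> a" by blast
      then show "(r b < residual X A c (Suc n) b \<omega>) = (?R a \<omega> + r b < ?R b \<omega>)"
        unfolding res_b[OF \<open>b \<noteq> a\<close>] by linarith
    qed
    then have 2: "(\<forall>b\<in>A (Suc n). r b < residual X A c (Suc n) b \<omega>) \<longleftrightarrow>
        r v < X v 0 \<omega> \<and> r a < X a (Suc d) \<omega> \<and> ?late"
      unfolding A_split split res_a res_v by (simp only:)
    have 3: "\<forall>b\<in>T - {a}. ?R a \<omega> < ?R b \<omega>" if late: ?late
    proof
      fix b assume "b \<in> T - {a}"
      then have "?R a \<omega> + r b < ?R b \<omega>" using late by blast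
      then show "?R a \<omega> < ?R b \<omega>" using r[of b] by linarith
    qed
    show ?thesis
      unfolding E_def H_def G_def Q1_def Q2_def mem_Collect_eq Int_iff ev 2 using 1 3 by argo
  qed
  have E_meas: "E \<in> sets M"
  proof -
    let ?N = "clock_algebra (tree_clocks (A (Suc n)))"
    have "Measurable.pred ?N (\<lambda>\<omega>. \<forall>b\<in>A (Suc n). r b < residual X A c (Suc n) b \<omega>)"
      by (intro pred_intros_countable_bounded borel_measurable_pred_less borel_measurable_const
          measurable_residual[OF Suc.prems(1)])
    then have "Measurable.pred ?N (\<lambda>\<omega>. history_event X A c (Suc n) \<omega> \<and>
        (\<forall>b\<in>A (Suc n). r b < residual X A c (Suc n) b \<omega>))"
      by (intro pred_intros_logic pred_history_event[OF Suc.prems(1)])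
    then have "E \<in> sets ?N"
      unfolding E_def Measurable.pred_def by simp
    then show ?thesis
      using sets_clock_algebra_subset[OF tree_clocks_subset[OF growth_history_gn_tree[OF Suc.prems(1)]]]
      by blast
  qed
  have "prob E = prob (H \<inter> (Q1 \<inter> Q2))"
  proof (rule measure_eq_AE)
    show "AE \<omega> in M. \<omega> \<in> E \<longleftrightarrow> \<omega> \<in> H \<inter> (Q1 \<inter> Q2)"
      using reg by eventually_elim (rule E_iff)
    show "H \<inter> (Q1 \<inter> Q2) \<in> sets M"
      using to_M[OF H_meas] Q_meas by blast
  qed (rule E_meas)
  also have "\<dots> = history_prob f A c (Suc n) *
      (exp (- f 0 * r v) * (exp (- f (Suc d) * r a) * (\<Prod>b\<in>T - {a}. exp (- lam b * r b))))"
    unfolding prob_HQ K_def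
    by (simp add: history_prob_def T_def[symmetric] a_def[symmetric] lam_def)
  also have "exp (- f 0 * r v) * (exp (- f (Suc d) * r a) * (\<Prod>b\<in>T - {a}. exp (- lam b * r b))) =
      (\<Prod>b\<in>A (Suc n). exp (- f (nchildren (A (Suc n)) b) * r b))"
  proof -
    let ?g = "\<lambda>b. exp (- f (nchildren (A (Suc n)) b) * r b)"
    have 1: "prod ?g (A (Suc n)) = ?g v * (?g a * prod ?g (T - {a}))"
      unfolding A' prod.insert[OF fin v(1)] prod.remove[OF fin a] by (rule refl)
    have 2: "prod ?g (T - {a}) = (\<Prod>b\<in>T - {a}. exp (- lam b * r b))"
      by (intro prod.cong) (auto simp: nc lam_def)
    have 3: "?g v = exp (- f 0 * r v)" by (simp only: nc_v)
    have 4: "?g a = exp (- f (Suc d) * r a)" by (simp add: nc)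
    show ?thesis unfolding 1 2 3 4 by (rule refl)
  qed
  finally have "prob E = history_prob f A c (Suc n) *
      (\<Prod>b\<in>A (Suc n). exp (- f (nchildren (A (Suc n)) b) * r b))" .
  then show ?case by (simp only: E_def)
qed

end

section \<open>The law of the jump trees\<close>

lemma space_tree_path_space [simp]: "space tree_path_space = UNIV"
  by (auto simp: tree_path_space_def space_PiM)

lemma sets_tree_path_cylinder: "{x. \<forall>i\<le>n. x i = A i} \<in> sets tree_path_space"
proof -
  have "{x. \<forall>i\<le>n. x i = A i} = (\<Inter>i\<in>{..n}. {x\<in>space tree_path_space. x i \<in> {A i}})"
    by auto
  also have "\<dots> \<in> sets tree_path_space"
    unfolding tree_path_space_def
    by (intro sets.finite_INT measurable_sets_Collect[OF measurable_component_singleton])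
       (auto simp: singleton_tree_space)
  finally show ?thesis .
qed

text \<open>Point cylinders do not generate the whole sigma-algebra. Up to a null set, though, each
  finite-dimensional event is a countable disjoint union of point cylinders with entries in
  \<open>C\<close>, on which the measures agree.\<close>

lemma tree_path_measure_eqI:
  assumes P: "prob_space P" "sets P = sets tree_path_space"
    and Q: "prob_space Q" "sets Q = sets tree_path_space"
    and C: "countable C" "AE x in P. \<forall>i. x i \<in> C"
    and eq: "\<And>A n. emeasure P {x. \<forall>i\<le>n. x i = A i} = emeasure Q {x. \<forall>i\<le>n. x i = A i}"
  shows "P = Q"
proof (rule measure_eqI_PiM_infinite)
  show "sets P = sets (PiM UNIV (\<lambda>_. tree_space))" "sets Q = sets (PiM UNIV (\<lambda>_. tree_space))"
    using P Q by (simp_all add: tree_path_space_def)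
  show "finite_measure P" using P by (simp add: prob_space_def)
next
  fix J :: "nat set" and F :: "nat \<Rightarrow> nat list set set"
  assume J: "finite J" and F: "\<And>i. i \<in> J \<Longrightarrow> F i \<in> sets tree_space"
  let ?B = "prod_emb UNIV (\<lambda>_. tree_space) J (Pi\<^sub>E J F)"
  have spaces: "space P = UNIV" "space Q = UNIV"
    using sets_eq_imp_space_eq[OF P(2)] sets_eq_imp_space_eq[OF Q(2)] by auto
  have B: "?B = {x. \<forall>j\<in>J. x j \<in> F j}"
    by (auto simp: prod_emb_def space_PiM PiE_iff)
  have B_sets: "?B \<in> sets tree_path_space"
    unfolding tree_path_space_def using J F by (intro sets_PiM_I) auto
  obtain n where n: "J \<subseteq> {..n}"
    using finite_nat_iff_bounded_le J by auto
  define cyl where "cyl A = {x. \<forall>i\<le>n. x i = A i}" for A :: "nat \<Rightarrow> nat list set"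
  \<comment> \<open>Extensional representatives ensure that distinct members of \<open>W\<close>
    differ at some index up to \<open>n\<close>, so that their cylinders are disjoint.\<close>
  define W where "W = Pi\<^sub>E {..n} (\<lambda>_. C)"
  have W: "countable W" unfolding W_def using C(1) by (intro countable_PiE) auto
  have disj: "disjoint_family_on cyl V" if "V \<subseteq> W" for V
    unfolding disjoint_family_on_def
  proof (intro ballI impI)
    fix A A' assume "A \<in> V" "A' \<in> V" "A \<noteq> A'"
    then have "A \<in> Pi\<^sub>E {..n} (\<lambda>_. C)" "A' \<in> Pi\<^sub>E {..n} (\<lambda>_. C)"
      using that unfolding W_def by blast+
    then have "\<exists>i\<in>{..n}. A i \<noteq> A' i"
      using PiE_ext \<open>A \<noteq> A'\<close> by metis
    then obtain i where "i \<le> n" "A i \<noteq> A' i" by blast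
    then show "cyl A \<inter> cyl A' = {}" by (auto simp: cyl_def)
  qed
  have union: "emeasure P (\<Union>A\<in>V. cyl A) = emeasure Q (\<Union>A\<in>V. cyl A)" if V: "V \<subseteq> W" for V
  proof -
    have "emeasure P (\<Union>A\<in>V. cyl A) = (\<integral>\<^sup>+A. emeasure P (cyl A) \<partial>count_space V)"
      using V W P(2) sets_tree_path_cylinder
      by (intro emeasure_UN_countable disj) (auto simp: cyl_def intro: countable_subset)
    also have "\<dots> = (\<integral>\<^sup>+A. emeasure Q (cyl A) \<partial>count_space V)"
      by (simp add: cyl_def eq)
    also have "\<dots> = emeasure Q (\<Union>A\<in>V. cyl A)"
      using V W Q(2) sets_tree_path_cylinder
      by (intro emeasure_UN_countable[symmetric] disj) (auto simp: cyl_def intro: countable_subset)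
    finally show ?thesis .
  qed
  have U_sets: "(\<Union>A\<in>V. cyl A) \<in> sets tree_path_space" if V: "V \<subseteq> W" for V
    unfolding cyl_def using countable_subset[OF V W] sets_tree_path_cylinder
    by (intro sets.countable_UN') auto
  have restrict: "x \<in> (\<Union>A\<in>W. cyl A) \<longleftrightarrow> (\<forall>i\<le>n. x i \<in> C)" for x
  proof
    assume "\<forall>i\<le>n. x i \<in> C"
    then have "restrict x {..n} \<in> W" "x \<in> cyl (restrict x {..n})"
      by (auto simp: W_def cyl_def)
    then show "x \<in> (\<Union>A\<in>W. cyl A)" by blast
  qed (auto simp: W_def cyl_def PiE_iff)
  have AE_P: "AE x in P. x \<in> (\<Union>A\<in>W. cyl A)"
    using C(2) by eventually_elim (simp only: restrict, blast)
  \<comment> \<open>The support transfers to \<open>Q\<close>: the cylinders with entries in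
    \<open>C\<close> have the same total mass 1 under both measures.\<close>
  have "emeasure Q (\<Union>A\<in>W. cyl A) = emeasure P (\<Union>A\<in>W. cyl A)"
    using union by simp
  also have "\<dots> = 1"
    using prob_space.emeasure_eq_1_AE[OF P(1) _ AE_P] U_sets[of W] P(2) by simp
  finally have "emeasure Q (\<Union>A\<in>W. cyl A) = 1" .
  then have AE_Q: "AE x in Q. x \<in> (\<Union>A\<in>W. cyl A)"
    using prob_space.AE_in_set_eq_1[OF Q(1), of "\<Union>A\<in>W. cyl A"] U_sets[of W] Q(2)
    by (simp add: measure_def)
  let ?V = "{A\<in>W. \<forall>j\<in>J. A j \<in> F j}"
  have in_V: "x \<in> ?B \<longleftrightarrow> x \<in> (\<Union>A\<in>?V. cyl A)" if x: "x \<in> (\<Union>A\<in>W. cyl A)" for x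
  proof
    assume xB: "x \<in> ?B"
    obtain A where A: "A \<in> W" "x \<in> cyl A" using x by blast
    then have "\<forall>j\<in>J. A j = x j" using n by (auto simp: cyl_def)
    then show "x \<in> (\<Union>A\<in>?V. cyl A)" using A xB unfolding B by auto
  next
    assume "x \<in> (\<Union>A\<in>?V. cyl A)"
    then obtain A where A: "A \<in> ?V" "x \<in> cyl A" by blast
    then have "\<forall>j\<in>J. x j = A j" using n by (auto simp: cyl_def)
    then show "x \<in> ?B" using A unfolding B by auto
  qed
  have V: "?V \<subseteq> W" by blast
  have "emeasure P ?B = emeasure P (\<Union>A\<in>?V. cyl A)"
    using AE_P in_V B_sets U_sets[OF V] P(2) by (intro emeasure_eq_AE) (auto elim: AE_mp)
  also have "\<dots> = emeasure Q (\<Union>A\<in>?V. cyl A)" by (rule union[OF V])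
  also have "\<dots> = emeasure Q ?B"
    using AE_Q in_V B_sets U_sets[OF V] Q(2) by (intro emeasure_eq_AE) (auto elim: AE_mp)
  finally show "emeasure P ?B = emeasure Q ?B" .
qed

lemma sets_GN_law [simp]: "sets (GN_law f) = sets tree_path_space"
  by (simp add: GN_law_def)

text \<open>The total mass of the projective limit is computed on coordinate 0 alone, as the full
  cylinder over it is the whole space.\<close>

lemma prob_space_GN_law: "prob_space (GN_law f)"
proof -
  let ?N = "\<lambda>_::nat. count_space UNIV :: nat list set measure"
  have "emeasure (GN.PF.lim f) (prod_emb UNIV ?N {0} (space (PiM {0} ?N))) =
      emeasure (GN.CI f {0}) (space (PiM {0} ?N))"
    by (rule GN.lim) auto
  also have "\<dots> = 1"
    using prob_space.emeasure_space_1[OF GN.PF.prob_space_P[of "{0}" f]] by (simp add: GN.PF.space_P)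
  also have "prod_emb UNIV ?N {0} (space (PiM {0} ?N)) = space (GN.PF.lim f)"
    by (auto simp: prod_emb_def space_PiM)
  finally have "prob_space (GN.PF.lim f)" by (rule prob_spaceI)
  moreover have "(\<lambda>x. x) \<in> GN.PF.lim f \<rightarrow>\<^sub>M tree_path_space"
  proof -
    have "(\<lambda>x. x) \<in> PiM UNIV ?N \<rightarrow>\<^sub>M tree_path_space"
      unfolding tree_path_space_def
    proof (rule measurable_PiM_single')
      fix i :: nat
      have "(\<lambda>x. x i) \<in> PiM UNIV ?N \<rightarrow>\<^sub>M count_space UNIV"
        by (rule measurable_component_singleton) simp
      then show "(\<lambda>x. x i) \<in> PiM UNIV ?N \<rightarrow>\<^sub>M tree_space"
        by (rule measurable_compose) simp
    qed (auto simp: space_PiM)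
    then show ?thesis
      unfolding measurable_cong_sets[OF GN.PF.sets_lim refl] .
  qed
  ultimately show ?thesis
    unfolding GN_law_def by (rule prob_space.prob_space_distr)
qed

lemma GN_trans_growth:
  assumes gn: "gn_tree A" and a: "a \<in> A"
  shows "GN_trans f A (add_child A a) = f (nchildren A a) / (\<Sum>b\<in>A. f (nchildren A b))"
  using add_child_inject[OF gn] by (intro GN_trans_unique[OF a refl]) metis

context exponential_clocks
begin

text \<open>Along a growth history the event is almost surely the history event, to which
  \<open>prob_residuals\<close> applies. Any other path has probability 0 on the left; on the right,
  either the start is wrong or some step is not the addition of a child and contributes a zero
  factor.\<close>

lemma prob_jump_trees:
  assumes reg: "AE \<omega> in M. regular X \<omega>"
  shows "prob {\<omega>\<in>space M. \<forall>i\<le>n. jump_tree X i \<omega> = A i} =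
    (if A 0 = {[]} then \<Prod>i<n. GN_trans f (A i) (A (Suc i)) else 0)"
proof -
  let ?E = "{\<omega>\<in>space M. \<forall>i\<le>n. jump_tree X i \<omega> = A i}"
  have E: "?E \<in> sets M"
  proof -
    have "?E = (\<lambda>\<omega> n. jump_tree X n \<omega>) -` {x. \<forall>i\<le>n. x i = A i} \<inter> space M" by auto
    then show ?thesis
      using measurable_sets[OF measurable_jump_trees sets_tree_path_cylinder[of n A]] by (simp only:)
  qed
  show ?thesis
  proof (cases "\<exists>c. growth_history A c n")
    case True
    then obtain c where hist: "growth_history A c n" ..
    \<comment> \<open>Positivity of the residuals, almost surely implied by the history event, is
      added in order to match \<open>prob_residuals\<close> with all thresholds 0.\<close>
    let ?H = "{\<omega>\<in>space M. history_event X A c n \<omega> \<and> (\<forall>b\<in>A n. 0 < residual X A c n b \<omega>)}"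
    let ?N = "clock_algebra (tree_clocks (A n))"
    have "Measurable.pred ?N (\<lambda>\<omega>. \<forall>b\<in>A n. 0 < residual X A c n b \<omega>)"
      by (intro pred_intros_countable_bounded borel_measurable_pred_less borel_measurable_const
          measurable_residual[OF hist])
    then have "Measurable.pred ?N (\<lambda>\<omega>. history_event X A c n \<omega> \<and> (\<forall>b\<in>A n. 0 < residual X A c n b \<omega>))"
      by (intro pred_intros_logic pred_history_event[OF hist])
    then have "?H \<in> sets ?N"
      unfolding Measurable.pred_def by simp
    then have H: "?H \<in> sets M"
      using sets_clock_algebra_subset[OF tree_clocks_subset[OF growth_history_gn_tree[OF hist]]]
      by blast
    have "AE \<omega> in M. \<omega> \<in> ?E \<longleftrightarrow> \<omega> \<in> ?H"
      using reg
    proof eventually_elim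
      case (elim \<omega>)
      then show ?case
        using jump_trees_eq_iff[OF elim hist] residual_pos[OF elim hist] by blast
    qed
    then have "prob ?E = prob ?H"
      using E H by (rule measure_eq_AE)
    also have "\<dots> = history_prob f A c n"
      using prob_residuals[OF reg hist, of "\<lambda>_. 0"] by simp
    also have "\<dots> = (\<Prod>i<n. GN_trans f (A i) (A (Suc i)))"
      unfolding history_prob_def
    proof (rule prod.cong)
      fix i assume "i \<in> {..<n}"
      then have i: "c i \<in> A i" "A (Suc i) = add_child (A i) (c i)" "growth_history A c i"
        using hist by (auto simp: growth_history_def)
      show "f (nchildren (A i) (c i)) / (\<Sum>b\<in>A i. f (nchildren (A i) b)) =
          GN_trans f (A i) (A (Suc i))"
        unfolding i(2) using GN_trans_growth[OF growth_history_gn_tree[OF i(3)] i(1), of f] by (rule sym)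
    qed simp
    finally show ?thesis
      using hist by (simp add: growth_history_def)
  next
    case False
    have "\<not> (\<forall>i\<le>n. jump_tree X i \<omega> = A i)" if \<omega>: "regular X \<omega>" for \<omega>
    proof
      assume T: "\<forall>i\<le>n. jump_tree X i \<omega> = A i"
      have "\<exists>c. c \<in> A i \<and> A (Suc i) = add_child (A i) c" if "i < n" for i
      proof (rule jump_tree_Suc[OF \<omega>, of i])
        fix a assume "a \<in> jump_tree X i \<omega>" "jump_tree X (Suc i) \<omega> = add_child (jump_tree X i \<omega>) a"
        moreover have "jump_tree X i \<omega> = A i" "jump_tree X (Suc i) \<omega> = A (Suc i)" using T that by auto
        ultimately show ?thesis by metis
      qed
      then obtain c where "\<And>i. i < n \<Longrightarrow> c i \<in> A i \<and> A (Suc i) = add_child (A i) (c i)" by metis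
      then have "growth_history A c n"
        using T jump_tree_0[OF \<omega>] by (auto simp: growth_history_def)
      then show False using False by blast
    qed
    note no_history = this
    have "AE \<omega> in M. \<omega> \<notin> ?E"
      using reg by eventually_elim (use no_history in blast)
    then have "prob ?E = 0"
      using E by (subst prob_eq_0)
    moreover have "(\<Prod>i<n. GN_trans f (A i) (A (Suc i))) = 0" if "A 0 = {[]}"
    proof -
      have "\<exists>i<n. \<forall>a\<in>A i. A (Suc i) \<noteq> add_child (A i) a"
      proof (rule ccontr)
        assume "\<not> ?thesis"
        then have "\<forall>i. \<exists>a. i < n \<longrightarrow> a \<in> A i \<and> A (Suc i) = add_child (A i) a" by blast
        then obtain c where "\<And>i. i < n \<Longrightarrow> c i \<in> A i \<and> A (Suc i) = add_child (A i) (c i)" by metis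
        then have "growth_history A c n" using that by (auto simp: growth_history_def)
        then show False using False by blast
      qed
      then obtain i where "i < n" "\<forall>a\<in>A i. A (Suc i) \<noteq> add_child (A i) a" by blast
      then show ?thesis by (intro prod_zero) (auto intro!: bexI[of _ i] GN_trans_eq_0)
    qed
    ultimately show ?thesis by auto
  qed
qed

lemma distr_jump_trees:
  assumes reg: "AE \<omega> in M. regular X \<omega>"
  shows "distr M tree_path_space (\<lambda>\<omega> n. jump_tree X n \<omega>) = GN_law f"
proof (rule tree_path_measure_eqI)
  let ?T = "\<lambda>\<omega> n. jump_tree X n \<omega>"
  note T = measurable_jump_trees
  show "prob_space (distr M tree_path_space ?T)" by (rule prob_space_distr[OF T])
  show "prob_space (GN_law f)" by (rule prob_space_GN_law)
  show C: "countable (Collect finite :: nat list set set)"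
    by (rule countable_Collect_finite)
  have "AE \<omega> in M. \<forall>i. ?T \<omega> i \<in> Collect finite"
    using reg by eventually_elim (simp add: finite_jump_tree)
  moreover have "{x\<in>space tree_path_space. \<forall>i. x i \<in> (Collect finite :: nat list set set)} \<in> sets tree_path_space"
  proof -
    have "(Collect finite :: nat list set set) = (\<Union>A\<in>Collect finite. {A})" by auto
    also have "\<dots> \<in> sets tree_space"
      using C singleton_tree_space by (intro sets.countable_UN') auto
    finally have fin: "(Collect finite :: nat list set set) \<in> sets tree_space" .
    show ?thesis
      unfolding tree_path_space_def
      by (intro sets.sets_Collect_countable_All measurable_sets_Collect[OF measurable_component_singleton])
         (use fin in auto)
  qed
  ultimately show "AE x in distr M tree_path_space ?T. \<forall>i. x i \<in> Collect finite"
    by (subst AE_distr_iff[OF T]) auto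
  show "emeasure (distr M tree_path_space ?T) {x. \<forall>i\<le>n. x i = A i} =
      emeasure (GN_law f) {x. \<forall>i\<le>n. x i = A i}" for A n
  proof -
    have "measure (distr M tree_path_space ?T) {x. \<forall>i\<le>n. x i = A i} =
        prob {\<omega>\<in>space M. \<forall>i\<le>n. jump_tree X i \<omega> = A i}"
      unfolding measure_distr[OF T sets_tree_path_cylinder]
      by (rule arg_cong[where f=prob]) auto
    also have "\<dots> = measure (GN_law f) {x. \<forall>i\<le>n. x i = A i}"
      unfolding prob_jump_trees[OF reg] by (rule measure_GN_law[symmetric]) (rule f_pos)
    finally have "measure (distr M tree_path_space ?T) {x. \<forall>i\<le>n. x i = A i} =
        measure (GN_law f) {x. \<forall>i\<le>n. x i = A i}" .
    then show ?thesis
      by (simp only: finite_measure.emeasure_eq_measure[OF prob_space.finite_measure[OF prob_space_GN_law]]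
          finite_measure.emeasure_eq_measure[OF prob_space.finite_measure[OF prob_space_distr[OF T]]])
  qed
qed simp_all

lemma AE_regular:
  assumes "\<And>j. 0 \<le> w j" "summable w"
    and "\<And>e. 0 < e \<Longrightarrow> summable (\<lambda>j. real j * exp (- f j * (e * w j)))"
  shows "AE \<omega> in M. regular X \<omega>"
proof -
  have "AE \<omega> in M. \<forall>t. ereal t < tree_explosion X \<omega> \<longrightarrow> finite {a\<in>nat_seqs. birth X a \<omega> \<le> t}"
    using assms by (rule AE_finite_alive)
  with AE_positive_clocks AE_inj_birth AE_birth_neq_tree_explosion show ?thesis
    by eventually_elim (simp add: regular_def)
qed

end

theorem theorem4p3:
  fixes M :: "'w measure"
    and X :: "nat list \<Rightarrow> nat \<Rightarrow> 'w \<Rightarrow> real"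
    and p :: real
    and f :: "nat \<Rightarrow> real"
  assumes p: "1 < p"
    and f: "f = (\<lambda>j. (real j + 1) powr p)"
    and M: "prob_space M"
    and indep: "prob_space.indep_vars M (\<lambda>_. borel) (\<lambda>(a, j). X a j) (nat_seqs \<times> UNIV)"
    and exponential:
      "\<And>a j. a \<in> nat_seqs \<Longrightarrow> distributed M lborel (X a j) (exponential_density (f j))"
  shows "(\<lambda>\<omega> n. jump_tree X n \<omega>) \<in> M \<rightarrow>\<^sub>M tree_path_space
    \<and> distr M tree_path_space (\<lambda>\<omega> n. jump_tree X n \<omega>) = GN_law f
    \<and> (AE \<omega> in M. incseq (\<lambda>n. jump_tree X n \<omega>)
         \<and> (\<Union>n. jump_tree X n \<omega>) = alive X (tree_explosion X \<omega>) \<omega>)"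
proof -
  interpret prob_space M by (rule M)
  interpret exponential_clocks M X f
    by unfold_locales (use indep exponential in \<open>auto simp: f\<close>)
  \<comment> \<open>An exponent strictly between 1 and \<open>p\<close>: above 1 the shares
    \<open>w\<close> are summable, and below \<open>p\<close> the product \<open>f j * w j\<close>
    still grows like a positive power of \<open>j\<close>, here with exponent
    \<open>(p - 1) / 2\<close>.\<close>
  define q where "q = (1 + p) / 2"
  define w where "w j = (real j + 1) powr (- q)" for j :: nat
  have reg: "AE \<omega> in M. regular X \<omega>"
  proof (rule AE_regular)
    show "0 \<le> w j" for j by (simp add: w_def)
    have "summable (\<lambda>j. real (Suc j) powr (- q))"
      using p by (subst summable_Suc_iff) (simp add: summable_real_powr_iff q_def)
    then show "summable w" by (simp add: w_def[abs_def] add.commute)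
    fix e :: real assume e: "0 < e"
    have "- f j * (e * w j) = - e * (real j + 1) powr ((p - 1) / 2)" for j
    proof -
      have "(real j + 1) powr p * (real j + 1) powr (- q) = (real j + 1) powr ((p - 1) / 2)"
        by (simp add: powr_add[symmetric] q_def field_simps)
      then show ?thesis by (simp add: f w_def)
    qed
    then show "summable (\<lambda>j. real j * exp (- f j * (e * w j)))"
      using summable_stretched_exponential[OF e, of "(p - 1) / 2"] p by (simp only:) simp
  qed
  moreover from reg have "AE \<omega> in M. incseq (\<lambda>n. jump_tree X n \<omega>)
      \<and> (\<Union>n. jump_tree X n \<omega>) = alive X (tree_explosion X \<omega>) \<omega>"
    by eventually_elim (simp add: incseq_jump_tree Union_jump_tree)
  ultimately show ?thesis
    using measurable_jump_trees distr_jump_trees by blast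
qed

end
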